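(* Let $(X,G)$ be a minimal dynamical system with an ergodic invariant measure $\mu$. Suppose $H$ is an almost normal finite subgroup of $G$ such that, for every $x\in X$, the point $x$ has trivial holonomy if and only if $G_x=gHg^{-1}$ for some $g\in G$. Suppose, in addition, that $G$ is not allosteric and that $N_G(H)/H$ is commensurable to $N_G(H)$. Then: (1) The IRS associated to $(X,G,\mu)$ is an atomic probability measure on $S(G)$. (2) The IRS associated to $(X,G,\mu)$ is supported on the stabilizer URS of $(X,G)$, i.e. $(X,G,\mu)$ has no essential holonomy.
   Context: A dynamical system $(X,G)$ is a countable discrete finitely generated group $G$ acting by homeomorphisms on a compact Hausdorff space $X$. It is minimal if $X$ is the only non-empty closed $G$-invariant subset of $X$. An invariant measure is a $G$-invariant Borel probability measure $\mu$ on $X$; it is ergodic if $\mu(A)\in\{0,1\}$ for every invariant Borel set $A$. The stabilizer of $x\in X$ is $G_x=\{g\in G: gx=x\}$. A subgroup $H$ of $G$ is almost normal if its normalizer $N_G(H)$ has finite index in $G$. A point $x\in X$ has trivial holonomy if for every $g\in G_x$ there is an open neighborhood $V$ of $x$ such that $g$ fixes every point of $V$. $(X,G,\mu)$ has no essential holonomy if $\mu$-a.e. point has trivial holonomy. $S(G)$ is the space of all subgroups of $G$ with the Chabauty--Fell topology, whose basic open sets are $U(A,B)=\{K\in S(G): A\subset K,\ B\cap K=\emptyset\}$ for finite $A,B\subset G$; $G$ acts on $S(G)$ by conjugation. The stabilizer URS of a minimal $(X,G)$ is the closure in $S(G)$ of $\{G_x : x \text{ has trivial holonomy}\}$; it is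 the unique minimal closed conjugation-invariant subset of the closure of $\{G_x:x\in X\}$. The IRS associated to $(X,G,\mu)$ is the push-forward $\nu=\mathrm{Stab}_*\mu$ under the Borel map $\mathrm{Stab}:X\to S(G)$, $x\mapsto G_x$. $\nu$ is atomic if $\nu(\{K\})>0$ for some $K\in S(G)$; $\nu$ is supported on the stabilizer URS if that set has $\nu$-measure $1$. $(X,G)$ is topologically free if the set of points with trivial stabilizer is residual; $(X,G,\mu)$ is essentially free if $\mu$-a.e. point has trivial stabilizer. A group $G$ is allosteric if there is a minimal topologically free action of $G$ on a compact Hausdorff space, with an ergodic measure with respect to which it is not essentially free. Groups $G_1,G_2$ are commensurable if they have isomorphic finite index subgroups. *)

theory Defs
  imports
    "HOL-Algebra.Group_Action"
    "HOL-Algebra.Generated_Groups"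
    "HOL-Probability.Probability_Measure"
begin

no_notation Congruence.eq_closure_of (\<open>closure'_of\<index>\<close>)

section \<open>Groups\<close>

definition finitely_generated :: "('g, 'c) monoid_scheme \<Rightarrow> bool" where
  "finitely_generated G \<longleftrightarrow> (\<exists>S. finite S \<and> S \<subseteq> carrier G \<and> generate G S = carrier G)"

definition finite_index :: "('g, 'c) monoid_scheme \<Rightarrow> 'g set \<Rightarrow> bool" where
  "finite_index G K \<longleftrightarrow> subgroup K G \<and> finite (rcosets\<^bsub>G\<^esub> K)"

definition almost_normal :: "('g, 'c) monoid_scheme \<Rightarrow> 'g set \<Rightarrow> bool" where
  "almost_normal G H \<longleftrightarrow> subgroup H G \<and> finite_index G (normalizer G H)"

definition commensurable :: "('g, 'c) monoid_scheme \<Rightarrow> ('h, 'd) monoid_scheme \<Rightarrow> bool" where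
  "commensurable G\<^sub>1 G\<^sub>2 \<longleftrightarrow>
     (\<exists>K\<^sub>1 K\<^sub>2. finite_index G\<^sub>1 K\<^sub>1 \<and> finite_index G\<^sub>2 K\<^sub>2 \<and>
        G\<^sub>1\<lparr>carrier := K\<^sub>1\<rparr> \<cong> G\<^sub>2\<lparr>carrier := K\<^sub>2\<rparr>)"


section \<open>Dynamical systems\<close>

definition dynamical_system ::
  "('g, 'c) monoid_scheme \<Rightarrow> 'x topology \<Rightarrow> ('g \<Rightarrow> 'x \<Rightarrow> 'x) \<Rightarrow> bool" where
  "dynamical_system G X \<phi> \<longleftrightarrow>
     countable (carrier G) \<and> finitely_generated G \<and>
     compact_space X \<and> Hausdorff_space X \<and>
     group_action G (topspace X) \<phi> \<and>
     (\<forall>g\<in>carrier G. homeomorphic_map X X (\<phi> g))"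

definition invariant_set :: "('g, 'c) monoid_scheme \<Rightarrow> ('g \<Rightarrow> 'x \<Rightarrow> 'x) \<Rightarrow> 'x set \<Rightarrow> bool" where
  "invariant_set G \<phi> A \<longleftrightarrow> (\<forall>g\<in>carrier G. \<phi> g ` A = A)"

definition minimal_system ::
  "('g, 'c) monoid_scheme \<Rightarrow> 'x topology \<Rightarrow> ('g \<Rightarrow> 'x \<Rightarrow> 'x) \<Rightarrow> bool" where
  "minimal_system G X \<phi> \<longleftrightarrow>
     dynamical_system G X \<phi> \<and> topspace X \<noteq> {} \<and>
     (\<forall>C. closedin X C \<and> C \<noteq> {} \<and> invariant_set G \<phi> C \<longrightarrow> C = topspace X)"

definition trivial_holonomy ::
  "('g, 'c) monoid_scheme \<Rightarrow> 'x topology \<Rightarrow> ('g \<Rightarrow> 'x \<Rightarrow> 'x) \<Rightarrow> 'x \<Rightarrow> bool" where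
  "trivial_holonomy G X \<phi> x \<longleftrightarrow>
     (\<forall>g\<in>stabilizer G \<phi> x. \<exists>V. openin X V \<and> x \<in> V \<and> (\<forall>y\<in>V. \<phi> g y = y))"

definition residual_in :: "'x topology \<Rightarrow> 'x set \<Rightarrow> bool" where
  "residual_in X S \<longleftrightarrow> S \<subseteq> topspace X \<and>
     (\<exists>U :: nat \<Rightarrow> 'x set.
        (\<forall>n. openin X (U n) \<and> X closure_of U n = topspace X) \<and> (\<Inter>n. U n) \<subseteq> S)"

definition topologically_free ::
  "('g, 'c) monoid_scheme \<Rightarrow> 'x topology \<Rightarrow> ('g \<Rightarrow> 'x \<Rightarrow> 'x) \<Rightarrow> bool" where
  "topologically_free G X \<phi> \<longleftrightarrow>
     residual_in X {x \<in> topspace X. stabilizer G \<phi> x = {\<one>\<^bsub>G\<^esub>}}"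


section \<open>Invariant measures\<close>

definition borel_of :: "'x topology \<Rightarrow> 'x measure" where
  "borel_of X = sigma (topspace X) {U. openin X U}"

text \<open>No regularity is imposed on Borel measures, even if \<open>X\<close> is not metrizable.\<close>

definition invariant_measure ::
  "('g, 'c) monoid_scheme \<Rightarrow> 'x topology \<Rightarrow> ('g \<Rightarrow> 'x \<Rightarrow> 'x) \<Rightarrow> 'x measure \<Rightarrow> bool" where
  "invariant_measure G X \<phi> \<mu> \<longleftrightarrow>
     prob_space \<mu> \<and> sets \<mu> = sets (borel_of X) \<and>
     (\<forall>g\<in>carrier G. \<forall>A\<in>sets \<mu>. emeasure \<mu> (\<phi> g ` A) = emeasure \<mu> A)"

definition ergodic_measure ::
  "('g, 'c) monoid_scheme \<Rightarrow> 'x topology \<Rightarrow> ('g \<Rightarrow> 'x \<Rightarrow> 'x) \<Rightarrow> 'x measure \<Rightarrow> bool" where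
  "ergodic_measure G X \<phi> \<mu> \<longleftrightarrow>
     invariant_measure G X \<phi> \<mu> \<and>
     (\<forall>A\<in>sets \<mu>. invariant_set G \<phi> A \<longrightarrow> measure \<mu> A \<in> {0, 1})"

definition no_essential_holonomy ::
  "('g, 'c) monoid_scheme \<Rightarrow> 'x topology \<Rightarrow> ('g \<Rightarrow> 'x \<Rightarrow> 'x) \<Rightarrow> 'x measure \<Rightarrow> bool" where
  "no_essential_holonomy G X \<phi> \<mu> \<longleftrightarrow> (AE x in \<mu>. trivial_holonomy G X \<phi> x)"

definition essentially_free ::
  "('g, 'c) monoid_scheme \<Rightarrow> ('g \<Rightarrow> 'x \<Rightarrow> 'x) \<Rightarrow> 'x measure \<Rightarrow> bool" where
  "essentially_free G \<phi> \<mu> \<longleftrightarrow> (AE x in \<mu>. stabilizer G \<phi> x = {\<one>\<^bsub>G\<^esub>})"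


section \<open>The space of subgroups, stabilizer URS and IRS\<close>

definition chabauty_fell :: "('g, 'c) monoid_scheme \<Rightarrow> 'g set topology" where
  "chabauty_fell G = topology_generated_by
     {{K. subgroup K G \<and> A \<subseteq> K \<and> B \<inter> K = {}} | A B.
        finite A \<and> A \<subseteq> carrier G \<and> finite B \<and> B \<subseteq> carrier G}"

definition stabilizer_URS ::
  "('g, 'c) monoid_scheme \<Rightarrow> 'x topology \<Rightarrow> ('g \<Rightarrow> 'x \<Rightarrow> 'x) \<Rightarrow> 'g set set" where
  "stabilizer_URS G X \<phi> =
     chabauty_fell G closure_of (stabilizer G \<phi> ` {x \<in> topspace X. trivial_holonomy G X \<phi> x})"

definition IRS ::
  "('g, 'c) monoid_scheme \<Rightarrow> ('g \<Rightarrow> 'x \<Rightarrow> 'x) \<Rightarrow> 'x measure \<Rightarrow> 'g set measure" where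
  "IRS G \<phi> \<mu> = distr \<mu> (borel_of (chabauty_fell G)) (stabilizer G \<phi>)"

definition atomic :: "'a measure \<Rightarrow> bool" where
  "atomic \<nu> \<longleftrightarrow> (\<exists>K\<in>space \<nu>. measure \<nu> {K} > 0)"


section \<open>Allosteric groups\<close>

text \<open>
  HOL cannot quantify over the carrier type of the space, so it is fixed to \<open>nat set set\<close>.
  This loses no system: a minimal system of a countable group has a countable dense orbit, so its
  space, being separable and Hausdorff, has at most as many points as \<open>nat set set\<close>, and the
  system can be transported there. See \<open>allostericI\<close> below.
\<close>

definition allosteric :: "('g, 'c) monoid_scheme \<Rightarrow> bool" where
  "allosteric G \<longleftrightarrow>
     (\<exists>(X :: nat set set topology) \<phi> \<mu>.
        minimal_system G X \<phi> \<and> topologically_free G X \<phi> \<and>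
        ergodic_measure G X \<phi> \<mu> \<and> \<not> essentially_free G \<phi> \<mu>)"


lemma space_borel_of: "space (borel_of X) = topspace X"
  unfolding borel_of_def by (rule space_measure_of) (auto dest: openin_subset)

lemma sets_borel_of: "sets (borel_of X) = sigma_sets (topspace X) {U. openin X U}"
  unfolding borel_of_def by (rule sets_measure_of) (auto dest: openin_subset)

lemma continuous_map_measurable:
  assumes "continuous_map X Y f"
  shows "f \<in> measurable (borel_of X) (borel_of Y)"
proof (rule measurable_sigma_sets[OF sets_borel_of])
  show "{U. openin Y U} \<subseteq> Pow (topspace Y)" by (auto dest: openin_subset)
  show "f \<in> space (borel_of X) \<rightarrow> topspace Y"
    using assms by (auto simp: space_borel_of continuous_map_def)
  fix U assume "U \<in> {U. openin Y U}"
  then have "openin X (f -` U \<inter> topspace X)"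
    using openin_continuous_map_preimage[OF assms, of U]
    by (simp add: vimage_def Int_def conj_commute)
  then show "f -` U \<inter> space (borel_of X) \<in> sets (borel_of X)"
    by (auto simp: space_borel_of sets_borel_of)
qed

lemma minimal_system_card:
  fixes X :: "'x topology"
  assumes "minimal_system G X \<phi>"
  shows "\<exists>f :: 'x \<Rightarrow> nat set set. inj_on f (topspace X)"
proof -
  have ds: "countable (carrier G)" "Hausdorff_space X" "group_action G (topspace X) \<phi>"
    and hom: "\<And>g. g \<in> carrier G \<Longrightarrow> homeomorphic_map X X (\<phi> g)"
    and ne: "topspace X \<noteq> {}"
    and min: "\<And>C. closedin X C \<Longrightarrow> C \<noteq> {} \<Longrightarrow> invariant_set G \<phi> C \<Longrightarrow> C = topspace X"
    using assms unfolding minimal_system_def dynamical_system_def by blast+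
  interpret group_action G "topspace X" \<phi> by (rule ds(3))
  have grp: "group G" using group_hom unfolding group_hom_def by blast
  obtain x where x: "x \<in> topspace X" using ne by blast
  define D where "D = orbit G \<phi> x"
  have Dimg: "D = (\<lambda>g. \<phi> g x) ` carrier G" by (auto simp: D_def orbit_def)
  have cD: "countable D" unfolding Dimg using ds(1) by simp
  have xD: "x \<in> D" unfolding D_def by (rule orbit_refl[OF x])
  have Dsub: "D \<subseteq> topspace X" unfolding Dimg using element_image x by blast
  have invD: "\<phi> g ` D = D" if g: "g \<in> carrier G" for g
  proof
    show sub: "\<phi> g ` D \<subseteq> D"
    proof
      fix y assume "y \<in> \<phi> g ` D"
      then obtain h where h: "h \<in> carrier G" "y = \<phi> g (\<phi> h x)" unfolding Dimg by blast
      then have "y = \<phi> (g \<otimes>\<^bsub>G\<^esub> h) x" using composition_rule[OF x g h(1)] by simp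
      then show "y \<in> D" unfolding Dimg using grp g h(1) group.is_monoid monoid.m_closed by fastforce
    qed
    show "D \<subseteq> \<phi> g ` D"
    proof
      fix y assume "y \<in> D"
      then obtain h where h: "h \<in> carrier G" "y = \<phi> h x" unfolding Dimg by blast
      have c: "inv\<^bsub>G\<^esub> g \<otimes>\<^bsub>G\<^esub> h \<in> carrier G"
        using grp g h(1) by (simp add: group.is_monoid monoid.m_closed group.inv_closed)
      have "\<phi> g (\<phi> (inv\<^bsub>G\<^esub> g \<otimes>\<^bsub>G\<^esub> h) x) = \<phi> (g \<otimes>\<^bsub>G\<^esub> (inv\<^bsub>G\<^esub> g \<otimes>\<^bsub>G\<^esub> h)) x"
        using composition_rule[OF x g c] by simp
      also have "g \<otimes>\<^bsub>G\<^esub> (inv\<^bsub>G\<^esub> g \<otimes>\<^bsub>G\<^esub> h) = h"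
        using grp g h(1) by (metis group.inv_closed group.r_inv group.is_monoid monoid.m_assoc monoid.l_one)
      finally show "y \<in> \<phi> g ` D" unfolding Dimg using h c by force
    qed
  qed
  have "invariant_set G \<phi> (X closure_of D)"
    unfolding invariant_set_def
    using homeomorphic_map_closure_of[OF hom Dsub] invD by metis
  then have dense: "X closure_of D = topspace X"
    using min[of "X closure_of D"] closure_of_subset[OF Dsub] xD by auto
  define c where "c = to_nat_on D"
  have injc: "inj_on c D" unfolding c_def using cD by (rule inj_on_to_nat_on)
  define f where "f y = {c ` (D \<inter> U) | U. openin X U \<and> y \<in> U}" for y
  have "inj_on f (topspace X)"
  proof (rule inj_onI, rule ccontr)
    fix y z assume y: "y \<in> topspace X" and z: "z \<in> topspace X" and eq: "f y = f z" and yz: "y \<noteq> z"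
    obtain U V where UV: "openin X U" "openin X V" "y \<in> U" "z \<in> V" "disjnt U V"
      using ds(2) y z yz unfolding Hausdorff_space_def by metis
    have "c ` (D \<inter> U) \<in> f y"
      unfolding f_def by (rule CollectI, rule exI[of _ U]) (simp add: UV(1,3))
    then have "c ` (D \<inter> U) \<in> f z" by (simp only: eq)
    then obtain W where W: "openin X W" "z \<in> W" "c ` (D \<inter> U) = c ` (D \<inter> W)"
      unfolding f_def by (elim CollectE exE conjE)
    have DUW: "D \<inter> U = D \<inter> W" using W(3) inj_on_image_eq_iff[OF injc, of "D \<inter> U" "D \<inter> W"] by simp
    have "openin X (W \<inter> V)" "z \<in> W \<inter> V" using W UV by auto
    moreover have "\<forall>T. z \<in> T \<and> openin X T \<longrightarrow> (\<exists>d. d \<in> D \<and> d \<in> T)"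
      using z unfolding dense[symmetric] by (simp add: in_closure_of)
    ultimately obtain d where d: "d \<in> D" "d \<in> W" "d \<in> V" by auto
    have "d \<in> U" using d(1,2) DUW by auto
    then show False using d(3) UV(5) by (auto simp: disjnt_def)
  qed
  then show ?thesis by blast
qed

lemma allostericI:
  fixes X :: "'x topology"
  assumes "minimal_system G X \<phi>" "topologically_free G X \<phi>"
    "ergodic_measure G X \<phi> \<mu>" "\<not> essentially_free G \<phi> \<mu>"
  shows "allosteric G"
proof -
  obtain f :: "'x \<Rightarrow> nat set set" where inj: "inj_on f (topspace X)"
    using minimal_system_card[OF assms(1)] by blast
  define T where "T = f ` topspace X"
  define k where "k = inv_into (topspace X) f"
  define Y where "Y = pullback_topology T k X"
  define \<psi> where "\<psi> g = (\<lambda>y\<in>T. f (\<phi> g (k y)))" for g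
  define \<nu> where "\<nu> = distr \<mu> (borel_of Y) f"
  have kf: "k (f x) = x" if "x \<in> topspace X" for x
    using that inj by (simp add: k_def)
  have kT: "k y \<in> topspace X" and fk: "f (k y) = y" if "y \<in> T" for y
    using that kf by (auto simp: T_def)
  have fT: "f x \<in> T" if "x \<in> topspace X" for x using that by (simp add: T_def)
  have topY: "topspace Y = T" unfolding Y_def topspace_pullback_topology using kT by auto
  have ck: "continuous_map Y X k"
    using continuous_map_pullback[OF continuous_map_id] unfolding Y_def by (metis id_comp)
  have cf: "continuous_map X Y f"
    unfolding Y_def
  proof (rule continuous_map_pullback')
    show "continuous_map X X (k \<circ> f)"
      using kf by (intro continuous_map_eq[OF continuous_map_id]) auto
    show "topspace X \<subseteq> f -` T" using fT by blast
  qed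
  have hm: "homeomorphic_maps X Y f k"
    unfolding homeomorphic_maps_def using ck cf kf fk topY by auto
  have hf: "homeomorphic_map X Y f" and hk: "homeomorphic_map Y X k"
    using hm homeomorphic_maps_map by blast+

  have ds: "countable (carrier G)" "finitely_generated G" "compact_space X" "Hausdorff_space X"
      "group_action G (topspace X) \<phi>"
    and hom: "\<And>g. g \<in> carrier G \<Longrightarrow> homeomorphic_map X X (\<phi> g)"
    and ne: "topspace X \<noteq> {}"
    and min: "\<And>C. closedin X C \<Longrightarrow> C \<noteq> {} \<Longrightarrow> invariant_set G \<phi> C \<Longrightarrow> C = topspace X"
    using assms(1) unfolding minimal_system_def dynamical_system_def by blast+
  interpret group_action G "topspace X" \<phi> by (rule ds(5))
  have grp: "group G" using group_hom unfolding group_hom_def by blast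
  have el: "\<phi> g x \<in> topspace X" if "g \<in> carrier G" "x \<in> topspace X" for g x
    using element_image that by blast
  have hom': "homeomorphic_map Y Y (\<psi> g)" if g: "g \<in> carrier G" for g
  proof (rule homeomorphic_map_eq)
    show "homeomorphic_map Y Y (f \<circ> (\<phi> g \<circ> k))"
      by (rule homeomorphic_map_compose[OF homeomorphic_map_compose[OF hk hom[OF g]] hf])
  qed (auto simp: topY \<psi>_def)
  have act: "group_action G (topspace Y) \<psi>"
    unfolding group_action_def group_hom_def group_hom_axioms_def
  proof (intro conjI grp group_BijGroup)
    have bij: "\<psi> g \<in> Bij T" if g: "g \<in> carrier G" for g
      using homeomorphic_imp_injective_map[OF hom'[OF g]] homeomorphic_imp_surjective_map[OF hom'[OF g]]
      unfolding Bij_def bij_betw_def topY by (simp add: \<psi>_def)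
    show "\<psi> \<in> hom G (BijGroup (topspace Y))"
    proof (rule homI)
      fix g assume "g \<in> carrier G"
      then show "\<psi> g \<in> carrier (BijGroup (topspace Y))" using bij by (simp add: BijGroup_def topY)
    next
      fix g h assume g: "g \<in> carrier G" and h: "h \<in> carrier G"
      have "\<psi> (g \<otimes>\<^bsub>G\<^esub> h) = compose T (\<psi> g) (\<psi> h)"
      proof
        fix y show "\<psi> (g \<otimes>\<^bsub>G\<^esub> h) y = compose T (\<psi> g) (\<psi> h) y"
          using composition_rule[OF kT g h] el[OF h kT]
          by (auto simp: \<psi>_def compose_def fT kf)
      qed
      then show "\<psi> (g \<otimes>\<^bsub>G\<^esub> h) = \<psi> g \<otimes>\<^bsub>BijGroup (topspace Y)\<^esub> \<psi> h"
        using bij[OF g] bij[OF h] by (simp add: BijGroup_def topY)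
    qed
  qed
  have hs: "X homeomorphic_space Y" using hm unfolding homeomorphic_space_def by blast
  have dsY: "dynamical_system G Y \<psi>"
    unfolding dynamical_system_def
    using ds hom' act homeomorphic_compact_space[OF hs] homeomorphic_Hausdorff_space[OF hs] by blast
  have \<psi>f: "\<psi> g (f x) = f (\<phi> g x)" if "x \<in> topspace X" for g x
    using that by (simp add: \<psi>_def fT kf)
  have inv_k: "invariant_set G \<phi> (k ` C)" if C: "C \<subseteq> T" and i: "invariant_set G \<psi> C" for C
    unfolding invariant_set_def
  proof
    fix g assume g: "g \<in> carrier G"
    have "\<phi> g (k y) = k (\<psi> g y)" if "y \<in> C" for y
      using that C kT el[OF g] by (auto simp: \<psi>_def kf subset_iff)
    then have "\<phi> g ` k ` C = k ` \<psi> g ` C" by (auto simp: image_image)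
    then show "\<phi> g ` k ` C = k ` C" using i g by (simp add: invariant_set_def)
  qed
  have fkC: "f ` k ` C = C" if "C \<subseteq> T" for C using that fk by (force simp: image_image)
  have minY: "minimal_system G Y \<psi>"
    unfolding minimal_system_def
  proof (intro conjI dsY allI impI)
    show "topspace Y \<noteq> {}" using ne by (simp add: topY T_def)
    fix C assume C: "closedin Y C \<and> C \<noteq> {} \<and> invariant_set G \<psi> C"
    then have CT: "C \<subseteq> T" using closedin_subset topY by blast
    have "closedin X (k ` C)" using C CT homeomorphic_map_closedness_eq[OF hk] topY by blast
    then have "k ` C = topspace X" using min C inv_k[OF CT] by simp
    then show "C = topspace Y" using fkC[OF CT] by (simp add: topY T_def)
  qed
  have stab: "stabilizer G \<psi> (f x) = stabilizer G \<phi> x" if x: "x \<in> topspace X" for x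
    unfolding stabilizer_def using el[OF _ x] inj x by (auto simp: \<psi>f[OF x] inj_on_eq_iff)

  have tfY: "topologically_free G Y \<psi>"
  proof -
    obtain U :: "nat \<Rightarrow> 'x set" where U: "\<And>n. openin X (U n)" "\<And>n. X closure_of U n = topspace X"
      "(\<Inter>n. U n) \<subseteq> {x \<in> topspace X. stabilizer G \<phi> x = {\<one>\<^bsub>G\<^esub>}}"
      using assms(2) unfolding topologically_free_def residual_in_def by blast
    have sub: "U n \<subseteq> topspace X" for n using U(1) openin_subset by blast
    have "openin Y (f ` U n)" for n using U(1) sub homeomorphic_map_openness_eq[OF hf] by blast
    moreover have "Y closure_of (f ` U n) = topspace Y" for n
      using homeomorphic_map_closure_of[OF hf sub] U(2) by (simp add: topY T_def)
    moreover have "(\<Inter>n. f ` U n) \<subseteq> {y \<in> topspace Y. stabilizer G \<psi> y = {\<one>\<^bsub>G\<^esub>}}"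
    proof
      fix y assume y: "y \<in> (\<Inter>n. f ` U n)"
      then obtain x where x: "x \<in> U 0" "y = f x" by blast
      then have xX: "x \<in> topspace X" using sub by blast
      have "x \<in> U n" for n
      proof -
        obtain x' where "x' \<in> U n" "y = f x'" using y by blast
        then show ?thesis using inj sub x xX by (metis inj_onD subsetD)
      qed
      then have "stabilizer G \<phi> x = {\<one>\<^bsub>G\<^esub>}" using U(3) by blast
      then show "y \<in> {y \<in> topspace Y. stabilizer G \<psi> y = {\<one>\<^bsub>G\<^esub>}}"
        using stab[OF xX] x fT[OF xX] by (simp add: topY)
    qed
    ultimately show ?thesis
      unfolding topologically_free_def residual_in_def
      by (intro conjI exI[of _ "\<lambda>n. f ` U n"]) auto
  qed

  have ps: "prob_space \<mu>" and sm: "sets \<mu> = sets (borel_of X)"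
    and inv: "\<And>g A. g \<in> carrier G \<Longrightarrow> A \<in> sets \<mu> \<Longrightarrow> emeasure \<mu> (\<phi> g ` A) = emeasure \<mu> A"
    and erg: "\<And>A. A \<in> sets \<mu> \<Longrightarrow> invariant_set G \<phi> A \<Longrightarrow> measure \<mu> A \<in> {0, 1}"
    using assms(3) unfolding ergodic_measure_def invariant_measure_def by blast+
  have sp: "space \<mu> = topspace X" using sets_eq_imp_space_eq[OF sm] space_borel_of by metis
  have mf: "f \<in> measurable \<mu> (borel_of Y)"
    using continuous_map_measurable[OF cf] measurable_cong_sets[OF sm refl] by blast
  have sn: "sets \<nu> = sets (borel_of Y)" by (simp add: \<nu>_def)
  have ssub: "A \<subseteq> T" if "A \<in> sets \<nu>" for A
    using sets.sets_into_space[OF that] by (simp add: \<nu>_def space_borel_of topY)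
  have vim: "f -` A \<inter> space \<mu> = k ` A" if "A \<subseteq> T" for A
    unfolding sp using that kT fk kf by (auto simp: subset_iff image_iff) metis
  have em: "emeasure \<nu> A = emeasure \<mu> (k ` A)" and mk: "k ` A \<in> sets \<mu>" if A: "A \<in> sets \<nu>" for A
  proof -
    have A': "A \<in> sets (borel_of Y)" using A sn by simp
    show "emeasure \<nu> A = emeasure \<mu> (k ` A)"
      unfolding \<nu>_def emeasure_distr[OF mf A'] vim[OF ssub[OF A]] ..
    show "k ` A \<in> sets \<mu>" using measurable_sets[OF mf A'] vim[OF ssub[OF A]] by simp
  qed
  have meas_img: "\<psi> g ` A \<in> sets \<nu>" if g: "g \<in> carrier G" and A: "A \<in> sets \<nu>" for g A
  proof -
    obtain p where p: "homeomorphic_maps Y Y (\<psi> g) p"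
      using hom'[OF g] homeomorphic_map_maps by blast
    then have "continuous_map Y Y p" unfolding homeomorphic_maps_def by blast
    then have "p -` A \<inter> space (borel_of Y) \<in> sets (borel_of Y)"
      using measurable_sets[OF continuous_map_measurable] A sn by blast
    moreover have "p -` A \<inter> space (borel_of Y) = \<psi> g ` A"
    proof -
      have "\<And>y. y \<in> T \<Longrightarrow> p (\<psi> g y) = y \<and> \<psi> g (p y) = y \<and> \<psi> g y \<in> T \<and> p y \<in> T"
        using p unfolding homeomorphic_maps_def continuous_map_def topY by auto
      then show ?thesis using ssub[OF A] unfolding space_borel_of topY
        by (auto simp: subset_iff image_iff)
    qed
    ultimately show ?thesis using sn by simp
  qed
  have ergY: "ergodic_measure G Y \<psi> \<nu>"
    unfolding ergodic_measure_def invariant_measure_def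
  proof (intro conjI ballI impI sn)
    show "prob_space \<nu>" unfolding \<nu>_def by (rule prob_space.prob_space_distr[OF ps mf])
  next
    fix g A assume g: "g \<in> carrier G" and A: "A \<in> sets \<nu>"
    have "k (\<psi> g y) = \<phi> g (k y)" if "y \<in> A" for y
      using that ssub[OF A] kT el[OF g] by (auto simp: \<psi>_def kf subset_iff)
    then have "k ` \<psi> g ` A = \<phi> g ` k ` A" by (auto simp: image_image)
    then show "emeasure \<nu> (\<psi> g ` A) = emeasure \<nu> A"
      using em[OF A] em[OF meas_img[OF g A]] inv[OF g mk[OF A]] by simp
  next
    fix A assume A: "A \<in> sets \<nu>" and i: "invariant_set G \<psi> A"
    have "measure \<nu> A = measure \<mu> (k ` A)" using em[OF A] by (simp add: measure_def)
    then show "measure \<nu> A \<in> {0, 1}" using erg[OF mk[OF A] inv_k[OF ssub[OF A] i]] by simp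
  qed
  have nfY: "\<not> essentially_free G \<psi> \<nu>"
  proof
    assume "essentially_free G \<psi> \<nu>"
    then have "AE x in \<mu>. stabilizer G \<psi> (f x) = {\<one>\<^bsub>G\<^esub>}"
      unfolding essentially_free_def \<nu>_def by (rule AE_distrD[OF mf])
    then have "AE x in \<mu>. stabilizer G \<phi> x = {\<one>\<^bsub>G\<^esub>}"
      by (rule AE_mp) (rule AE_I2, simp add: sp stab)
    then show False using assms(4) by (simp add: essentially_free_def)
  qed
  show ?thesis unfolding allosteric_def using minY tfY ergY nfY by blast
qed

end

theory Submission
  imports Defs "HOL-Algebra.Zassenhaus"
begin

text \<open>
  Everything follows once almost every point is known to have trivial holonomy. The stabilizers of
  these points are the conjugates of \<open>H\<close>, of which there are countably many, so one of them is an atom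
  of the IRS; and they lie in the stabilizer URS by its definition.

  So suppose that nontrivial holonomy has positive measure. The proof then constructs an allosteric
  action of \<open>G\<close>. Let \<open>N\<close> be the normalizer of \<open>H\<close> and \<open>Y\<close> the set of points fixed by \<open>H\<close>. The translates
  of \<open>Y\<close> cover \<open>X\<close>, and \<open>gY\<close> is disjoint from \<open>Y\<close> unless \<open>g\<close> lies in \<open>N\<close>
  (\<open>conjugate_H_subset_stab\<close>, \<open>conjugate_H_in_stab_unique\<close>): both rest on the fact that, by
  minimality, a subset of \<open>G\<close> with finitely many conjugates which lies in one stabilizer has a
  conjugate in every stabilizer, in particular in the finite stabilizer of a point with trivial
  holonomy. On \<open>Y\<close>
  the action of \<open>N\<close> factors through \<open>N/H\<close>, and as an action of \<open>N/H\<close> it is minimal and topologically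
  free, but not essentially free. It remains to carry such an action from \<open>N/H\<close> over to \<open>G\<close>, which has
  finite index subgroups isomorphic to finite index subgroups of \<open>N/H\<close>. This is done in one step down
  and one step up.

  Going down, \<open>finite_index_hom_with_kernel\<close> provides a normal subgroup \<open>L\<close> of finite index in \<open>G\<close>,
  contained in \<open>N\<close>, with a homomorphism to \<open>G\<close> whose kernel is \<open>L \<inter> H\<close> and whose image \<open>P\<close> has finite
  index. Under \<open>L\<close> the space splits into finitely many clopen minimal components, and the measure into
  finitely many ergodic ones (\<open>restrict_to_component\<close>); a component inside \<open>Y\<close> carries an action of \<open>P\<close>.
  The danger is that this action becomes essentially free, which happens only if almost all
  stabilizers are finite. But a finite subgroup that occurs as a stabilizer with positive
  probability has finitely many conjugates, because these occur on disjoint sets of equal measure,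
  and then minimality makes it a conjugate of \<open>H\<close> (\<open>finite_stab_class_null\<close>).

  Going up, the action of \<open>P\<close> is induced to \<open>G\<close>; this preserves minimality, ergodicity, topological
  freeness and the failure of essential freeness (\<open>allosteric_from_finite_index\<close>).
\<close>

section \<open>Subgroups of finite index\<close>

lemma (in group) r_coset_eq_iff:
  assumes "subgroup K G" "g \<in> carrier G" "h \<in> carrier G"
  shows "K #> g = K #> h \<longleftrightarrow> g \<otimes> inv h \<in> K"
proof -
  have "g \<in> K #> h \<longleftrightarrow> g \<otimes> inv h \<in> K"
    using subgroup.rcos_module[OF assms(1) is_group assms(3,2)] .
  moreover have "g \<in> K #> h \<longleftrightarrow> K #> g = K #> h"
    using assms rcos_self repr_independence by (metis)
  ultimately show ?thesis by simp
qed

text \<open>Coset representatives in this form involve no inverses, and so they read the same in \<open>G\<close> and in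
  a subgroup, whose inverse operation is a different term.\<close>

lemma (in group) finite_index_iff:
  "finite_index G K \<longleftrightarrow>
     subgroup K G \<and>
     (\<exists>T. finite T \<and> T \<subseteq> carrier G \<and> (\<forall>g\<in>carrier G. \<exists>t\<in>T. \<exists>k\<in>K. g = k \<otimes> t))"
    (is "_ \<longleftrightarrow> _ \<and> ?fin")
proof -
  have "finite (rcosets K) \<longleftrightarrow> ?fin" if K: "subgroup K G"
  proof
    assume "finite (rcosets K)"
    then obtain T where T: "T \<subseteq> carrier G" "finite T" "(\<lambda>g. K #> g) ` T = (\<lambda>g. K #> g) ` carrier G"
      using finite_subset_image[of "(\<lambda>g. K #> g) ` carrier G" "\<lambda>g. K #> g" "carrier G"]
      unfolding RCOSETS_def by (auto simp: UNION_singleton_eq_range)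
    have "\<exists>t\<in>T. \<exists>k\<in>K. g = k \<otimes> t" if g: "g \<in> carrier G" for g
    proof -
      obtain t where "t \<in> T" "K #> g = K #> t" using T(3) g by (metis (no_types, lifting) imageE imageI)
      moreover have "g \<in> K #> g" using rcos_self[OF g K] .
      ultimately show ?thesis unfolding r_coset_def by auto
    qed
    with T(1,2) show ?fin by blast
  next
    assume ?fin
    then obtain T where T: "finite T" "T \<subseteq> carrier G"
      "\<And>g. g \<in> carrier G \<Longrightarrow> \<exists>t\<in>T. \<exists>k\<in>K. g = k \<otimes> t" by blast
    have "rcosets K \<subseteq> (\<lambda>t. K #> t) ` T"
    proof
      fix C assume "C \<in> rcosets K"
      then obtain g where g: "g \<in> carrier G" "C = K #> g" unfolding RCOSETS_def by blast
      obtain t k where t: "t \<in> T" "k \<in> K" "g = k \<otimes> t" using T(3)[OF g(1)] by blast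
      have "g \<otimes> inv t \<in> K"
        using t T(2) subgroup.mem_carrier[OF K] by (simp add: m_assoc subset_iff)
      then show "C \<in> (\<lambda>t. K #> t) ` T"
        using r_coset_eq_iff[OF K g(1), of t] g t T(2) by blast
    qed
    then show "finite (rcosets K)" using T(1) finite_surj by blast
  qed
  then show ?thesis unfolding finite_index_def by blast
qed

text \<open>One element for each value of \<open>F\<close> is enough to represent all cosets.\<close>

lemma (in group) finite_index_by_invariant:
  assumes K: "subgroup K G" and fin: "finite (F ` carrier G)"
    and sep: "\<And>g h. g \<in> carrier G \<Longrightarrow> h \<in> carrier G \<Longrightarrow> F g = F h \<Longrightarrow> g \<otimes> inv h \<in> K"
  shows "finite_index G K"
proof -
  obtain T where T: "T \<subseteq> carrier G" "finite T" "F ` T = F ` carrier G"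
    using finite_subset_image[OF fin subset_refl] by metis
  have "\<exists>t\<in>T. \<exists>k\<in>K. g = k \<otimes> t" if g: "g \<in> carrier G" for g
  proof -
    obtain t where t: "t \<in> T" "F g = F t" using T(3) g by (metis (no_types, lifting) imageE imageI)
    then have "g \<otimes> inv t \<in> K" "g = (g \<otimes> inv t) \<otimes> t"
      using sep[OF g] g T(1) by (auto simp: m_assoc subset_iff)
    with t show ?thesis by blast
  qed
  with K T(1,2) show ?thesis unfolding finite_index_iff by blast
qed

lemma (in group) finite_index_trans:
  assumes B: "finite_index G B" and A: "finite_index (G\<lparr>carrier := B\<rparr>) A"
  shows "finite_index G A"
proof -
  have sB: "subgroup B G" using B unfolding finite_index_def by blast
  interpret B: group "G\<lparr>carrier := B\<rparr>" by (rule subgroup_imp_group[OF sB])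
  obtain S where S: "finite S" "S \<subseteq> carrier G" "\<And>g. g \<in> carrier G \<Longrightarrow> \<exists>t\<in>S. \<exists>k\<in>B. g = k \<otimes> t"
    using B unfolding finite_index_iff by blast
  obtain T where T: "finite T" "T \<subseteq> B" "\<And>g. g \<in> B \<Longrightarrow> \<exists>t\<in>T. \<exists>k\<in>A. g = k \<otimes> t"
    and sA: "subgroup A (G\<lparr>carrier := B\<rparr>)"
    using A unfolding B.finite_index_iff by auto
  have BG: "B \<subseteq> carrier G" by (rule subgroup.subset[OF sB])
  have AG: "subgroup A G" using incl_subgroup[OF sB sA] .
  have "\<exists>u\<in>(\<lambda>(t, s). t \<otimes> s) ` (T \<times> S). \<exists>k\<in>A. g = k \<otimes> u" if g: "g \<in> carrier G" for g
  proof -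
    obtain s b where s: "s \<in> S" "b \<in> B" "g = b \<otimes> s" using S(3)[OF g] by blast
    obtain t a where t: "t \<in> T" "a \<in> A" "b = a \<otimes> t" using T(3)[OF s(2)] by blast
    have "g = a \<otimes> (t \<otimes> s)"
      using s t S(2) T(2) BG subgroup.mem_carrier[OF AG] by (simp add: m_assoc subset_iff)
    then show ?thesis using s(1) t(1,2) by (intro bexI[of _ "t \<otimes> s"] bexI[of _ a]) auto
  qed
  moreover have "(\<lambda>(t, s). t \<otimes> s) ` (T \<times> S) \<subseteq> carrier G" using S(2) T(2) BG by auto
  moreover have "finite ((\<lambda>(t, s). t \<otimes> s) ` (T \<times> S))" using S(1) T(1) by simp
  ultimately show ?thesis unfolding finite_index_iff using AG by blast
qed

lemma (in group) finite_index_in_subgroup: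
  assumes A: "finite_index G A" and B: "subgroup B G" and AB: "A \<subseteq> B"
  shows "finite_index (G\<lparr>carrier := B\<rparr>) A"
proof -
  interpret B: group "G\<lparr>carrier := B\<rparr>" by (rule subgroup_imp_group[OF B])
  have sA: "subgroup A G" using A unfolding finite_index_def by blast
  show ?thesis
  proof (rule B.finite_index_by_invariant[of A "\<lambda>g. A #> g"])
    show "subgroup A (G\<lparr>carrier := B\<rparr>)" by (rule subgroup_incl[OF sA B AB])
    have "(\<lambda>g. A #> g) ` carrier (G\<lparr>carrier := B\<rparr>) \<subseteq> rcosets A"
      unfolding RCOSETS_def using subgroup.subset[OF B] by auto
    then show "finite ((\<lambda>g. A #> g) ` carrier (G\<lparr>carrier := B\<rparr>))"
      using A finite_subset unfolding finite_index_def by blast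
    fix g h assume "g \<in> carrier (G\<lparr>carrier := B\<rparr>)" "h \<in> carrier (G\<lparr>carrier := B\<rparr>)" "A #> g = A #> h"
    then show "g \<otimes>\<^bsub>G\<lparr>carrier := B\<rparr>\<^esub> inv\<^bsub>G\<lparr>carrier := B\<rparr>\<^esub> h \<in> A"
      using r_coset_eq_iff[OF sA, of g h] subgroup.mem_carrier[OF B]
      by (simp add: m_inv_consistent[OF B])
  qed
qed

lemma finite_index_hom_image:
  assumes "group G" "group K" and h: "h \<in> hom G K" "h ` carrier G = carrier K"
    and A: "finite_index G A"
  shows "finite_index K (h ` A)"
proof -
  interpret G: group G by fact
  interpret K: group K by fact
  interpret group_hom G K h using h by unfold_locales auto
  obtain T where T: "finite T" "T \<subseteq> carrier G"
      "\<And>g. g \<in> carrier G \<Longrightarrow> \<exists>t\<in>T. \<exists>k\<in>A. g = k \<otimes>\<^bsub>G\<^esub> t"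
    and sA: "subgroup A G"
    using A unfolding G.finite_index_iff by blast
  have "\<exists>t\<in>h ` T. \<exists>k\<in>h ` A. g = k \<otimes>\<^bsub>K\<^esub> t" if g: "g \<in> carrier K" for g
  proof -
    obtain x where x: "x \<in> carrier G" "g = h x" using g h(2) by blast
    obtain t a where t: "t \<in> T" "a \<in> A" "x = a \<otimes>\<^bsub>G\<^esub> t" using T(3)[OF x(1)] by blast
    then have "g = h a \<otimes>\<^bsub>K\<^esub> h t"
      using x T(2) subgroup.mem_carrier[OF sA] by (simp add: subset_iff)
    with t show ?thesis by blast
  qed
  moreover have "subgroup (h ` A) K" using subgroup_img_is_subgroup[OF sA] .
  moreover have "h ` T \<subseteq> carrier K" using T(2) by auto
  ultimately show ?thesis unfolding K.finite_index_iff using T(1) by blast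
qed

lemma finite_index_hom_vimage:
  assumes "group G" "group K" and h: "h \<in> hom G K" and B: "finite_index K B"
  shows "finite_index G {g \<in> carrier G. h g \<in> B}"
proof -
  interpret G: group G by fact
  interpret K: group K by fact
  interpret group_hom G K h using h by unfold_locales auto
  have sB: "subgroup B K" and fin: "finite (rcosets\<^bsub>K\<^esub> B)"
    using B unfolding finite_index_def by auto
  show ?thesis
  proof (rule G.finite_index_by_invariant[where F = "\<lambda>g. B #>\<^bsub>K\<^esub> h g"])
    show "subgroup {g \<in> carrier G. h g \<in> B} G"
      by (rule G.subgroupI)
        (use sB subgroup.one_closed[OF sB] in \<open>auto intro: subgroup.m_closed subgroup.m_inv_closed\<close>)
    show "finite ((\<lambda>g. B #>\<^bsub>K\<^esub> h g) ` carrier G)"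
      by (rule finite_subset[OF _ fin]) (use hom_closed in \<open>unfold RCOSETS_def, blast\<close>)
    fix g g' assume "g \<in> carrier G" "g' \<in> carrier G" "B #>\<^bsub>K\<^esub> h g = B #>\<^bsub>K\<^esub> h g'"
    then show "g \<otimes>\<^bsub>G\<^esub> inv\<^bsub>G\<^esub> g' \<in> {g \<in> carrier G. h g \<in> B}"
      using K.r_coset_eq_iff[OF sB] by auto
  qed
qed

text \<open>A subgroup meets each of the finitely many cosets of \<open>L\<close> in a translate of its intersection with
  \<open>L\<close>, or not at all.\<close>

lemma (in group) finite_subgroup_if_finite_Int:
  assumes L: "finite_index G L" and K: "subgroup K G" and fin: "finite (L \<inter> K)"
  shows "finite K"
proof -
  have sL: "subgroup L G" using L unfolding finite_index_def by blast
  obtain T where T: "finite T" "T \<subseteq> carrier G" "\<And>g. g \<in> carrier G \<Longrightarrow> \<exists>t\<in>T. \<exists>l\<in>L. g = l \<otimes> t"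
    using L unfolding finite_index_iff by blast
  have "finite {k \<in> K. \<exists>l\<in>L. k = l \<otimes> t}" if t: "t \<in> T" for t
  proof (cases "{k \<in> K. \<exists>l\<in>L. k = l \<otimes> t} = {}")
    case True
    show ?thesis unfolding True by simp
  next
    case False
    then obtain k0 l0 where k0: "k0 \<in> K" "l0 \<in> L" "k0 = l0 \<otimes> t" by blast
    have tG: "t \<in> carrier G" using t T(2) by blast
    have "{k \<in> K. \<exists>l\<in>L. k = l \<otimes> t} \<subseteq> (\<lambda>m. m \<otimes> k0) ` (L \<inter> K)"
    proof
      fix k assume "k \<in> {k \<in> K. \<exists>l\<in>L. k = l \<otimes> t}"
      then obtain l where l: "k \<in> K" "l \<in> L" "k = l \<otimes> t" by blast
      have G: "l \<in> carrier G" "l0 \<in> carrier G" "k \<in> carrier G" "k0 \<in> carrier G"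
        using l k0 subgroup.mem_carrier[OF sL] subgroup.mem_carrier[OF K] by auto
      have "k \<otimes> inv k0 \<in> K"
        using subgroup.m_closed[OF K l(1) subgroup.m_inv_closed[OF K k0(1)]] .
      moreover have "k \<otimes> inv k0 = l \<otimes> inv l0"
      proof -
        have "t \<otimes> (inv t \<otimes> inv l0) = inv l0" using G tG by (simp add: m_assoc[symmetric])
        then show ?thesis unfolding l(3) k0(3) using G tG by (simp add: inv_mult_group m_assoc)
      qed
      then have "k \<otimes> inv k0 \<in> L"
        using subgroup.m_closed[OF sL l(2) subgroup.m_inv_closed[OF sL k0(2)]] by simp
      moreover have "k = (k \<otimes> inv k0) \<otimes> k0" using G by (simp add: m_assoc)
      ultimately show "k \<in> (\<lambda>m. m \<otimes> k0) ` (L \<inter> K)" by blast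
    qed
    then show ?thesis using fin finite_surj by blast
  qed
  then have "finite (\<Union>t\<in>T. {k \<in> K. \<exists>l\<in>L. k = l \<otimes> t})" using T(1) by blast
  moreover have "K \<subseteq> (\<Union>t\<in>T. {k \<in> K. \<exists>l\<in>L. k = l \<otimes> t})"
    using T(3) subgroup.mem_carrier[OF K] by blast
  ultimately show ?thesis using finite_subset by blast
qed

definition normal_core :: "('g, 'c) monoid_scheme \<Rightarrow> 'g set \<Rightarrow> 'g set" where
  "normal_core G K = {g \<in> carrier G. \<forall>x\<in>carrier G. x \<otimes>\<^bsub>G\<^esub> g \<otimes>\<^bsub>G\<^esub> inv\<^bsub>G\<^esub> x \<in> K}"

lemma (in group) normal_core_subset:
  assumes "subgroup K G"
  shows "normal_core G K \<subseteq> K"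
proof
  fix g assume "g \<in> normal_core G K"
  then have "g \<in> carrier G" "\<one> \<otimes> g \<otimes> inv \<one> \<in> K" unfolding normal_core_def by blast+
  then show "g \<in> K" by simp
qed

lemma (in group) normal_core_normal:
  assumes K: "subgroup K G"
  shows "normal_core G K \<lhd> G"
proof -
  have "subgroup (normal_core G K) G"
  proof (rule subgroupI)
    show "normal_core G K \<subseteq> carrier G" unfolding normal_core_def by blast
    have "\<one> \<in> normal_core G K" unfolding normal_core_def using subgroup.one_closed[OF K] by simp
    then show "normal_core G K \<noteq> {}" by blast
  next
    fix a assume a: "a \<in> normal_core G K"
    then have aG: "a \<in> carrier G" unfolding normal_core_def by blast
    have "x \<otimes> inv a \<otimes> inv x \<in> K" if x: "x \<in> carrier G" for x
    proof -
      have "inv (x \<otimes> a \<otimes> inv x) \<in> K"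
        using a x subgroup.m_inv_closed[OF K] unfolding normal_core_def by blast
      then show ?thesis using aG x by (simp add: inv_mult_group m_assoc)
    qed
    with aG show "inv a \<in> normal_core G K" unfolding normal_core_def by simp
  next
    fix a b assume a: "a \<in> normal_core G K" and b: "b \<in> normal_core G K"
    then have G: "a \<in> carrier G" "b \<in> carrier G" unfolding normal_core_def by blast+
    have "x \<otimes> (a \<otimes> b) \<otimes> inv x \<in> K" if x: "x \<in> carrier G" for x
    proof -
      have "(x \<otimes> a \<otimes> inv x) \<otimes> (x \<otimes> b \<otimes> inv x) \<in> K"
        using a b x subgroup.m_closed[OF K] unfolding normal_core_def by blast
      moreover have "(x \<otimes> a \<otimes> inv x) \<otimes> (x \<otimes> b \<otimes> inv x) = x \<otimes> (a \<otimes> b) \<otimes> inv x"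
      proof -
        have "inv x \<otimes> (x \<otimes> (b \<otimes> inv x)) = b \<otimes> inv x"
          using G x by (simp add: m_assoc[symmetric])
        then show ?thesis using G x by (simp add: m_assoc)
      qed
      ultimately show ?thesis by simp
    qed
    with G show "a \<otimes> b \<in> normal_core G K" unfolding normal_core_def by simp
  qed
  moreover have "y \<otimes> a \<otimes> inv y \<in> normal_core G K"
    if y: "y \<in> carrier G" and a: "a \<in> normal_core G K" for y a
  proof -
    have aG: "a \<in> carrier G" using a unfolding normal_core_def by blast
    have "x \<otimes> (y \<otimes> a \<otimes> inv y) \<otimes> inv x \<in> K" if x: "x \<in> carrier G" for x
    proof -
      have "(x \<otimes> y) \<otimes> a \<otimes> inv (x \<otimes> y) \<in> K" using a x y unfolding normal_core_def by blast
      then show ?thesis using aG x y by (simp add: inv_mult_group m_assoc)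
    qed
    with aG y show ?thesis unfolding normal_core_def by simp
  qed
  ultimately show ?thesis unfolding normal_inv_iff by blast
qed

text \<open>The core is the kernel of the action of the group on the finite set of cosets by right
  multiplication.\<close>

lemma (in group) normal_core_finite_index:
  assumes fi: "finite_index G K"
  shows "finite_index G (normal_core G K)"
proof -
  have K: "subgroup K G" and fin: "finite (rcosets K)" using fi unfolding finite_index_def by auto
  let ?F = "\<lambda>g. \<lambda>C\<in>rcosets K. C #> g"
  show ?thesis
  proof (rule finite_index_by_invariant[of _ ?F])
    show "subgroup (normal_core G K) G" using normal_core_normal[OF K] normal_imp_subgroup by blast
    have "(C #> g) \<in> rcosets K" if "C \<in> rcosets K" "g \<in> carrier G" for C g
      using that coset_mult_assoc[OF subgroup.subset[OF K]] unfolding RCOSETS_def by auto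
    then have "?F ` carrier G \<subseteq> rcosets K \<rightarrow>\<^sub>E rcosets K" by auto
    then show "finite (?F ` carrier G)" using fin finite_PiE finite_subset by metis
    fix g h assume g: "g \<in> carrier G" and h: "h \<in> carrier G" and eq: "?F g = ?F h"
    have "x \<otimes> (g \<otimes> inv h) \<otimes> inv x \<in> K" if x: "x \<in> carrier G" for x
    proof -
      have "K #> x \<in> rcosets K" using x unfolding RCOSETS_def by blast
      then have "K #> x #> g = K #> x #> h" using fun_cong[OF eq, of "K #> x"] by simp
      then have "K #> (x \<otimes> g) = K #> (x \<otimes> h)"
        using coset_mult_assoc[OF subgroup.subset[OF K]] g h x by simp
      then have "(x \<otimes> g) \<otimes> inv (x \<otimes> h) \<in> K" using r_coset_eq_iff[OF K] g h x by simp
      then show ?thesis using g h x by (simp add: inv_mult_group m_assoc)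
    qed
    with g h show "g \<otimes> inv h \<in> normal_core G K" unfolding normal_core_def by simp
  qed
qed

lemma (in group) power_in_finite_index:
  assumes fi: "finite_index G K" and q: "q \<in> carrier G"
  obtains m :: nat where "m > 0" "q [^] m \<in> K"
proof -
  have K: "subgroup K G" and fin: "finite (rcosets K)" using fi unfolding finite_index_def by auto
  have "range (\<lambda>m::nat. K #> q [^] m) \<subseteq> rcosets K" using q unfolding RCOSETS_def by auto
  then have "\<not> inj (\<lambda>m::nat. K #> q [^] m)" using fin finite_subset range_inj_infinite by metis
  then obtain i j :: nat where ij: "i < j" "K #> q [^] j = K #> q [^] i"
    unfolding inj_def by (metis linorder_neq_iff)
  then have "q [^] j \<otimes> inv (q [^] i) \<in> K" using r_coset_eq_iff[OF K] q by simp
  moreover have "q [^] j = q [^] (j - i) \<otimes> q [^] i" using ij(1) q by (simp add: nat_pow_mult)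
  ultimately have "q [^] (j - i) \<in> K" using q by (simp add: m_assoc)
  with ij(1) show ?thesis by (intro that[of "j - i"]) auto
qed

text \<open>This is how commensurability of \<open>N/H\<close> with \<open>N\<close>, the normalizer of \<open>H\<close>, enters the proof: some
  finite index subgroup \<open>A\<close> of \<open>N/H\<close> is isomorphic to a finite index subgroup of \<open>N\<close>, so the preimage
  of \<open>A\<close> in \<open>N\<close> maps onto the latter with kernel \<open>H\<close>. Passing to the core in \<open>G\<close> makes the domain
  normal and keeps the image of finite index.\<close>

lemma (in group) finite_index_hom_with_kernel:
  assumes H: "subgroup H G" and fiN: "finite_index G (normalizer G H)"
    and comm: "commensurable ((G\<lparr>carrier := normalizer G H\<rparr>) Mod H) (G\<lparr>carrier := normalizer G H\<rparr>)"
  obtains L p where "L \<lhd> G" "finite_index G L" "L \<subseteq> normalizer G H"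
    "p \<in> hom (G\<lparr>carrier := L\<rparr>) G" "\<And>l. l \<in> L \<Longrightarrow> p l = \<one> \<longleftrightarrow> l \<in> H" "finite_index G (p ` L)"
proof -
  define N where "N = normalizer G H"
  let ?N = "G\<lparr>carrier := N\<rparr>"
  let ?Q = "?N Mod H"
  have N: "subgroup N G" using fiN unfolding N_def finite_index_def by blast
  interpret N: group ?N by (rule subgroup_imp_group[OF N])
  interpret HN: normal H ?N unfolding N_def by (rule subgroup_in_normalizer[OF H])
  interpret Q: group ?Q by (rule HN.factorgroup_is_group)
  obtain A B where fiA: "finite_index ?Q A" and fiB: "finite_index ?N B"
    and iso: "?Q\<lparr>carrier := A\<rparr> \<cong> ?N\<lparr>carrier := B\<rparr>"
    using comm unfolding commensurable_def N_def by blast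
  obtain f where f: "f \<in> iso (?Q\<lparr>carrier := A\<rparr>) (?N\<lparr>carrier := B\<rparr>)"
    using iso unfolding is_iso_def by blast
  have A: "subgroup A ?Q" and B: "subgroup B ?N" using fiA fiB unfolding finite_index_def by auto
  have BG: "subgroup B G" using incl_subgroup[OF N B] .
  interpret QA: group "?Q\<lparr>carrier := A\<rparr>" by (rule Q.subgroup_imp_group[OF A])
  interpret GB: group "G\<lparr>carrier := B\<rparr>" by (rule subgroup_imp_group[OF BG])
  have fh: "f \<in> hom (?Q\<lparr>carrier := A\<rparr>) (G\<lparr>carrier := B\<rparr>)" and fb: "bij_betw f A B"
    using f unfolding iso_def by auto
  interpret f: group_hom "?Q\<lparr>carrier := A\<rparr>" "G\<lparr>carrier := B\<rparr>" f
    by (rule group_hom.intro[OF QA.is_group GB.is_group group_hom_axioms.intro[OF fh]])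
  define r where "r = (\<lambda>a. H #>\<^bsub>?N\<^esub> a)"
  define K where "K = {n \<in> N. r n \<in> A}"
  have rh: "r \<in> hom ?N ?Q" unfolding r_def by (rule HN.r_coset_hom_Mod)
  have fiKN: "finite_index ?N K"
    using finite_index_hom_vimage[OF N.is_group Q.is_group rh fiA] unfolding K_def by simp
  have fiK: "finite_index G K" using finite_index_trans[OF fiN[folded N_def] fiKN] .
  then have K: "subgroup K G" unfolding finite_index_def by blast
  define L where "L = normal_core G K"
  define p where "p = (\<lambda>l. f (r l))"
  have LK: "L \<subseteq> K" unfolding L_def by (rule normal_core_subset[OF K])
  have nL: "L \<lhd> G" unfolding L_def by (rule normal_core_normal[OF K])
  have fiL: "finite_index G L" unfolding L_def by (rule normal_core_finite_index[OF fiK])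
  have KN: "K \<subseteq> N" unfolding K_def by blast
  have rmult: "r (a \<otimes> b) = r a \<otimes>\<^bsub>?Q\<^esub> r b" if "a \<in> N" "b \<in> N" for a b
    using hom_mult[OF rh] that by simp
  interpret GK: group "G\<lparr>carrier := K\<rparr>" by (rule subgroup_imp_group[OF K])
  have pK: "p \<in> hom (G\<lparr>carrier := K\<rparr>) (G\<lparr>carrier := B\<rparr>)"
  proof (rule homI)
    show "p a \<in> carrier (G\<lparr>carrier := B\<rparr>)" if "a \<in> carrier (G\<lparr>carrier := K\<rparr>)" for a
      using that f.hom_closed[of "r a"] unfolding p_def K_def by simp
    show "p (a \<otimes>\<^bsub>G\<lparr>carrier := K\<rparr>\<^esub> b) = p a \<otimes>\<^bsub>G\<lparr>carrier := B\<rparr>\<^esub> p b"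
      if "a \<in> carrier (G\<lparr>carrier := K\<rparr>)" "b \<in> carrier (G\<lparr>carrier := K\<rparr>)" for a b
      using that rmult f.hom_mult[of "r a" "r b"] unfolding p_def K_def by simp
  qed
  have psurj: "p ` K = B"
  proof -
    have "r ` K = A"
    proof -
      have "C \<in> r ` K" if C: "C \<in> A" for C
      proof -
        have "C \<in> carrier ?Q" using C subgroup.mem_carrier[OF A] by blast
        then obtain n where "n \<in> N" "C = r n"
          unfolding carrier_FactGroup r_def by auto
        with C show ?thesis unfolding K_def by blast
      qed
      then show ?thesis unfolding K_def by blast
    qed
    then show ?thesis using fb unfolding p_def bij_betw_def by (metis image_image)
  qed
  have "finite_index (G\<lparr>carrier := B\<rparr>) (p ` L)"
    using finite_index_hom_image[OF GK.is_group GB.is_group pK _ finite_index_in_subgroup[OF fiL K LK]]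
      psurj by simp
  then have fip: "finite_index G (p ` L)"
    using finite_index_trans[OF finite_index_trans[OF fiN[folded N_def] fiB]] by simp
  have pL: "p \<in> hom (G\<lparr>carrier := L\<rparr>) G"
  proof (rule homI)
    show "p a \<in> carrier G" if "a \<in> carrier (G\<lparr>carrier := L\<rparr>)" for a
      using that LK hom_carrier[OF pK] subgroup.subset[OF BG] by auto
    show "p (a \<otimes>\<^bsub>G\<lparr>carrier := L\<rparr>\<^esub> b) = p a \<otimes> p b"
      if "a \<in> carrier (G\<lparr>carrier := L\<rparr>)" "b \<in> carrier (G\<lparr>carrier := L\<rparr>)" for a b
      using that hom_mult[OF pK, of a b] LK by auto
  qed
  have ker: "p l = \<one> \<longleftrightarrow> l \<in> H" if l: "l \<in> L" for l
  proof -
    have lK: "l \<in> N" "r l \<in> A" using l LK unfolding K_def by auto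
    have "H \<in> A" using subgroup.one_closed[OF A] by simp
    then have "p l = f H \<longleftrightarrow> r l = H"
      using fb lK(2) unfolding p_def bij_betw_def by (metis inj_on_eq_iff)
    moreover have "f H = \<one>" using f.hom_one by simp
    moreover have "r l = H \<longleftrightarrow> l \<in> H"
      using N.coset_join1[of H l] N.coset_join2[of l H] HN.subgroup_axioms HN.subset lK(1)
      unfolding r_def by auto
    ultimately show ?thesis by simp
  qed
  have LN: "L \<subseteq> normalizer G H" using LK KN unfolding N_def by (rule subset_trans)
  show ?thesis by (rule that[OF nL fiL LN pL ker fip])
qed

section \<open>Continuous actions\<close>

lemma openin_sets_borel_of: "openin X U \<Longrightarrow> U \<in> sets (borel_of X)"
  unfolding sets_borel_of by (rule sigma_sets.Basic) simp

lemma closedin_sets_borel_of: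
  assumes "closedin X C"
  shows "C \<in> sets (borel_of X)"
proof -
  have "space (borel_of X) - (topspace X - C) \<in> sets (borel_of X)"
    using assms by (intro sets.compl_sets openin_sets_borel_of) (simp add: closedin_def)
  then show ?thesis using closedin_subset[OF assms] by (simp add: space_borel_of double_diff)
qed

text \<open>Unlike in a homomorphism into \<open>BijGroup\<close>, the maps of a continuous action need not be extensional,
  so that the same \<open>\<phi>\<close> acts on every invariant subspace.\<close>

locale continuous_action = group G for G (structure) +
  fixes X :: "'x topology" and \<phi> :: "'a \<Rightarrow> 'x \<Rightarrow> 'x"
  assumes countable_carrier: "countable (carrier G)"
    and compact: "compact_space X"
    and Hausdorff: "Hausdorff_space X"
    and act_one: "x \<in> topspace X \<Longrightarrow> \<phi> \<one> x = x"
    and act_mult: "\<lbrakk>g \<in> carrier G; h \<in> carrier G; x \<in> topspace X\<rbrakk> \<Longrightarrow> \<phi> (g \<otimes> h) x = \<phi> g (\<phi> h x)"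
    and act_continuous: "g \<in> carrier G \<Longrightarrow> continuous_map X X (\<phi> g)"
begin

lemma act_closed: "g \<in> carrier G \<Longrightarrow> x \<in> topspace X \<Longrightarrow> \<phi> g x \<in> topspace X"
  using act_continuous by (auto simp: continuous_map_def)

lemma act_inv:
  assumes "g \<in> carrier G" "x \<in> topspace X"
  shows "\<phi> (inv g) (\<phi> g x) = x" "\<phi> g (\<phi> (inv g) x) = x"
  using assms act_mult[of "inv g" g x] act_mult[of g "inv g" x] by (simp_all add: act_one)

lemma act_homeomorphic:
  assumes "g \<in> carrier G"
  shows "homeomorphic_map X X (\<phi> g)"
proof -
  have "homeomorphic_maps X X (\<phi> g) (\<phi> (inv g))"
    unfolding homeomorphic_maps_def using assms by (simp add: act_continuous act_inv)
  then show ?thesis using homeomorphic_maps_map by blast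
qed

lemma act_inj_on: "g \<in> carrier G \<Longrightarrow> inj_on (\<phi> g) (topspace X)"
  using homeomorphic_imp_injective_map[OF act_homeomorphic] .

lemma act_image_subset: "g \<in> carrier G \<Longrightarrow> A \<subseteq> topspace X \<Longrightarrow> \<phi> g ` A \<subseteq> topspace X"
  using act_closed by blast

lemma act_image_mult:
  assumes "g \<in> carrier G" "h \<in> carrier G" "A \<subseteq> topspace X"
  shows "\<phi> g ` \<phi> h ` A = \<phi> (g \<otimes> h) ` A"
  unfolding image_image using assms by (intro image_cong) (auto simp: act_mult)

lemma act_image_one: "A \<subseteq> topspace X \<Longrightarrow> \<phi> \<one> ` A = A"
  using image_cong[of A A "\<phi> \<one>" "\<lambda>x. x"] act_one by (simp add: subset_iff)

lemma mem_act_image: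
  assumes "g \<in> carrier G" "x \<in> topspace X" "A \<subseteq> topspace X"
  shows "x \<in> \<phi> g ` A \<longleftrightarrow> \<phi> (inv g) x \<in> A"
proof
  assume "x \<in> \<phi> g ` A"
  then obtain a where "a \<in> A" "x = \<phi> g a" by blast
  then show "\<phi> (inv g) x \<in> A" using assms by (auto simp: act_inv)
next
  assume "\<phi> (inv g) x \<in> A"
  then show "x \<in> \<phi> g ` A" using imageI[of _ A "\<phi> g"] act_inv(2)[OF assms(1,2)] by metis
qed

lemma act_image_eq_vimage:
  assumes "g \<in> carrier G" "A \<subseteq> topspace X"
  shows "\<phi> g ` A = \<phi> (inv g) -` A \<inter> topspace X"
  using mem_act_image[OF assms(1) _ assms(2)] act_image_subset[OF assms] by blast

lemma act_image_Int:
  assumes "g \<in> carrier G" "A \<subseteq> topspace X" "B \<subseteq> topspace X"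
  shows "\<phi> g ` (A \<inter> B) = \<phi> g ` A \<inter> \<phi> g ` B"
  using inj_on_image_Int[OF act_inj_on] assms by blast

lemma closedin_act_image: "g \<in> carrier G \<Longrightarrow> closedin X C \<Longrightarrow> closedin X (\<phi> g ` C)"
  using homeomorphic_map_closedness_eq[OF act_homeomorphic] closedin_subset by blast

lemma sets_act_image:
  assumes "g \<in> carrier G" "A \<in> sets (borel_of X)"
  shows "\<phi> g ` A \<in> sets (borel_of X)"
proof -
  have A: "A \<subseteq> topspace X" using sets.sets_into_space[OF assms(2)] by (simp add: space_borel_of)
  have "\<phi> (inv g) \<in> measurable (borel_of X) (borel_of X)"
    using assms(1) by (intro continuous_map_measurable act_continuous) simp
  from measurable_sets[OF this assms(2)] show ?thesis
    using act_image_eq_vimage[OF assms(1) A] by (simp add: space_borel_of)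
qed

lemma invariant_setI:
  assumes A: "A \<subseteq> topspace X" and sub: "\<And>g x. g \<in> carrier G \<Longrightarrow> x \<in> A \<Longrightarrow> \<phi> g x \<in> A"
  shows "invariant_set G \<phi> A"
  unfolding invariant_set_def
proof (intro ballI equalityI)
  fix g assume g: "g \<in> carrier G"
  show "\<phi> g ` A \<subseteq> A" using sub g by blast
  show "A \<subseteq> \<phi> g ` A"
  proof
    fix x assume x: "x \<in> A"
    then have "\<phi> (inv g) x \<in> A" using sub g by simp
    then show "x \<in> \<phi> g ` A" using mem_act_image[OF g _ A] x A by blast
  qed
qed

lemma invariant_setD: "invariant_set G \<phi> A \<Longrightarrow> g \<in> carrier G \<Longrightarrow> x \<in> A \<Longrightarrow> \<phi> g x \<in> A"
  unfolding invariant_set_def by blast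

text \<open>The smallest invariant set that contains \<open>A\<close>.\<close>

definition saturation :: "'x set \<Rightarrow> 'x set" where
  "saturation A = (\<Union>g\<in>carrier G. \<phi> g ` A)"

lemma saturation_superset: "A \<subseteq> topspace X \<Longrightarrow> A \<subseteq> saturation A"
  unfolding saturation_def using UN_upper[OF one_closed, of "\<lambda>g. \<phi> g ` A"] act_image_one by simp

lemma saturation_subset: "A \<subseteq> topspace X \<Longrightarrow> saturation A \<subseteq> topspace X"
  unfolding saturation_def using act_image_subset by blast

lemma saturation_invariant:
  assumes A: "A \<subseteq> topspace X"
  shows "invariant_set G \<phi> (saturation A)"
proof (rule invariant_setI[OF saturation_subset[OF A]])
  fix g x assume g: "g \<in> carrier G" and x: "x \<in> saturation A"
  then obtain h a where h: "h \<in> carrier G" "a \<in> A" "x = \<phi> h a" unfolding saturation_def by blast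
  then have "\<phi> g x = \<phi> (g \<otimes> h) a" using g A by (simp add: act_mult subset_iff)
  then show "\<phi> g x \<in> saturation A" unfolding saturation_def using g h by blast
qed

lemma sets_saturation: "A \<in> sets (borel_of X) \<Longrightarrow> saturation A \<in> sets (borel_of X)"
  unfolding saturation_def using countable_carrier sets_act_image
  by (intro sets.countable_UN') auto

definition fixed_points :: "'a \<Rightarrow> 'x set" where
  "fixed_points g = {x \<in> topspace X. \<phi> g x = x}"

lemma closedin_fixed_points: "g \<in> carrier G \<Longrightarrow> closedin X (fixed_points g)"
  unfolding fixed_points_def
  using closedin_continuous_maps_eq[OF Hausdorff act_continuous continuous_map_id[unfolded id_def]] by simp

lemma fixed_points_conj_iff:
  assumes "g \<in> carrier G" "h \<in> carrier G" "x \<in> topspace X"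
  shows "\<phi> g x \<in> fixed_points (g \<otimes> h \<otimes> inv g) \<longleftrightarrow> x \<in> fixed_points h"
proof -
  have "\<phi> (g \<otimes> h \<otimes> inv g) (\<phi> g x) = \<phi> g (\<phi> h x)"
    using assms by (simp add: act_mult act_inv act_closed)
  then show ?thesis
    using assms inj_on_eq_iff[OF act_inj_on] unfolding fixed_points_def by (simp add: act_closed)
qed

lemma subgroup_action:
  assumes K: "subgroup K G"
  shows "continuous_action (G\<lparr>carrier := K\<rparr>) X \<phi>"
proof -
  interpret K: group "G\<lparr>carrier := K\<rparr>" by (rule subgroup_imp_group[OF K])
  show ?thesis
    using countable_subset[OF subgroup.subset[OF K] countable_carrier] subgroup.mem_carrier[OF K]
    by unfold_locales (simp_all add: compact Hausdorff act_one act_mult act_continuous)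
qed

lemma subspace_action:
  assumes Z: "closedin X Z" and inv: "invariant_set G \<phi> Z"
  shows "continuous_action G (subtopology X Z) \<phi>"
proof unfold_locales
  show "compact_space (subtopology X Z)"
    using closedin_compact_space[OF compact Z] compactin_subspace by blast
  show "continuous_map (subtopology X Z) (subtopology X Z) (\<phi> g)" if "g \<in> carrier G" for g
    using that act_continuous inv invariant_setD
    by (auto simp: continuous_map_in_subtopology continuous_map_from_subtopology)
qed (auto simp: countable_carrier Hausdorff Hausdorff_space_subtopology act_one act_mult)

end

locale minimal_action = continuous_action +
  assumes nonempty: "topspace X \<noteq> {}"
    and minimal: "\<lbrakk>closedin X C; C \<noteq> {}; invariant_set G \<phi> C\<rbrakk> \<Longrightarrow> C = topspace X"

lemma minimal_system_imp_minimal_action: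
  assumes "minimal_system G X \<phi>"
  shows "minimal_action G X \<phi>"
proof -
  have ds: "countable (carrier G)" "compact_space X" "Hausdorff_space X" "group_action G (topspace X) \<phi>"
    and hom: "\<And>g. g \<in> carrier G \<Longrightarrow> homeomorphic_map X X (\<phi> g)"
    using assms unfolding minimal_system_def dynamical_system_def by blast+
  interpret group_action G "topspace X" \<phi> by (rule ds(4))
  interpret group G using group_hom unfolding group_hom_def by blast
  show ?thesis
  proof unfold_locales
    show "\<phi> \<one>\<^bsub>G\<^esub> x = x" if "x \<in> topspace X" for x
      using that by (simp flip: id_eq_one)
    show "\<phi> (g \<otimes>\<^bsub>G\<^esub> h) x = \<phi> g (\<phi> h x)"
      if "g \<in> carrier G" "h \<in> carrier G" "x \<in> topspace X" for g h x
      using that composition_rule by simp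
  qed (use assms ds hom in \<open>auto simp: minimal_system_def homeomorphic_imp_continuous_map\<close>)
qed

lemma minimal_action_imp_minimal_system:
  assumes "minimal_action G X \<phi>" and fg: "finitely_generated G"
  shows "minimal_system G X (\<lambda>g. restrict (\<phi> g) (topspace X))"
proof -
  interpret minimal_action G X \<phi> by fact
  let ?r = "\<lambda>g. restrict (\<phi> g) (topspace X)"
  have hom: "homeomorphic_map X X (?r g)" if "g \<in> carrier G" for g
    by (rule homeomorphic_map_eq[OF act_homeomorphic[OF that]]) simp
  have bij: "?r g \<in> Bij (topspace X)" if "g \<in> carrier G" for g
    using homeomorphic_imp_injective_map[OF hom[OF that]] homeomorphic_imp_surjective_map[OF hom[OF that]]
    unfolding Bij_def bij_betw_def by simp
  have "group_action G (topspace X) ?r"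
    unfolding group_action_def group_hom_def group_hom_axioms_def
  proof (intro conjI is_group group_BijGroup homI)
    show "?r g \<in> carrier (BijGroup (topspace X))" if "g \<in> carrier G" for g
      using bij[OF that] by (simp add: BijGroup_def)
    show "?r (g \<otimes>\<^bsub>G\<^esub> h) = ?r g \<otimes>\<^bsub>BijGroup (topspace X)\<^esub> ?r h"
      if "g \<in> carrier G" "h \<in> carrier G" for g h
      using that bij by (auto simp: BijGroup_def compose_def act_mult act_closed)
  qed
  moreover have "invariant_set G \<phi> C" if "closedin X C" "invariant_set G ?r C" for C
    using that closedin_subset[OF that(1)] unfolding invariant_set_def
    by (metis (no_types, lifting) image_cong restrict_apply subsetD)
  ultimately show ?thesis
    unfolding minimal_system_def dynamical_system_def
    using countable_carrier fg compact Hausdorff hom nonempty minimal by blast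
qed

section \<open>Restriction to a normal subgroup of finite index\<close>

context continuous_action
begin

lemma normal_act_image_invariant:
  assumes L: "L \<lhd> G" and A: "A \<subseteq> topspace X" and inv: "invariant_set (G\<lparr>carrier := L\<rparr>) \<phi> A"
    and q: "q \<in> carrier G"
  shows "invariant_set (G\<lparr>carrier := L\<rparr>) \<phi> (\<phi> q ` A)"
proof -
  interpret L: continuous_action "G\<lparr>carrier := L\<rparr>" X \<phi>
    by (rule subgroup_action[OF normal_imp_subgroup[OF L]])
  show ?thesis
  proof (rule L.invariant_setI[OF act_image_subset[OF q A]])
    fix l x assume l': "l \<in> carrier (G\<lparr>carrier := L\<rparr>)" and x: "x \<in> \<phi> q ` A"
    then obtain a where a: "a \<in> A" "x = \<phi> q a" by blast
    have l: "l \<in> L" "l \<in> carrier G"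
      using l' subgroup.mem_carrier[OF normal_imp_subgroup[OF L]] by auto
    have "inv q \<otimes> l \<otimes> q \<in> L" using normal.inv_op_closed1[OF L q l(1)] .
    then have "\<phi> (inv q \<otimes> l \<otimes> q) a \<in> A" using L.invariant_setD[OF inv _ a(1)] by simp
    moreover have "\<phi> l x = \<phi> q (\<phi> (inv q \<otimes> l \<otimes> q) a)"
      using a A l q by (auto simp: act_mult act_inv act_closed)
    ultimately show "\<phi> l x \<in> \<phi> q ` A" by blast
  qed
qed

text \<open>A translate \<open>gA\<close> depends only on the coset of \<open>g\<close>, because \<open>L\<close> is normal and preserves \<open>A\<close>.\<close>

lemma finite_translates:
  assumes fi: "finite_index G L" and L: "L \<lhd> G"
    and A: "A \<subseteq> topspace X" and inv: "invariant_set (G\<lparr>carrier := L\<rparr>) \<phi> A"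
  obtains T where "finite T" "T \<subseteq> carrier G" "(\<lambda>g. \<phi> g ` A) ` carrier G = (\<lambda>g. \<phi> g ` A) ` T"
    "card T = card (rcosets L)"
proof -
  have sL: "subgroup L G" and fin: "finite (rcosets L)" using fi unfolding finite_index_def by auto
  define T where "T = (\<lambda>C. SOME g. g \<in> C) ` (rcosets L)"
  have some: "(SOME g. g \<in> C) \<in> C" if "C \<in> rcosets L" for C
    using subgroup.rcosets_non_empty[OF sL that] by (simp add: some_in_eq)
  have Csub: "C \<subseteq> carrier G" if "C \<in> rcosets L" for C
    using that rcosets_part_G[OF sL] by blast
  have inj: "inj_on (\<lambda>C. SOME g. g \<in> C) (rcosets L)"
    by (rule inj_onI) (metis some rcos_disjoint[OF sL] pairwiseD disjnt_iff)
  have TG: "T \<subseteq> carrier G" unfolding T_def using some Csub by blast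
  have "\<phi> g ` A \<in> (\<lambda>g. \<phi> g ` A) ` T" if g: "g \<in> carrier G" for g
  proof -
    have C: "L #> g \<in> rcosets L" by (rule rcosetsI[OF subgroup.subset[OF sL] g])
    define t where "t = (SOME g'. g' \<in> L #> g)"
    have t: "t \<in> T" "t \<in> L #> g" unfolding t_def T_def using C some by blast+
    then obtain l where l: "l \<in> L" "t = l \<otimes> g" unfolding r_coset_def by blast
    have "\<phi> t ` A = \<phi> l ` \<phi> g ` A"
      using act_image_mult[OF subgroup.mem_carrier[OF sL l(1)] g A] l(2) by simp
    also have "\<dots> = \<phi> g ` A"
      using normal_act_image_invariant[OF L A inv g] l(1) unfolding invariant_set_def by simp
    finally show ?thesis using t(1) by blast
  qed
  then have "(\<lambda>g. \<phi> g ` A) ` carrier G = (\<lambda>g. \<phi> g ` A) ` T" using TG by blast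
  moreover have "finite T" "card T = card (rcosets L)"
    unfolding T_def using fin card_image[OF inj] by simp_all
  ultimately show ?thesis using that TG by blast
qed

end

text \<open>Let \<open>Z\<close> be the orbit closure of \<open>y\<close> under \<open>L\<close>. If \<open>D \<subseteq> Z\<close> is nonempty, closed and \<open>L\<close>-invariant,
  then the finitely many translates of \<open>D\<close> cover \<open>X\<close>, so one of them, \<open>qD\<close>, contains \<open>y\<close>
  and hence \<open>Z \<subseteq> qD \<subseteq> qZ\<close>. Iterating, \<open>Z \<subseteq> qZ \<subseteq> q\<^sup>2Z \<subseteq> \<dots>\<close>, and this chain returns to \<open>Z\<close> since a
  power of \<open>q\<close> lies in \<open>L\<close>; so \<open>qD = qZ\<close>, and \<open>Z\<close> is minimal. The translates of \<open>Z\<close> then partition \<open>X\<close> into finitely many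
  closed sets, which makes \<open>Z\<close> open.\<close>

lemma (in minimal_action) minimal_component:
  assumes fi: "finite_index G L" and L: "L \<lhd> G" and y: "y \<in> topspace X"
  obtains Z where "y \<in> Z" "closedin X Z" "openin X Z" "invariant_set (G\<lparr>carrier := L\<rparr>) \<phi> Z"
    "\<And>C. closedin X C \<Longrightarrow> invariant_set (G\<lparr>carrier := L\<rparr>) \<phi> C \<Longrightarrow> y \<in> C \<Longrightarrow> Z \<subseteq> C"
    "minimal_action (G\<lparr>carrier := L\<rparr>) (subtopology X Z) \<phi>"
proof -
  let ?L = "G\<lparr>carrier := L\<rparr>"
  have sL: "subgroup L G" by (rule normal_imp_subgroup[OF L])
  interpret L: continuous_action ?L X \<phi> by (rule subgroup_action[OF sL])
  define \<C> where "\<C> = {C. closedin X C \<and> invariant_set ?L \<phi> C \<and> y \<in> C}"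
  define Z where "Z = \<Inter>\<C>"
  have top: "topspace X \<in> \<C>"
    unfolding \<C>_def using y L.act_closed by (auto intro!: L.invariant_setI)
  have yZ: "y \<in> Z" unfolding Z_def \<C>_def by blast
  have Zmin: "Z \<subseteq> C" if "closedin X C" "invariant_set ?L \<phi> C" "y \<in> C" for C
    unfolding Z_def \<C>_def using that by blast
  have ZC: "closedin X Z" unfolding Z_def using top by (intro closedin_Inter) (auto simp: \<C>_def)
  have ZX: "Z \<subseteq> topspace X" by (rule closedin_subset[OF ZC])
  have Zinv: "invariant_set ?L \<phi> Z"
  proof (rule L.invariant_setI[OF ZX])
    fix l x assume l: "l \<in> carrier ?L" and x: "x \<in> Z"
    show "\<phi> l x \<in> Z" unfolding Z_def
    proof
      fix C assume C: "C \<in> \<C>"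
      then have "x \<in> C" using x unfolding Z_def by blast
      then show "\<phi> l x \<in> C" using C L.invariant_setD[OF _ l] unfolding \<C>_def by blast
    qed
  qed
  have Zsub: "D = Z" if D: "closedin X D" "D \<subseteq> Z" "D \<noteq> {}" "invariant_set ?L \<phi> D" for D
  proof -
    have DX: "D \<subseteq> topspace X" by (rule closedin_subset[OF D(1)])
    obtain T where T: "finite T" "T \<subseteq> carrier G" "(\<lambda>g. \<phi> g ` D) ` carrier G = (\<lambda>g. \<phi> g ` D) ` T"
      using finite_translates[OF fi L DX D(4)] .
    have "closedin X (\<Union>t\<in>T. \<phi> t ` D)"
      using T(1,2) closedin_act_image[OF _ D(1)] by (intro closedin_Union) auto
    then have "closedin X (saturation D)" unfolding saturation_def T(3) .
    then have "saturation D = topspace X"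
      using minimal saturation_invariant[OF DX] saturation_superset[OF DX] D(3) by blast
    then obtain q where q: "q \<in> carrier G" "y \<in> \<phi> q ` D" using y unfolding saturation_def by blast
    have "Z \<subseteq> \<phi> q ` D"
      by (rule Zmin[OF closedin_act_image[OF q(1) D(1)] normal_act_image_invariant[OF L DX D(4) q(1)] q(2)])
    moreover have qD: "\<phi> q ` D \<subseteq> \<phi> q ` Z" using D(2) by blast
    ultimately have qZ: "Z \<subseteq> \<phi> q ` Z" by blast
    obtain m :: nat where m: "m > 0" "q [^] m \<in> L" using power_in_finite_index[OF fi q(1)] .
    have chain: "\<phi> q ` Z \<subseteq> \<phi> (q [^] Suc k) ` Z" for k :: nat
    proof (induction k)
      case 0
      then show ?case using q(1) by simp
    next
      case (Suc k)
      have "\<phi> q ` Z \<subseteq> \<phi> (q [^] Suc k) ` Z" by (rule Suc)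
      also have "\<dots> \<subseteq> \<phi> (q [^] Suc k) ` \<phi> q ` Z" using qZ by (rule image_mono)
      also have "\<dots> = \<phi> (q [^] Suc (Suc k)) ` Z"
        using act_image_mult[of "q [^] Suc k" q Z] q(1) ZX by simp
      finally show ?case .
    qed
    have "\<phi> q ` Z \<subseteq> \<phi> (q [^] m) ` Z" using chain[of "m - 1"] m(1) by simp
    also have "\<dots> = Z" using Zinv m(2) unfolding invariant_set_def by simp
    finally have "\<phi> q ` D = \<phi> q ` Z" using \<open>Z \<subseteq> \<phi> q ` D\<close> qD by blast
    then show "D = Z" using inj_on_image_eq_iff[OF act_inj_on[OF q(1)] DX ZX] by blast
  qed
  have le: "Z \<subseteq> \<phi> g ` Z" if g: "g \<in> carrier G" and ne: "\<phi> g ` Z \<inter> Z \<noteq> {}" for g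
  proof -
    have "invariant_set ?L \<phi> (\<phi> g ` Z)" by (rule normal_act_image_invariant[OF L ZX Zinv g])
    then have "invariant_set ?L \<phi> (\<phi> g ` Z \<inter> Z)"
      using L.invariant_setD[OF _ _] Zinv ZX by (intro L.invariant_setI) (auto simp del: image_iff)
    then have "\<phi> g ` Z \<inter> Z = Z"
      using Zsub closedin_Int[OF closedin_act_image[OF g ZC] ZC] ne by blast
    then show ?thesis by blast
  qed
  have eq: "\<phi> g ` Z = Z" if g: "g \<in> carrier G" and ne: "\<phi> g ` Z \<inter> Z \<noteq> {}" for g
  proof
    show "Z \<subseteq> \<phi> g ` Z" by (rule le[OF g ne])
    have cancel: "\<phi> (inv g) ` \<phi> g ` Z = Z"
      using act_image_mult[of "inv g" g Z] g ZX by (simp add: act_image_one)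
    have "\<phi> (inv g) ` (\<phi> g ` Z \<inter> Z) = Z \<inter> \<phi> (inv g) ` Z"
      using act_image_Int[of "inv g" "\<phi> g ` Z" Z] g ZX act_image_subset cancel by simp
    then have "\<phi> (inv g) ` Z \<inter> Z \<noteq> {}" using ne by blast
    then have "Z \<subseteq> \<phi> (inv g) ` Z" using le[of "inv g"] g by blast
    then have "\<phi> g ` Z \<subseteq> \<phi> g ` \<phi> (inv g) ` Z" by (rule image_mono)
    then show "\<phi> g ` Z \<subseteq> Z"
      using act_image_mult[of g "inv g" Z] g ZX by (simp add: act_image_one)
  qed
  obtain T where T: "finite T" "T \<subseteq> carrier G" "(\<lambda>g. \<phi> g ` Z) ` carrier G = (\<lambda>g. \<phi> g ` Z) ` T"
    using finite_translates[OF fi L ZX Zinv] .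
  have "closedin X (\<Union>t\<in>T. \<phi> t ` Z)"
    using T(1,2) closedin_act_image[OF _ ZC] by (intro closedin_Union) auto
  then have "closedin X (saturation Z)" unfolding saturation_def T(3) .
  then have cover: "saturation Z = topspace X"
    using minimal saturation_invariant[OF ZX] saturation_superset[OF ZX] yZ by blast
  have "topspace X - Z = (\<Union>t\<in>{t \<in> T. \<phi> t ` Z \<noteq> Z}. \<phi> t ` Z)"
  proof
    show "topspace X - Z \<subseteq> (\<Union>t\<in>{t \<in> T. \<phi> t ` Z \<noteq> Z}. \<phi> t ` Z)"
      unfolding cover[symmetric] saturation_def T(3) by blast
    show "(\<Union>t\<in>{t \<in> T. \<phi> t ` Z \<noteq> Z}. \<phi> t ` Z) \<subseteq> topspace X - Z"
    proof
      fix x assume "x \<in> (\<Union>t\<in>{t \<in> T. \<phi> t ` Z \<noteq> Z}. \<phi> t ` Z)"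
      then obtain t where t: "t \<in> T" "\<phi> t ` Z \<noteq> Z" "x \<in> \<phi> t ` Z" by blast
      then have "t \<in> carrier G" using T(2) by blast
      then show "x \<in> topspace X - Z" using t eq[of t] act_image_subset[of t Z] ZX by blast
    qed
  qed
  moreover have "closedin X (\<Union>t\<in>{t \<in> T. \<phi> t ` Z \<noteq> Z}. \<phi> t ` Z)"
    using T(1,2) closedin_act_image[OF _ ZC] by (intro closedin_Union) auto
  ultimately have ZO: "openin X Z" unfolding openin_closedin_eq using ZX by simp
  have "minimal_action ?L (subtopology X Z) \<phi>"
    unfolding minimal_action_def minimal_action_axioms_def
  proof (intro conjI allI impI)
    show "continuous_action ?L (subtopology X Z) \<phi>" by (rule L.subspace_action[OF ZC Zinv])
    show "topspace (subtopology X Z) \<noteq> {}" using yZ ZX by auto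
    fix C assume C: "closedin (subtopology X Z) C" "C \<noteq> {}" "invariant_set ?L \<phi> C"
    then have "closedin X C" "C \<subseteq> Z" using closedin_closed_subtopology[OF ZC] by auto
    then show "C = topspace (subtopology X Z)" using Zsub C ZX by auto
  qed
  then show ?thesis using that yZ ZC ZO Zinv Zmin by blast
qed

section \<open>Ergodic components of a normal subgroup of finite index\<close>

locale ergodic_action = minimal_action G X \<phi> for G (structure) and X :: "'x topology" and \<phi> +
  fixes \<mu> :: "'x measure"
  assumes ergodic_measure: "ergodic_measure G X \<phi> \<mu>"
begin

lemma prob_space_measure: "prob_space \<mu>"
  and sets_measure: "sets \<mu> = sets (borel_of X)"
  and emeasure_act_image: "g \<in> carrier G \<Longrightarrow> A \<in> sets \<mu> \<Longrightarrow> emeasure \<mu> (\<phi> g ` A) = emeasure \<mu> A"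
  and ergodic: "A \<in> sets \<mu> \<Longrightarrow> invariant_set G \<phi> A \<Longrightarrow> measure \<mu> A \<in> {0, 1}"
  using ergodic_measure unfolding ergodic_measure_def invariant_measure_def by blast+

sublocale prob_space \<mu> by (rule prob_space_measure)

lemma space_measure: "space \<mu> = topspace X"
  using sets_eq_imp_space_eq[OF sets_measure] by (simp add: space_borel_of)

lemma sets_measure_subset: "A \<in> sets \<mu> \<Longrightarrow> A \<subseteq> topspace X"
  using sets.sets_into_space space_measure by blast

lemma sets_measure_act_image: "g \<in> carrier G \<Longrightarrow> A \<in> sets \<mu> \<Longrightarrow> \<phi> g ` A \<in> sets \<mu>"
  using sets_act_image sets_measure by blast

lemma measure_act_image: "g \<in> carrier G \<Longrightarrow> A \<in> sets \<mu> \<Longrightarrow> prob (\<phi> g ` A) = prob A"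
  using emeasure_act_image by (simp add: measure_def)

lemma closedin_measurable: "closedin X C \<Longrightarrow> C \<in> sets \<mu>"
  unfolding sets_measure by (rule closedin_sets_borel_of)

lemma saturation_measurable: "A \<in> sets \<mu> \<Longrightarrow> saturation A \<in> sets \<mu>"
  using sets_saturation sets_measure by blast

lemma measure_saturation:
  assumes A: "A \<in> sets \<mu>" and pos: "prob A > 0"
  shows "prob (saturation A) = 1"
proof -
  have AX: "A \<subseteq> topspace X" by (rule sets_measure_subset[OF A])
  have "prob A \<le> prob (saturation A)"
    by (rule finite_measure_mono[OF saturation_superset[OF AX] saturation_measurable[OF A]])
  then show ?thesis using pos ergodic[OF saturation_measurable[OF A] saturation_invariant[OF AX]] by auto
qed

lemma component_measure_bound:
  assumes fi: "finite_index G L" and L: "L \<lhd> G"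
    and B: "B \<in> sets \<mu>" "invariant_set (G\<lparr>carrier := L\<rparr>) \<phi> B" and pos: "prob B > 0"
  shows "1 \<le> card (rcosets L) * prob B"
proof -
  obtain T where T: "finite T" "T \<subseteq> carrier G" "(\<lambda>g. \<phi> g ` B) ` carrier G = (\<lambda>g. \<phi> g ` B) ` T"
    "card T = card (rcosets L)"
    using finite_translates[OF fi L sets_measure_subset[OF B(1)] B(2)] .
  have "1 = prob (\<Union>t\<in>T. \<phi> t ` B)"
    using measure_saturation[OF B(1) pos] unfolding saturation_def T(3) by simp
  also have "\<dots> \<le> (\<Sum>t\<in>T. prob (\<phi> t ` B))"
    by (rule finite_measure_subadditive_finite[OF T(1)]) (use T(2) B(1) sets_measure_act_image in blast)
  also have "\<dots> = (\<Sum>t\<in>T. prob B)"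
    by (rule sum.cong) (use T(2) B(1) measure_act_image in auto)
  finally show ?thesis using T(4) by simp
qed

text \<open>Ergodicity may be lost under \<open>L\<close>, but an \<open>L\<close>-invariant set of positive measure has measure at
  least \<open>1/n\<close>, where \<open>n\<close> is the index, because its translates cover almost everything. So
  splitting a set repeatedly into invariant pieces of positive measure stops after at most \<open>n\<close> steps.\<close>

lemma ergodic_component:
  assumes fi: "finite_index G L" and L: "L \<lhd> G"
    and Z: "Z \<in> sets \<mu>" "invariant_set (G\<lparr>carrier := L\<rparr>) \<phi> Z" and pos: "prob Z > 0"
  obtains A where "A \<in> sets \<mu>" "A \<subseteq> Z" "invariant_set (G\<lparr>carrier := L\<rparr>) \<phi> A" "prob A > 0"
    "\<And>B. B \<in> sets \<mu> \<Longrightarrow> B \<subseteq> A \<Longrightarrow> invariant_set (G\<lparr>carrier := L\<rparr>) \<phi> B \<Longrightarrow> prob B = 0 \<or> prob B = prob A"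
proof -
  let ?L = "G\<lparr>carrier := L\<rparr>"
  let ?n = "real (card (rcosets L))"
  interpret L: continuous_action ?L X \<phi> by (rule subgroup_action[OF normal_imp_subgroup[OF L]])
  define P where "P k A \<longleftrightarrow>
    A \<in> sets \<mu> \<and> A \<subseteq> Z \<and> invariant_set ?L \<phi> A \<and> prob A > 0 \<and> ?n * prob A \<le> real k" for k :: nat and A
  obtain k0 :: nat where "?n * prob Z \<le> real k0" using real_arch_simple by blast
  then have "\<exists>A. P k0 A" unfolding P_def using Z pos by blast
  (* Both parts of a splitting satisfy ?n * prob \<ge> 1, so each of them has a smaller bound k. *)
  define k where "k = (LEAST k. \<exists>A. P k A)"
  obtain A where A: "P k A" unfolding k_def using LeastI_ex[of "\<lambda>k. \<exists>A. P k A"] \<open>\<exists>A. P k0 A\<close> by blast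
  have Aset: "A \<in> sets \<mu>" "A \<subseteq> Z" "invariant_set ?L \<phi> A" "prob A > 0" "?n * prob A \<le> real k"
    using A unfolding P_def by auto
  have "prob B = 0 \<or> prob B = prob A"
    if B: "B \<in> sets \<mu>" "B \<subseteq> A" "invariant_set ?L \<phi> B" for B
  proof (rule ccontr)
    assume "\<not> (prob B = 0 \<or> prob B = prob A)"
    moreover have diff: "prob (A - B) = prob A - prob B"
      by (rule finite_measure_Diff[OF Aset(1) B(1,2)])
    ultimately have posB: "prob B > 0" and posD: "prob (A - B) > 0"
      using finite_measure_mono[OF B(2) Aset(1)] measure_nonneg[of \<mu> B] by linarith+
    have "\<phi> l ` (A - B) = A - B" if "l \<in> L" for l
    proof -
      have lG: "l \<in> carrier G" using that subgroup.mem_carrier[OF normal_imp_subgroup[OF L]] by blast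
      have "\<phi> l ` (A - B) = \<phi> l ` A - \<phi> l ` B"
        using inj_on_image_set_diff[OF act_inj_on[OF lG], of A B] sets_measure_subset[OF Aset(1)]
          B(2) by blast
      then show ?thesis using Aset(3) B(3) that unfolding invariant_set_def by simp
    qed
    then have "invariant_set ?L \<phi> (A - B)" unfolding invariant_set_def by simp
    moreover have AB: "A - B \<in> sets \<mu>" using Aset(1) B(1) by blast
    ultimately have "1 \<le> ?n * prob (A - B)" using component_measure_bound[OF fi L _ _ posD] by simp
    then have "?n * prob B \<le> real k - 1" using diff Aset(5) by (simp add: right_diff_distrib)
    moreover have "1 \<le> ?n * prob B" using component_measure_bound[OF fi L B(1,3) posB] .
    ultimately have "P (k - 1) B" and "k > 0" unfolding P_def using B Aset(2) posB by auto
    then show False using not_less_Least[of "k - 1" "\<lambda>k. \<exists>A. P k A"] unfolding k_def by auto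
  qed
  then show ?thesis using that Aset by blast
qed

end

lemma sets_borel_of_subtopology:
  assumes "Z \<in> sets (borel_of X)"
  shows "sets (borel_of (subtopology X Z)) = {B \<in> sets (borel_of X). B \<subseteq> Z}"
proof -
  have ZX: "Z \<subseteq> topspace X" using sets.sets_into_space[OF assms] by (simp add: space_borel_of)
  have "sets (borel_of (subtopology X Z)) = sigma_sets Z ((\<inter>) Z ` {U. openin X U})"
    unfolding sets_borel_of using ZX
    by (intro arg_cong2[where f = sigma_sets]) (auto simp: openin_subtopology)
  also have "\<dots> = (\<inter>) Z ` sets (borel_of X)"
    using sigma_sets_Int[OF _ ZX] assms unfolding sets_borel_of by metis
  also have "\<dots> = {B \<in> sets (borel_of X). B \<subseteq> Z}" using assms by auto
  finally show ?thesis .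
qed

text \<open>The measure \<open>\<nu>\<close> is \<open>\<mu>\<close> conditioned on an ergodic piece \<open>A\<close> of the minimal component \<open>Z\<close> around \<open>y\<close>.
  Through the choice of \<open>y\<close> the component can be placed inside any given nonempty closed
  \<open>L\<close>-invariant set.\<close>

theorem (in ergodic_action) restrict_to_component:
  assumes fi: "finite_index G L" and L: "L \<lhd> G" and y: "y \<in> topspace X"
  obtains Z A \<nu> where "y \<in> Z" "closedin X Z" "openin X Z" "invariant_set (G\<lparr>carrier := L\<rparr>) \<phi> Z"
    "\<forall>C. closedin X C \<and> invariant_set (G\<lparr>carrier := L\<rparr>) \<phi> C \<and> y \<in> C \<longrightarrow> Z \<subseteq> C"
    "ergodic_action (G\<lparr>carrier := L\<rparr>) (subtopology X Z) \<phi> \<nu>"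
    "A \<in> sets \<mu>" "A \<subseteq> Z" "prob A > 0"
    "\<forall>B\<in>sets \<mu>. B \<subseteq> Z \<longrightarrow> emeasure \<nu> B = emeasure \<mu> (A \<inter> B) / emeasure \<mu> A"
proof -
  let ?L = "G\<lparr>carrier := L\<rparr>"
  have sL: "subgroup L G" by (rule normal_imp_subgroup[OF L])
  obtain Z where Z: "y \<in> Z" "closedin X Z" "openin X Z" "invariant_set ?L \<phi> Z"
    and Zmin: "\<And>C. closedin X C \<Longrightarrow> invariant_set ?L \<phi> C \<Longrightarrow> y \<in> C \<Longrightarrow> Z \<subseteq> C"
    and minZ: "minimal_action ?L (subtopology X Z) \<phi>"
    using minimal_component[OF fi L y] by blast
  have ZX: "Z \<subseteq> topspace X" by (rule closedin_subset[OF Z(2)])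
  have Zm: "Z \<in> sets \<mu>" by (rule closedin_measurable[OF Z(2)])
  obtain T where T: "finite T" "T \<subseteq> carrier G" "(\<lambda>g. \<phi> g ` Z) ` carrier G = (\<lambda>g. \<phi> g ` Z) ` T"
    using finite_translates[OF fi L ZX Z(4)] .
  have posZ: "prob Z > 0"
  proof (rule ccontr)
    assume "\<not> prob Z > 0"
    then have "prob Z = 0" using measure_nonneg[of \<mu> Z] by simp
    then have "prob (\<phi> t ` Z) = 0" if "t \<in> T" for t
      using that T(2) Zm measure_act_image by auto
    then have "prob (\<Union>t\<in>T. \<phi> t ` Z) \<le> 0"
      using finite_measure_subadditive_finite[OF T(1), of "\<lambda>t. \<phi> t ` Z"] T(2) Zm sets_measure_act_image
      by (force simp: subset_iff image_subset_iff)
    moreover have "closedin X (saturation Z)"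
      unfolding saturation_def T(3)
      using T(1,2) closedin_act_image[OF _ Z(2)] by (intro closedin_Union) auto
    then have "saturation Z = topspace X"
      using minimal saturation_invariant[OF ZX] saturation_superset[OF ZX] Z(1) by blast
    ultimately show False using prob_space unfolding space_measure saturation_def T(3) by simp
  qed
  obtain A where A: "A \<in> sets \<mu>" "A \<subseteq> Z" "invariant_set ?L \<phi> A" "prob A > 0"
    and Amin: "\<And>B. B \<in> sets \<mu> \<Longrightarrow> B \<subseteq> A \<Longrightarrow> invariant_set ?L \<phi> B \<Longrightarrow> prob B = 0 \<or> prob B = prob A"
    using ergodic_component[OF fi L Zm Z(4) posZ] by blast
  have AX: "A \<subseteq> topspace X" using A(2) ZX by blast
  have eA: "emeasure \<mu> A \<noteq> 0" "emeasure \<mu> A \<noteq> \<infinity>" using A(4) by (auto simp: emeasure_eq_measure)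
  define \<nu> where "\<nu> = restrict_space (uniform_measure \<mu> A) Z"
  have em: "emeasure \<nu> B = emeasure \<mu> (A \<inter> B) / emeasure \<mu> A" if "B \<in> sets \<mu>" "B \<subseteq> Z" for B
    unfolding \<nu>_def using that A(1) Zm sets_measure_subset[OF Zm]
    by (subst emeasure_restrict_space) (auto simp: space_measure Int_absorb2)
  have sets_\<nu>: "sets \<nu> = {B \<in> sets \<mu>. B \<subseteq> Z}"
    unfolding \<nu>_def sets_restrict_space using Zm by auto
  have sub: "sets (borel_of (subtopology X Z)) = {B \<in> sets \<mu>. B \<subseteq> Z}"
    using sets_borel_of_subtopology Zm unfolding sets_measure by blast
  have "ergodic_measure ?L (subtopology X Z) \<phi> \<nu>"
    unfolding ergodic_measure_def invariant_measure_def
  proof (intro conjI ballI impI)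
    show "prob_space \<nu>"
    proof (rule prob_spaceI)
      have "space \<nu> = Z" using ZX unfolding \<nu>_def by (auto simp: space_restrict_space space_measure)
      then show "emeasure \<nu> (space \<nu>) = 1"
        using em[OF Zm subset_refl] A(2) eA by (simp add: Int_absorb2 ennreal_divide_self less_top[symmetric])
    qed
    show "sets \<nu> = sets (borel_of (subtopology X Z))" unfolding sub sets_\<nu> ..
  next
    fix l B assume l: "l \<in> carrier ?L" and B: "B \<in> sets \<nu>"
    have lG: "l \<in> carrier G" using l subgroup.mem_carrier[OF sL] by simp
    have Bm: "B \<in> sets \<mu>" "B \<subseteq> Z" "B \<subseteq> topspace X" using B sets_\<nu> ZX by auto
    have lB: "\<phi> l ` B \<in> sets \<mu>" "\<phi> l ` B \<subseteq> Z"
      using sets_measure_act_image[OF lG Bm(1)] Z(4) l Bm(2) unfolding invariant_set_def by auto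
    have "A \<inter> \<phi> l ` B = \<phi> l ` (A \<inter> B)"
      using act_image_Int[OF lG AX Bm(3)] A(3) l unfolding invariant_set_def by simp
    then have "emeasure \<mu> (A \<inter> \<phi> l ` B) = emeasure \<mu> (A \<inter> B)"
      using emeasure_act_image[OF lG] A(1) Bm(1) by simp
    then show "emeasure \<nu> (\<phi> l ` B) = emeasure \<nu> B" using em lB Bm by simp
  next
    fix B assume B: "B \<in> sets \<nu>" and inv: "invariant_set ?L \<phi> B"
    have Bm: "B \<in> sets \<mu>" "B \<subseteq> Z" "B \<subseteq> topspace X" using B sets_\<nu> ZX by auto
    have "\<phi> l ` (A \<inter> B) = A \<inter> B" if "l \<in> L" for l
      using act_image_Int[OF subgroup.mem_carrier[OF sL that] AX Bm(3)] A(3) inv that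
      unfolding invariant_set_def by simp
    then have "prob (A \<inter> B) = 0 \<or> prob (A \<inter> B) = prob A"
      using Amin[of "A \<inter> B"] A(1) Bm(1) unfolding invariant_set_def by auto
    moreover have "emeasure \<nu> B = ennreal (prob (A \<inter> B) / prob A)"
      using em[OF Bm(1,2)] A(4) by (simp add: emeasure_eq_measure divide_ennreal)
    then have "measure \<nu> B = prob (A \<inter> B) / prob A" by (simp add: measure_def)
    ultimately show "measure \<nu> B \<in> {0, 1}" using A(4) by auto
  qed
  then have erg: "ergodic_action ?L (subtopology X Z) \<phi> \<nu>"
    using minZ unfolding ergodic_action_def ergodic_action_axioms_def by blast
  have "\<forall>C. closedin X C \<and> invariant_set ?L \<phi> C \<and> y \<in> C \<longrightarrow> Z \<subseteq> C" using Zmin by blast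
  moreover have "\<forall>B\<in>sets \<mu>. B \<subseteq> Z \<longrightarrow> emeasure \<nu> B = emeasure \<mu> (A \<inter> B) / emeasure \<mu> A"
    using em by simp
  ultimately show ?thesis using that[OF Z _ erg A(1,2,4)] by simp
qed

section \<open>Allosteric actions\<close>

text \<open>For a countable group acting on a compact Hausdorff space, topological freeness is equivalent to
  every nontrivial element fixing a set with empty interior, and failure of essential freeness to some
  nontrivial element fixing a set of positive measure. In this form both properties pass easily to subgroups and to induced actions.\<close>

locale allosteric_action = ergodic_action G X \<phi> \<mu>
  for G (structure) and X :: "'x topology" and \<phi> and \<mu> +
  assumes nowhere_dense_fixed_points:
      "\<lbrakk>g \<in> carrier G; g \<noteq> \<one>\<rbrakk> \<Longrightarrow> X interior_of fixed_points g = {}"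
    and fixed_points_not_null: "\<exists>g\<in>carrier G. g \<noteq> \<one> \<and> prob (fixed_points g) > 0"

lemma (in allosteric_action) imp_allosteric:
  assumes fg: "finitely_generated G"
  shows "allosteric G"
proof -
  let ?r = "\<lambda>g. restrict (\<phi> g) (topspace X)"
  have stab: "stabilizer G ?r x = {g \<in> carrier G. x \<in> fixed_points g}" if "x \<in> topspace X" for x
    using that unfolding stabilizer_def fixed_points_def by auto
  have img: "?r g ` A = \<phi> g ` A" if "A \<subseteq> topspace X" for g A
    using that by (intro image_cong) auto
  obtain k where k: "k \<in> carrier G" "k \<noteq> \<one>" "prob (fixed_points k) > 0"
    using fixed_points_not_null by blast
  show ?thesis
  proof (rule allostericI)
    show "minimal_system G X ?r"
      by (rule minimal_action_imp_minimal_system[OF minimal_action_axioms fg])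
    define \<U> where "\<U> = (\<lambda>g. topspace X - fixed_points g) ` (carrier G - {\<one>})"
    define U where "U = from_nat_into \<U>"
    have "countable \<U>" "\<U> \<noteq> {}" unfolding \<U>_def using k countable_carrier by auto
    then have ran: "range U = \<U>" unfolding U_def by simp
    have dense: "openin X V \<and> X closure_of V = topspace X" if V: "V \<in> \<U>" for V
    proof -
      obtain g where g: "g \<in> carrier G" "g \<noteq> \<one>" "V = topspace X - fixed_points g"
        using V unfolding \<U>_def by blast
      then show ?thesis
        using closedin_fixed_points[OF g(1)] nowhere_dense_fixed_points[OF g(1,2)]
        by (simp add: closure_of_complement openin_diff)
    qed
    have "(\<Inter>n. U n) \<subseteq> {x \<in> topspace X. stabilizer G ?r x = {\<one>}}"
    proof
      fix x assume "x \<in> (\<Inter>n. U n)"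
      then have x: "x \<in> V" if "V \<in> \<U>" for V using that unfolding ran[symmetric] by blast
      then have xX: "x \<in> topspace X" using k(1,2) unfolding \<U>_def by blast
      have "x \<notin> fixed_points g" if "g \<in> carrier G" "g \<noteq> \<one>" for g
        using x that unfolding \<U>_def by blast
      moreover have "x \<in> fixed_points \<one>" using xX act_one unfolding fixed_points_def by simp
      ultimately have "stabilizer G ?r x = {\<one>}" unfolding stab[OF xX] by auto
      with xX show "x \<in> {x \<in> topspace X. stabilizer G ?r x = {\<one>}}" by blast
    qed
    moreover have "openin X (U n) \<and> X closure_of U n = topspace X" for n using dense ran by blast
    ultimately show "topologically_free G X ?r"
      unfolding topologically_free_def residual_in_def by blast
    have inv: "invariant_set G ?r A \<longleftrightarrow> invariant_set G \<phi> A" if "A \<in> sets \<mu>" for A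
      unfolding invariant_set_def using img[OF sets_measure_subset[OF that]] by simp
    show "ergodic_measure G X ?r \<mu>"
      unfolding ergodic_measure_def invariant_measure_def
      using prob_space_measure sets_measure emeasure_act_image ergodic inv img sets_measure_subset
      by simp
    show "\<not> essentially_free G ?r \<mu>"
    proof
      assume "essentially_free G ?r \<mu>"
      then have "AE x in \<mu>. stabilizer G ?r x = {\<one>}" unfolding essentially_free_def .
      then have "AE x in \<mu>. x \<notin> fixed_points k"
        by (rule AE_mp) (rule AE_I2, use k stab in \<open>auto simp: space_measure\<close>)
      moreover have "fixed_points k \<in> sets \<mu>"
        by (rule closedin_measurable[OF closedin_fixed_points[OF k(1)]])
      ultimately have "prob (fixed_points k) = 0"
        using prob_eq_0 by blast
      with k(3) show False by simp
    qed
  qed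
qed

text \<open>If the kernel of \<open>p\<close> acts trivially, then all preimages of an element of the image act in the same
  way, so the image acts, with the same invariant sets.\<close>

lemma (in ergodic_action) factor_action:
  assumes K: "group K" and p: "p \<in> hom G K"
    and triv: "\<And>g x. g \<in> carrier G \<Longrightarrow> p g = \<one>\<^bsub>K\<^esub> \<Longrightarrow> x \<in> topspace X \<Longrightarrow> \<phi> g x = x"
  obtains \<psi> where "ergodic_action (K\<lparr>carrier := p ` carrier G\<rparr>) X \<psi> \<mu>"
    "\<And>g x. g \<in> carrier G \<Longrightarrow> x \<in> topspace X \<Longrightarrow> \<psi> (p g) x = \<phi> g x"
proof -
  interpret K: group K by fact
  interpret p: group_hom G K p using p by unfold_locales auto
  let ?P = "K\<lparr>carrier := p ` carrier G\<rparr>"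
  define \<psi> where "\<psi> k = \<phi> (SOME g. g \<in> carrier G \<and> p g = k)" for k
  have \<psi>: "\<psi> (p g) x = \<phi> g x" if g: "g \<in> carrier G" and x: "x \<in> topspace X" for g x
  proof -
    define h where "h = (SOME h. h \<in> carrier G \<and> p h = p g)"
    have h: "h \<in> carrier G" "p h = p g"
      using someI[of "\<lambda>h. h \<in> carrier G \<and> p h = p g" g] g unfolding h_def by auto
    have "p (inv g \<otimes> h) = \<one>\<^bsub>K\<^esub>" using g h by simp
    then have "\<phi> (inv g \<otimes> h) x = x" using triv g h x by simp
    then have "\<phi> g (\<phi> (inv g \<otimes> h) x) = \<phi> g x" by simp
    then have "\<phi> h x = \<phi> g x" using g h x by (simp add: act_mult act_inv act_closed)
    then show ?thesis unfolding \<psi>_def h_def .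
  qed
  have P: "subgroup (p ` carrier G) K" by (rule p.img_is_subgroup)
  interpret P: group ?P by (rule K.subgroup_imp_group[OF P])
  have inv: "invariant_set ?P \<psi> A \<longleftrightarrow> invariant_set G \<phi> A" if "A \<subseteq> topspace X" for A
  proof -
    have "\<psi> (p g) ` A = \<phi> g ` A" if "g \<in> carrier G" for g
      using \<psi>[OF that] \<open>A \<subseteq> topspace X\<close> by (intro image_cong) auto
    then show ?thesis unfolding invariant_set_def by auto
  qed
  have img: "\<psi> (p g) ` A = \<phi> g ` A" if "g \<in> carrier G" "A \<subseteq> topspace X" for g A
    using \<psi>[OF that(1)] that(2) by (intro image_cong) auto
  have "ergodic_action ?P X \<psi> \<mu>"
  proof unfold_locales
    show "countable (carrier ?P)" using countable_carrier by simp
    show "\<psi> \<one>\<^bsub>?P\<^esub> x = x" if "x \<in> topspace X" for x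
      using \<psi>[OF one_closed that] act_one[OF that] by simp
    show "\<psi> (g \<otimes>\<^bsub>?P\<^esub> h) x = \<psi> g (\<psi> h x)"
      if g: "g \<in> carrier ?P" and h: "h \<in> carrier ?P" and x: "x \<in> topspace X" for g h x
    proof -
      obtain a b where ab: "a \<in> carrier G" "b \<in> carrier G" "g = p a" "h = p b" using g h by auto
      have "\<psi> (p (a \<otimes> b)) x = \<phi> a (\<phi> b x)" using \<psi>[of "a \<otimes> b" x] ab x by (simp add: act_mult del: p.hom_mult)
      then show ?thesis using ab \<psi> x by (simp add: act_closed)
    qed
    show "continuous_map X X (\<psi> g)" if g: "g \<in> carrier ?P" for g
    proof -
      obtain a where "a \<in> carrier G" "g = p a" using g by auto
      then show ?thesis using continuous_map_eq[OF act_continuous[of a]] \<psi> by metis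
    qed
    show "C = topspace X" if "closedin X C" "C \<noteq> {}" "invariant_set ?P \<psi> C" for C
      using minimal that inv[OF closedin_subset] by blast
    show "ergodic_measure ?P X \<psi> \<mu>"
      unfolding ergodic_measure_def invariant_measure_def
    proof (intro conjI ballI impI)
      fix k A assume "k \<in> carrier ?P" and A: "A \<in> sets \<mu>"
      then obtain g where "g \<in> carrier G" "k = p g" by auto
      then show "emeasure \<mu> (\<psi> k ` A) = emeasure \<mu> A"
        using img[OF _ sets_measure_subset[OF A]] emeasure_act_image A by simp
    next
      fix A assume "A \<in> sets \<mu>" "invariant_set ?P \<psi> A"
      then show "prob A \<in> {0, 1}" using inv[OF sets_measure_subset] ergodic by blast
    qed (auto simp: prob_space_measure sets_measure)
  qed (use compact Hausdorff nonempty in auto)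
  then show ?thesis using that \<psi> by blast
qed

section \<open>Induced actions\<close>

text \<open>The action induced from a subgroup \<open>P\<close> of finite index lives on \<open>G \<times>\<^sub>P Y\<close>. With a transversal \<open>T\<close>
  of the left cosets this space is \<open>Y \<times> T\<close>, on which an element moves the second coordinate as it moves
  the cosets, and corrects the first by a cocycle with values in \<open>P\<close>.\<close>

locale induced_action = group G for G (structure) +
  fixes P :: "'a set" and Y :: "'y topology" and \<psi> :: "'a \<Rightarrow> 'y \<Rightarrow> 'y" and \<mu> :: "'y measure"
  assumes countable_group: "countable (carrier G)"
    and finite_index: "finite_index G P"
    and base: "allosteric_action (G\<lparr>carrier := P\<rparr>) Y \<psi> \<mu>"
begin

sublocale base: allosteric_action "G\<lparr>carrier := P\<rparr>" Y \<psi> \<mu> by (rule base)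

definition rep :: "'a \<Rightarrow> 'a" where "rep g = (SOME x. x \<in> g <# P)"

definition transversal :: "'a set" where "transversal = rep ` carrier G"

definition cocycle :: "'a \<Rightarrow> 'a \<Rightarrow> 'a" where "cocycle g t = inv (rep (g \<otimes> t)) \<otimes> g \<otimes> t"

definition act :: "'a \<Rightarrow> 'y \<times> 'a \<Rightarrow> 'y \<times> 'a" where
  "act g = (\<lambda>(y, t). (\<psi> (cocycle g t) y, rep (g \<otimes> t)))"

definition induced_space :: "('y \<times> 'a) topology" where
  "induced_space = prod_topology Y (discrete_topology transversal)"

definition slice :: "('y \<times> 'a) set \<Rightarrow> 'a \<Rightarrow> 'y set" where
  "slice B t = {y. (y, t) \<in> B}"

definition induced_measure :: "('y \<times> 'a) measure" where
  "induced_measure = measure_of (space (borel_of induced_space)) (sets (borel_of induced_space))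
     (\<lambda>B. inverse (of_nat (card transversal)) * (\<Sum>t\<in>transversal. emeasure \<mu> (slice B t)))"

lemma subgroup_P: "subgroup P G"
  using finite_index unfolding finite_index_def by blast

lemma P_carrier: "p \<in> P \<Longrightarrow> p \<in> carrier G"
  using subgroup.mem_carrier[OF subgroup_P] .

lemma rep_in_coset:
  assumes "g \<in> carrier G"
  obtains p where "p \<in> P" "rep g = g \<otimes> p"
proof -
  have "g \<otimes> \<one> \<in> g <# P" using subgroup.one_closed[OF subgroup_P] unfolding l_coset_def by blast
  then have "rep g \<in> g <# P" unfolding rep_def by (rule someI)
  then show ?thesis using that unfolding l_coset_def by blast
qed

lemma rep_closed: "g \<in> carrier G \<Longrightarrow> rep g \<in> carrier G"
  using rep_in_coset[of g] P_carrier by (metis m_closed)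

lemma rep_mult:
  assumes "g \<in> carrier G" "p \<in> P"
  shows "rep (g \<otimes> p) = rep g"
proof -
  have "g \<otimes> p \<in> g <# P" using assms(2) unfolding l_coset_def by blast
  then have "g <# P = (g \<otimes> p) <# P" by (rule l_repr_independence[OF _ assms(1) subgroup_P])
  then show ?thesis unfolding rep_def by simp
qed

lemma rep_mult_rep:
  assumes "g \<in> carrier G" "h \<in> carrier G"
  shows "rep (g \<otimes> rep h) = rep (g \<otimes> h)"
proof -
  obtain p where p: "p \<in> P" "rep h = h \<otimes> p" using rep_in_coset[OF assms(2)] .
  then have "g \<otimes> rep h = (g \<otimes> h) \<otimes> p" using assms P_carrier by (simp add: m_assoc)
  then show ?thesis using rep_mult[of "g \<otimes> h" p] assms p(1) by simp
qed

lemma transversal_carrier: "t \<in> transversal \<Longrightarrow> t \<in> carrier G"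
  unfolding transversal_def using rep_closed by blast

lemma rep_transversal: "t \<in> transversal \<Longrightarrow> rep t = t"
  unfolding transversal_def using rep_mult_rep[of \<one>] rep_closed by auto

lemma rep_mem: "g \<in> carrier G \<Longrightarrow> rep g \<in> transversal"
  unfolding transversal_def by blast

lemma finite_transversal: "finite transversal"
proof -
  obtain S where S: "finite S" "S \<subseteq> carrier G" "\<And>g. g \<in> carrier G \<Longrightarrow> \<exists>s\<in>S. \<exists>k\<in>P. g = k \<otimes> s"
    using finite_index unfolding finite_index_iff by blast
  have "rep g \<in> (\<lambda>s. rep (inv s)) ` S" if g: "g \<in> carrier G" for g
  proof -
    obtain s k where s: "s \<in> S" "k \<in> P" "inv g = k \<otimes> s" using S(3)[of "inv g"] g by auto
    have sG: "s \<in> carrier G" using s(1) S(2) by blast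
    have "g = inv (k \<otimes> s)" using s(3) g by (metis inv_inv)
    then have "g = inv s \<otimes> inv k" using sG P_carrier[OF s(2)] by (simp add: inv_mult_group)
    then have "rep g = rep (inv s)"
      using rep_mult[of "inv s" "inv k"] sG subgroup.m_inv_closed[OF subgroup_P s(2)] by simp
    then show ?thesis using s(1) by blast
  qed
  then have "transversal \<subseteq> (\<lambda>s. rep (inv s)) ` S" unfolding transversal_def by blast
  then show ?thesis using S(1) finite_surj by blast
qed

lemma transversal_nonempty: "transversal \<noteq> {}"
  unfolding transversal_def by auto

lemma cocycle_closed:
  assumes g: "g \<in> carrier G" and t: "t \<in> carrier G"
  shows "cocycle g t \<in> P"
proof -
  obtain p where p: "p \<in> P" "rep (g \<otimes> t) = g \<otimes> t \<otimes> p" using rep_in_coset[of "g \<otimes> t"] g t by auto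
  have "cocycle g t = inv p"
    unfolding cocycle_def p(2) using g t P_carrier[OF p(1)]
    by (simp add: inv_mult_group m_assoc inv_solve_right')
  then show ?thesis using subgroup.m_inv_closed[OF subgroup_P p(1)] by simp
qed

lemma cocycle_mult:
  assumes "g \<in> carrier G" "h \<in> carrier G" "t \<in> carrier G"
  shows "cocycle (g \<otimes> h) t = cocycle g (rep (h \<otimes> t)) \<otimes> cocycle h t"
proof -
  have "rep (h \<otimes> t) \<otimes> (inv (rep (h \<otimes> t)) \<otimes> (h \<otimes> t)) = h \<otimes> t"
    using assms by (simp add: m_assoc[symmetric] rep_closed)
  then show ?thesis
    unfolding cocycle_def using assms by (simp add: m_assoc rep_closed rep_mult_rep)
qed

lemma bij_betw_rep_mult:
  assumes g: "g \<in> carrier G"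
  shows "bij_betw (\<lambda>t. rep (g \<otimes> t)) transversal transversal"
proof (rule bij_betw_byWitness[where f' = "\<lambda>t. rep (inv g \<otimes> t)"])
  show "\<forall>t\<in>transversal. rep (inv g \<otimes> rep (g \<otimes> t)) = t"
    using g transversal_carrier by (simp add: rep_mult_rep m_assoc[symmetric] rep_transversal)
  show "\<forall>t\<in>transversal. rep (g \<otimes> rep (inv g \<otimes> t)) = t"
    using g transversal_carrier by (simp add: rep_mult_rep m_assoc[symmetric] rep_transversal)
qed (use g transversal_carrier rep_mem in auto)

lemma topspace_induced: "topspace induced_space = topspace Y \<times> transversal"
  unfolding induced_space_def by simp

lemma continuous_section: "t \<in> transversal \<Longrightarrow> continuous_map Y induced_space (\<lambda>y. (y, t))"
  unfolding induced_space_def by (intro continuous_map_pairedI) auto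

lemma openin_induced_iff:
  "openin induced_space U \<longleftrightarrow>
     U \<subseteq> topspace induced_space \<and> (\<forall>t\<in>transversal. openin Y (slice U t))"
proof (intro iffI conjI ballI)
  assume U: "openin induced_space U"
  show "U \<subseteq> topspace induced_space" by (rule openin_subset[OF U])
  fix t assume "t \<in> transversal"
  from openin_continuous_map_preimage[OF continuous_section[OF this] U]
  have "openin Y {y \<in> topspace Y. (y, t) \<in> U}" .
  moreover have "{y \<in> topspace Y. (y, t) \<in> U} = slice U t"
    using openin_subset[OF U] unfolding slice_def topspace_induced by auto
  ultimately show "openin Y (slice U t)" by simp
next
  assume U: "U \<subseteq> topspace induced_space \<and> (\<forall>t\<in>transversal. openin Y (slice U t))"
  then have "U = (\<Union>t\<in>transversal. slice U t \<times> {t})"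
    unfolding slice_def topspace_induced by auto
  moreover have "openin induced_space (slice U t \<times> {t})" if "t \<in> transversal" for t
    using U that unfolding induced_space_def by (simp add: openin_prod_Times_iff)
  ultimately show "openin induced_space U" by (metis (no_types, lifting) openin_Union imageE)
qed

lemma closedin_slice:
  assumes C: "closedin induced_space C" and t: "t \<in> transversal"
  shows "closedin Y (slice C t)"
proof -
  have "closedin Y {y \<in> topspace Y. (y, t) \<in> C}"
    by (rule closedin_continuous_map_preimage[OF continuous_section[OF t] C])
  moreover have "{y \<in> topspace Y. (y, t) \<in> C} = slice C t"
    using closedin_subset[OF C] unfolding slice_def topspace_induced by auto
  ultimately show ?thesis by simp
qed

lemma sets_slice:
  assumes B: "B \<in> sets (borel_of induced_space)" and t: "t \<in> transversal"
  shows "slice B t \<in> sets \<mu>"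
proof -
  have "(\<lambda>y. (y, t)) -` B \<inter> topspace Y \<in> sets (borel_of Y)"
    using measurable_sets[OF continuous_map_measurable[OF continuous_section[OF t]] B]
    by (simp add: space_borel_of)
  moreover have "(\<lambda>y. (y, t)) -` B \<inter> topspace Y = slice B t"
    using sets.sets_into_space[OF B] unfolding slice_def space_borel_of topspace_induced by auto
  ultimately show ?thesis by (simp add: base.sets_measure)
qed

lemma slice_act_image:
  assumes g: "g \<in> carrier G" and t: "t \<in> transversal" and B: "B \<subseteq> topspace induced_space"
  shows "slice (act g ` B) (rep (g \<otimes> t)) = \<psi> (cocycle g t) ` slice B t"
proof (intro equalityI subsetI)
  fix z assume "z \<in> slice (act g ` B) (rep (g \<otimes> t))"
  then obtain y s where ys: "(y, s) \<in> B" "rep (g \<otimes> s) = rep (g \<otimes> t)" "z = \<psi> (cocycle g s) y"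
    unfolding slice_def act_def by auto
  then have "s \<in> transversal" using B unfolding topspace_induced by auto
  then have "s = t" using bij_betw_rep_mult[OF g] t ys(2) unfolding bij_betw_def inj_on_def by blast
  with ys show "z \<in> \<psi> (cocycle g t) ` slice B t" unfolding slice_def by blast
qed (force simp: slice_def act_def)

sublocale induced: continuous_action G induced_space act
proof unfold_locales
  show "countable (carrier G)" by (rule countable_group)
  show "compact_space induced_space"
    unfolding induced_space_def
    using base.compact finite_transversal by (simp add: compact_space_prod_topology compact_space_discrete_topology)
  show "Hausdorff_space induced_space"
    unfolding induced_space_def using base.Hausdorff by (simp add: Hausdorff_space_prod_topology)
  show "act \<one> x = x" if "x \<in> topspace induced_space" for x
    using that transversal_carrier base.act_one
    by (auto simp: topspace_induced act_def cocycle_def rep_transversal)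
  show "act (g \<otimes> h) x = act g (act h x)"
    if "g \<in> carrier G" "h \<in> carrier G" "x \<in> topspace induced_space" for g h x
    using that transversal_carrier base.act_mult cocycle_closed
    by (auto simp: topspace_induced act_def cocycle_mult m_assoc rep_mult_rep rep_closed)
next
  fix g assume g: "g \<in> carrier G"
  have closed: "act g x \<in> topspace induced_space" if "x \<in> topspace induced_space" for x
    using that g transversal_carrier base.act_closed cocycle_closed rep_mem
    by (auto simp: topspace_induced act_def)
  show "continuous_map induced_space induced_space (act g)"
    unfolding continuous_map_def
  proof (intro conjI allI impI)
    show "act g \<in> topspace induced_space \<rightarrow> topspace induced_space" using closed by blast
    fix U assume U: "openin induced_space U"
    show "openin induced_space {x \<in> topspace induced_space. act g x \<in> U}"
      unfolding openin_induced_iff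
    proof (intro conjI ballI)
      fix t assume t: "t \<in> transversal"
      have "slice {x \<in> topspace induced_space. act g x \<in> U} t
          = {y \<in> topspace Y. \<psi> (cocycle g t) y \<in> slice U (rep (g \<otimes> t))}"
        using t unfolding slice_def topspace_induced act_def by auto
      moreover have "openin Y (slice U (rep (g \<otimes> t)))"
        using U g t transversal_carrier rep_mem unfolding openin_induced_iff by simp
      moreover have "continuous_map Y Y (\<psi> (cocycle g t))"
        using base.act_continuous cocycle_closed g t transversal_carrier by simp
      ultimately show "openin Y (slice {x \<in> topspace induced_space. act g x \<in> U} t)"
        using openin_continuous_map_preimage by metis
    qed blast
  qed
qed

text \<open>With \<open>p = \<one>\<close> these elements identify any two slices, and with \<open>s = t\<close> they realize the action of \<open>P\<close>
  on a single slice. So an invariant set is the product of a \<open>P\<close>-invariant set with the transversal.\<close>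

lemma act_conj:
  assumes "t \<in> transversal" "s \<in> transversal" "p \<in> P" "y \<in> topspace Y"
  shows "act (s \<otimes> p \<otimes> inv t) (y, t) = (\<psi> p y, s)"
proof -
  have G: "t \<in> carrier G" "s \<in> carrier G" "p \<in> carrier G"
    using assms transversal_carrier P_carrier by auto
  have "s \<otimes> p \<otimes> inv t \<otimes> t = s \<otimes> p" using G by (simp add: m_assoc)
  moreover have "rep (s \<otimes> p) = s" using rep_mult[OF G(2) assms(3)] rep_transversal[OF assms(2)] by simp
  moreover have "inv s \<otimes> (s \<otimes> p) = p" using G by (simp add: m_assoc[symmetric])
  moreover have "inv s \<otimes> (s \<otimes> p \<otimes> inv t) \<otimes> t = inv s \<otimes> (s \<otimes> p \<otimes> inv t \<otimes> t)"
    using G by (simp add: m_assoc)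
  ultimately show ?thesis unfolding act_def cocycle_def by simp
qed

lemma invariant_slice:
  assumes C: "C \<subseteq> topspace induced_space" and inv: "invariant_set G act C"
    and s: "s \<in> transversal" and t: "t \<in> transversal"
  shows "slice C s = slice C t" and "invariant_set (G\<lparr>carrier := P\<rparr>) \<psi> (slice C t)"
proof -
  have move: "\<psi> p y \<in> slice C s"
    if "s \<in> transversal" "t \<in> transversal" "p \<in> P" "y \<in> slice C t" for s t p y
  proof -
    have y: "(y, t) \<in> C" "y \<in> topspace Y" using that(4) C unfolding slice_def topspace_induced by auto
    have "s \<otimes> p \<otimes> inv t \<in> carrier G" using that transversal_carrier P_carrier by simp
    from induced.invariant_setD[OF inv this y(1)] show ?thesis
      unfolding act_conj[OF that(2,1,3) y(2)] slice_def by simp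
  qed
  have sub: "slice C t \<subseteq> topspace Y" for t using C unfolding slice_def topspace_induced by auto
  have "\<psi> \<one> y = y" if "y \<in> slice C t" for y t
    using base.act_one that sub by auto
  then show "slice C s = slice C t"
    using move[OF s t subgroup.one_closed[OF subgroup_P]] move[OF t s subgroup.one_closed[OF subgroup_P]]
    by force
  show "invariant_set (G\<lparr>carrier := P\<rparr>) \<psi> (slice C t)"
    by (rule base.invariant_setI[OF sub]) (use move[OF t t] in simp)
qed

sublocale induced: minimal_action G induced_space act
proof unfold_locales
  show "topspace induced_space \<noteq> {}"
    using base.nonempty transversal_nonempty by (simp add: topspace_induced)
  fix C assume C: "closedin induced_space C" "C \<noteq> {}" "invariant_set G act C"
  have CX: "C \<subseteq> topspace induced_space" by (rule closedin_subset[OF C(1)])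
  obtain y t where yt: "(y, t) \<in> C" using C(2) by auto
  have t: "t \<in> transversal" using yt CX unfolding topspace_induced by auto
  have full: "slice C s = topspace Y" if s: "s \<in> transversal" for s
  proof (rule base.minimal)
    show "closedin Y (slice C s)" by (rule closedin_slice[OF C(1) s])
    have "y \<in> slice C t" using yt unfolding slice_def by simp
    then show "slice C s \<noteq> {}" using invariant_slice(1)[OF CX C(3) s t] by blast
    show "invariant_set (G\<lparr>carrier := P\<rparr>) \<psi> (slice C s)" by (rule invariant_slice(2)[OF CX C(3) s s])
  qed
  show "C = topspace induced_space"
    using CX full unfolding topspace_induced slice_def by auto
qed

lemma sets_induced_measure: "sets induced_measure = sets (borel_of induced_space)"
  unfolding induced_measure_def by (rule sets.sets_measure_of_eq)

lemma emeasure_induced: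
  assumes B: "B \<in> sets (borel_of induced_space)"
  shows "emeasure induced_measure B
    = inverse (of_nat (card transversal)) * (\<Sum>t\<in>transversal. emeasure \<mu> (slice B t))"
proof -
  let ?c = "inverse (of_nat (card transversal)) :: ennreal"
  let ?m = "\<lambda>B. ?c * (\<Sum>t\<in>transversal. emeasure \<mu> (slice B t))"
  show ?thesis
  proof (rule emeasure_measure_of[OF induced_measure_def])
    show "sets (borel_of induced_space) \<subseteq> Pow (space (borel_of induced_space))"
      by (rule sets.space_closed)
    show "B \<in> sets induced_measure" using B unfolding sets_induced_measure .
    show "positive (sets induced_measure) ?m" unfolding positive_def slice_def by simp
    show "countably_additive (sets induced_measure) ?m"
    proof (rule countably_additiveI)
      fix A :: "nat \<Rightarrow> ('y \<times> 'a) set"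
      assume A: "range A \<subseteq> sets induced_measure" "disjoint_family A"
      have sl: "slice (\<Union>i. A i) t = (\<Union>i. slice (A i) t)" for t unfolding slice_def by auto
      have "(\<Sum>i. emeasure \<mu> (slice (A i) t)) = emeasure \<mu> (slice (\<Union>i. A i) t)"
        if t: "t \<in> transversal" for t
        unfolding sl
      proof (rule suminf_emeasure)
        show "range (\<lambda>i. slice (A i) t) \<subseteq> sets \<mu>"
          using A(1) sets_slice[OF _ t] unfolding sets_induced_measure by blast
        show "disjoint_family (\<lambda>i. slice (A i) t)"
          using A(2) unfolding disjoint_family_on_def slice_def by blast
      qed
      then show "(\<Sum>i. ?m (A i)) = ?m (\<Union>i. A i)"
        by (simp add: suminf_sum summableI)
    qed
  qed
qed

lemma induced_emeasure_act_image:
  assumes g: "g \<in> carrier G" and B: "B \<in> sets induced_measure"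
  shows "emeasure induced_measure (act g ` B) = emeasure induced_measure B"
proof -
  have B': "B \<in> sets (borel_of induced_space)" using B unfolding sets_induced_measure .
  have BX: "B \<subseteq> topspace induced_space" using sets.sets_into_space[OF B'] by (simp add: space_borel_of)
  have "(\<Sum>t\<in>transversal. emeasure \<mu> (slice (act g ` B) t))
      = (\<Sum>t\<in>transversal. emeasure \<mu> (slice (act g ` B) (rep (g \<otimes> t))))"
    using sum.reindex_bij_betw[OF bij_betw_rep_mult[OF g], of "\<lambda>t. emeasure \<mu> (slice (act g ` B) t)"] by simp
  also have "\<dots> = (\<Sum>t\<in>transversal. emeasure \<mu> (slice B t))"
  proof (rule sum.cong)
    fix t assume t: "t \<in> transversal"
    have "cocycle g t \<in> P" using cocycle_closed g t transversal_carrier by blast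
    then show "emeasure \<mu> (slice (act g ` B) (rep (g \<otimes> t))) = emeasure \<mu> (slice B t)"
      unfolding slice_act_image[OF g t BX] using base.emeasure_act_image sets_slice[OF B' t] by simp
  qed simp
  finally show ?thesis
    using emeasure_induced[OF B'] emeasure_induced[OF induced.sets_act_image[OF g B']] by simp
qed

lemma induced_measure_uniform:
  assumes B: "B \<in> sets (borel_of induced_space)"
    and const: "\<And>t. t \<in> transversal \<Longrightarrow> emeasure \<mu> (slice B t) = c"
  shows "emeasure induced_measure B = c"
proof -
  let ?n = "of_nat (card transversal) :: ennreal"
  have n: "?n \<noteq> 0" "?n < Orderings.top_class.top" using finite_transversal transversal_nonempty of_nat_less_top by auto
  have "emeasure induced_measure B = (inverse ?n * ?n) * c"
    using emeasure_induced[OF B] const by (simp add: mult.assoc)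
  also have "inverse ?n * ?n = 1"
    using n ennreal_divide_self[of ?n] by (simp add: divide_ennreal_def mult.commute)
  finally show ?thesis by simp
qed

sublocale induced: ergodic_action G induced_space act induced_measure
proof unfold_locales
  show "ergodic_measure G induced_space act induced_measure"
    unfolding ergodic_measure_def invariant_measure_def
  proof (intro conjI ballI impI)
    have "slice (topspace induced_space) t = space \<mu>" if "t \<in> transversal" for t
      using that unfolding slice_def topspace_induced base.space_measure by auto
    then have "emeasure induced_measure (topspace induced_space) = 1"
      using base.emeasure_space_1 sets.top[of "borel_of induced_space"]
      by (intro induced_measure_uniform) (simp_all add: space_borel_of)
    then show "prob_space induced_measure"
      by (intro prob_spaceI) (simp add: sets_eq_imp_space_eq[OF sets_induced_measure] space_borel_of)
    show "sets induced_measure = sets (borel_of induced_space)" by (rule sets_induced_measure)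
  next
    fix g B assume "g \<in> carrier G" "B \<in> sets induced_measure"
    then show "emeasure induced_measure (act g ` B) = emeasure induced_measure B"
      by (rule induced_emeasure_act_image)
  next
    fix B assume B: "B \<in> sets induced_measure" and inv: "invariant_set G act B"
    have B': "B \<in> sets (borel_of induced_space)" using B unfolding sets_induced_measure .
    have BX: "B \<subseteq> topspace induced_space" using sets.sets_into_space[OF B'] by (simp add: space_borel_of)
    obtain t where t: "t \<in> transversal" using transversal_nonempty by blast
    have "emeasure induced_measure B = emeasure \<mu> (slice B t)"
      by (rule induced_measure_uniform[OF B']) (simp add: invariant_slice(1)[OF BX inv _ t])
    then have "measure induced_measure B = base.prob (slice B t)" by (simp add: measure_def)
    then show "measure induced_measure B \<in> {0, 1}"
      using base.ergodic[OF sets_slice[OF B' t] invariant_slice(2)[OF BX inv t t]] by simp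
  qed
qed

sublocale induced: allosteric_action G induced_space act induced_measure
proof unfold_locales
  fix g assume g: "g \<in> carrier G" "g \<noteq> \<one>"
  define U where "U = induced_space interior_of induced.fixed_points g"
  have U: "openin induced_space U" "U \<subseteq> induced.fixed_points g"
    unfolding U_def by (auto simp: interior_of_subset)
  have "slice U t = {}" if t: "t \<in> transversal" for t
  proof (rule ccontr)
    assume ne: "slice U t \<noteq> {}"
    have tG: "t \<in> carrier G" by (rule transversal_carrier[OF t])
    have moved: "rep (g \<otimes> t) = t \<and> y \<in> base.fixed_points (cocycle g t)" if "y \<in> slice U t" for y
      using that U(2) unfolding slice_def induced.fixed_points_def base.fixed_points_def act_def
      by (auto simp: topspace_induced)
    have rep: "rep (g \<otimes> t) = t" using moved ne by blast
    have "openin Y (slice U t)" using U(1) t unfolding openin_induced_iff by blast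
    then have "slice U t \<subseteq> Y interior_of base.fixed_points (cocycle g t)"
      using moved by (intro interior_of_maximal) blast+
    moreover have "cocycle g t \<in> P" by (rule cocycle_closed[OF g(1) tG])
    ultimately have "cocycle g t = \<one>" using base.nowhere_dense_fixed_points[of "cocycle g t"] ne by auto
    then have "t \<otimes> (inv t \<otimes> g \<otimes> t) \<otimes> inv t = \<one>" unfolding cocycle_def rep using tG by simp
    moreover have "t \<otimes> (inv t \<otimes> g \<otimes> t) \<otimes> inv t = (t \<otimes> inv t) \<otimes> g \<otimes> (t \<otimes> inv t)"
      using tG g(1) by (simp only: m_assoc m_closed inv_closed)
    ultimately show False using g tG by simp
  qed
  moreover have "U \<subseteq> topspace induced_space" by (rule openin_subset[OF U(1)])
  ultimately show "induced_space interior_of induced.fixed_points g = {}"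
    unfolding U_def[symmetric] slice_def topspace_induced by auto
next
  obtain p where p: "p \<in> P" "p \<noteq> \<one>" "base.prob (base.fixed_points p) > 0"
    using base.fixed_points_not_null by auto
  obtain t where t: "t \<in> transversal" using transversal_nonempty by blast
  define g where "g = t \<otimes> p \<otimes> inv t"
  have G: "t \<in> carrier G" "p \<in> carrier G" "g \<in> carrier G"
    unfolding g_def using transversal_carrier[OF t] P_carrier[OF p(1)] by auto
  have "g \<noteq> \<one>"
  proof
    assume "g = \<one>"
    then have "inv t \<otimes> g \<otimes> t = \<one>" using G by simp
    moreover have "inv t \<otimes> g \<otimes> t = (inv t \<otimes> t) \<otimes> p \<otimes> (inv t \<otimes> t)"
      unfolding g_def using G by (simp only: m_assoc m_closed inv_closed)
    ultimately show False using G p(2) by simp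
  qed
  have F: "induced.fixed_points g \<in> sets (borel_of induced_space)"
    using induced.closedin_measurable[OF induced.closedin_fixed_points[OF G(3)]]
    unfolding sets_induced_measure .
  have "base.fixed_points p \<subseteq> slice (induced.fixed_points g) t"
    using act_conj[OF t t p(1)] t
    unfolding slice_def induced.fixed_points_def base.fixed_points_def topspace_induced g_def by auto
  then have "emeasure \<mu> (base.fixed_points p) \<le> emeasure \<mu> (slice (induced.fixed_points g) t)"
    using sets_slice[OF F t] by (rule emeasure_mono)
  moreover have "emeasure \<mu> (base.fixed_points p) > 0"
    using p(3) by (simp add: base.emeasure_eq_measure)
  ultimately have "emeasure \<mu> (slice (induced.fixed_points g) t) \<noteq> 0" by auto
  then have "(\<Sum>t\<in>transversal. emeasure \<mu> (slice (induced.fixed_points g) t)) \<noteq> 0"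
    using t finite_transversal by auto
  then have "emeasure induced_measure (induced.fixed_points g) \<noteq> 0"
    unfolding emeasure_induced[OF F] by (simp add: ennreal_of_nat_eq_real_of_nat)
  then have "induced.prob (induced.fixed_points g) > 0"
    by (simp add: induced.emeasure_eq_measure zero_less_measure_iff)
  with \<open>g \<noteq> \<one>\<close> G(3) show "\<exists>g\<in>carrier G. g \<noteq> \<one> \<and> induced.prob (induced.fixed_points g) > 0" by blast
qed

end

theorem (in group) allosteric_from_finite_index:
  assumes "countable (carrier G)" "finitely_generated G" "finite_index G P"
    and "allosteric_action (G\<lparr>carrier := P\<rparr>) Y \<psi> \<mu>"
  shows "allosteric G"
proof -
  interpret induced_action G P Y \<psi> \<mu>
    by (intro induced_action.intro induced_action_axioms.intro is_group assms)
  show ?thesis by (rule induced.imp_allosteric[OF assms(2)])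
qed

section \<open>Stabilizers and their conjugates\<close>

definition (in group) conjugate :: "'a \<Rightarrow> 'a set \<Rightarrow> 'a set" where
  "conjugate g A = (\<lambda>h. g \<otimes> h \<otimes> inv g) ` A"

context group
begin

lemma coset_conjugate: "g <#\<^bsub>G\<^esub> A #>\<^bsub>G\<^esub> inv\<^bsub>G\<^esub> g = conjugate g A"
  unfolding conjugate_def l_coset_def r_coset_def by blast

lemma conj_eq_iff:
  assumes "g \<in> carrier G" "a \<in> carrier G" "b \<in> carrier G"
  shows "g \<otimes> a \<otimes> inv g = g \<otimes> b \<otimes> inv g \<longleftrightarrow> a = b"
  using assms by (simp add: m_assoc)

lemma conjugate_mult:
  assumes "g \<in> carrier G" "h \<in> carrier G" "A \<subseteq> carrier G"
  shows "conjugate g (conjugate h A) = conjugate (g \<otimes> h) A"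
  unfolding conjugate_def image_image using assms
  by (intro image_cong) (auto simp: m_assoc inv_mult_group subset_iff)

lemma conjugate_one: "A \<subseteq> carrier G \<Longrightarrow> conjugate \<one> A = A"
  unfolding conjugate_def by (force simp: subset_iff)

lemma conjugate_closed: "g \<in> carrier G \<Longrightarrow> A \<subseteq> carrier G \<Longrightarrow> conjugate g A \<subseteq> carrier G"
  unfolding conjugate_def by auto

lemma conjugate_inv:
  assumes "g \<in> carrier G" "A \<subseteq> carrier G"
  shows "conjugate (inv g) (conjugate g A) = A" "conjugate g (conjugate (inv g) A) = A"
  using assms by (simp_all add: conjugate_mult conjugate_one)

lemma card_conjugate: "g \<in> carrier G \<Longrightarrow> A \<subseteq> carrier G \<Longrightarrow> card (conjugate g A) = card A"
  unfolding conjugate_def using conj_eq_iff[of g] by (intro card_image inj_onI) (auto simp: subset_iff)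

lemma conjugate_Un: "conjugate g (A \<union> B) = conjugate g A \<union> conjugate g B"
  unfolding conjugate_def by (rule image_Un)

lemma conjugate_cancel:
  assumes "g \<in> carrier G" "A \<subseteq> carrier G" "B \<subseteq> carrier G" "conjugate g A = conjugate g B"
  shows "A = B"
  using assms conjugate_inv(1) by metis

lemma normalizer_conjugate:
  assumes "subgroup H G"
  shows "n \<in> normalizer G H \<longleftrightarrow> n \<in> carrier G \<and> conjugate n H = H"
  using subgroup.subset[OF assms] unfolding normalizer_def stabilizer_def by (auto simp: coset_conjugate)

lemma finite_conjugates:
  assumes H: "subgroup H G" and fi: "finite_index G (normalizer G H)"
  shows "finite ((\<lambda>g. conjugate g H) ` carrier G)"
proof -
  obtain T where T: "finite T" "T \<subseteq> carrier G"
    "\<And>g. g \<in> carrier G \<Longrightarrow> \<exists>t\<in>T. \<exists>n\<in>normalizer G H. g = n \<otimes> t"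
    using fi unfolding finite_index_iff by blast
  have "conjugate g H \<in> (\<lambda>t. conjugate (inv t) H) ` T" if g: "g \<in> carrier G" for g
  proof -
    obtain t n where t: "t \<in> T" "n \<in> normalizer G H" "inv g = n \<otimes> t" using T(3)[of "inv g"] g by auto
    have G: "t \<in> carrier G" "n \<in> carrier G" and n: "conjugate n H = H"
      using t T(2) normalizer_conjugate[OF H] by auto
    have "conjugate (inv n) H = H" using conjugate_inv(1)[OF G(2) subgroup.subset[OF H]] n by simp
    moreover have "g = inv t \<otimes> inv n" using t(3) g G by (metis inv_inv inv_mult_group)
    ultimately have "conjugate g H = conjugate (inv t) H"
      using conjugate_mult[of "inv t" "inv n" H] G subgroup.subset[OF H] by simp
    then show ?thesis using t(1) by blast
  qed
  then have "(\<lambda>g. conjugate g H) ` carrier G \<subseteq> (\<lambda>t. conjugate (inv t) H) ` T" by blast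
  then show ?thesis using T(1) finite_surj by blast
qed

end

context continuous_action
begin

abbreviation stab :: "'x \<Rightarrow> 'a set" where "stab \<equiv> stabilizer G \<phi>"

lemma mem_stab: "x \<in> topspace X \<Longrightarrow> g \<in> stab x \<longleftrightarrow> g \<in> carrier G \<and> x \<in> fixed_points g"
  unfolding stabilizer_def fixed_points_def by auto

lemma stab_carrier: "stab x \<subseteq> carrier G"
  unfolding stabilizer_def by blast

lemma subgroup_stab:
  assumes x: "x \<in> topspace X"
  shows "subgroup (stab x) G"
proof (rule subgroupI)
  show "stab x \<subseteq> carrier G" by (rule stab_carrier)
  show "stab x \<noteq> {}" using act_one[OF x] unfolding stabilizer_def by blast
  show "inv a \<in> stab x" if "a \<in> stab x" for a
    using that act_inv(1)[of a x] x unfolding stabilizer_def by auto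
  show "a \<otimes> b \<in> stab x" if "a \<in> stab x" "b \<in> stab x" for a b
    using that act_mult[of a b x] x unfolding stabilizer_def by auto
qed

lemma stab_act:
  assumes g: "g \<in> carrier G" and x: "x \<in> topspace X"
  shows "stab (\<phi> g x) = conjugate g (stab x)"
proof -
  have sub: "conjugate g (stab x) \<subseteq> stab (\<phi> g x)" if "g \<in> carrier G" "x \<in> topspace X" for g x
    using that unfolding conjugate_def stabilizer_def by (auto simp: act_mult act_inv act_closed)
  have "conjugate (inv g) (stab (\<phi> g x)) \<subseteq> stab x"
    using sub[of "inv g" "\<phi> g x"] g x by (simp add: act_closed act_inv)
  then have "conjugate g (conjugate (inv g) (stab (\<phi> g x))) \<subseteq> conjugate g (stab x)"
    unfolding conjugate_def by blast
  then show ?thesis using sub[OF g x] conjugate_inv(2)[OF g stab_carrier] by auto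
qed

lemma trivial_holonomy_act:
  assumes g: "g \<in> carrier G" and x: "x \<in> topspace X" and triv: "trivial_holonomy G X \<phi> x"
  shows "trivial_holonomy G X \<phi> (\<phi> g x)"
  unfolding trivial_holonomy_def
proof
  fix k assume "k \<in> stab (\<phi> g x)"
  then obtain h where h: "h \<in> stab x" "k = g \<otimes> h \<otimes> inv g"
    unfolding stab_act[OF g x] conjugate_def by blast
  have "\<exists>V. openin X V \<and> x \<in> V \<and> (\<forall>y\<in>V. \<phi> h y = y)"
    using triv h(1) unfolding trivial_holonomy_def by (rule bspec)
  then obtain V where V: "openin X V" "x \<in> V" "\<And>y. y \<in> V \<Longrightarrow> \<phi> h y = y" by auto
  have hG: "h \<in> carrier G" using h(1) stab_carrier by blast
  have "openin X (\<phi> g ` V)"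
    using homeomorphic_map_openness_eq[OF act_homeomorphic[OF g]] V(1) openin_subset by blast
  moreover have "\<phi> k y = y" if y: "y \<in> \<phi> g ` V" for y
  proof -
    obtain v where v: "v \<in> V" "y = \<phi> g v" using y by blast
    then have "v \<in> topspace X" using openin_subset[OF V(1)] by blast
    then show ?thesis using V(3)[OF v(1)] v(2) h(2) g hG by (simp add: act_mult act_inv act_closed)
  qed
  ultimately show "\<exists>V. openin X V \<and> \<phi> g x \<in> V \<and> (\<forall>y\<in>V. \<phi> k y = y)"
    using V(2) by (intro exI[of _ "\<phi> g ` V"]) simp
qed

text \<open>A point with nontrivial holonomy lies on the boundary of the fixed point set of some element, so
  Baire's theorem applies to the countably many boundaries.\<close>

lemma trivial_holonomy_dense:
  assumes V: "openin X V" "V \<noteq> {}"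
  obtains x where "x \<in> V" "trivial_holonomy G X \<phi> x"
proof -
  define b where "b g = fixed_points g - X interior_of fixed_points g" for g
  have "X interior_of \<Union> (b ` carrier G) = {}"
  proof (rule Baire_category_alt)
    show "completely_metrizable_space X \<or> locally_compact_space X \<and> regular_space X"
      using compact Hausdorff compact_imp_locally_compact_space compact_Hausdorff_imp_regular_space by blast
    show "countable (b ` carrier G)" using countable_carrier by simp
    fix S assume "S \<in> b ` carrier G"
    then obtain g where g: "g \<in> carrier G" "S = b g" by blast
    have "X interior_of b g \<subseteq> X interior_of fixed_points g" unfolding b_def by (rule interior_of_mono) blast
    moreover have "X interior_of b g \<subseteq> b g" by (rule interior_of_subset)
    ultimately have "X interior_of b g = {}" unfolding b_def by blast
    moreover have "closedin X (b g)"
      unfolding b_def using closedin_fixed_points[OF g(1)] openin_interior_of by (rule closedin_diff)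
    ultimately show "closedin X S \<and> X interior_of S = {}" using g(2) by simp
  qed
  then have "\<not> V \<subseteq> \<Union> (b ` carrier G)" using interior_of_maximal[OF _ V(1)] V(2) by blast
  then obtain x where x: "x \<in> V" "\<And>g. g \<in> carrier G \<Longrightarrow> x \<notin> b g" by blast
  then have xX: "x \<in> topspace X" using openin_subset[OF V(1)] by blast
  have "trivial_holonomy G X \<phi> x"
    unfolding trivial_holonomy_def
  proof
    fix g assume "g \<in> stab x"
    then have "x \<in> X interior_of fixed_points g" using x(2) mem_stab[OF xX] unfolding b_def by blast
    moreover have "\<forall>y\<in>X interior_of fixed_points g. \<phi> g y = y"
      using interior_of_subset[of X "fixed_points g"] unfolding fixed_points_def by blast
    ultimately show "\<exists>V. openin X V \<and> x \<in> V \<and> (\<forall>y\<in>V. \<phi> g y = y)"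
      by (intro exI[of _ "X interior_of fixed_points g"]) simp
  qed
  with x(1) show ?thesis by (rule that)
qed

definition fixed_set :: "'a set \<Rightarrow> 'x set" where
  "fixed_set A = {x \<in> topspace X. A \<subseteq> stab x}"

lemma closedin_fixed_set:
  assumes "A \<subseteq> carrier G"
  shows "closedin X (fixed_set A)"
proof -
  have "fixed_set A = topspace X \<inter> \<Inter> (fixed_points ` A)"
    unfolding fixed_set_def using assms mem_stab by (auto simp: subset_iff)
  also have "\<dots> = \<Inter> (insert (topspace X) (fixed_points ` A))" by simp
  also have "closedin X \<dots>" using closedin_fixed_points assms by (intro closedin_Inter) auto
  finally show ?thesis .
qed

lemma fixed_set_subset: "fixed_set A \<subseteq> topspace X"
  unfolding fixed_set_def by blast

lemma act_image_fixed_set: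
  assumes g: "g \<in> carrier G" and A: "A \<subseteq> carrier G"
  shows "\<phi> g ` fixed_set A = fixed_set (conjugate g A)"
proof -
  have sub: "\<phi> g ` fixed_set A \<subseteq> fixed_set (conjugate g A)" if "g \<in> carrier G" for g A
    unfolding fixed_set_def using that stab_act by (auto simp: act_closed conjugate_def)
  show ?thesis
  proof
    show "\<phi> g ` fixed_set A \<subseteq> fixed_set (conjugate g A)" by (rule sub[OF g])
    show "fixed_set (conjugate g A) \<subseteq> \<phi> g ` fixed_set A"
    proof
      fix x assume x: "x \<in> fixed_set (conjugate g A)"
      then have "\<phi> (inv g) x \<in> fixed_set A"
        using sub[of "inv g" "conjugate g A"] g conjugate_inv(1)[OF g A] by auto
      then show "x \<in> \<phi> g ` fixed_set A"
        using mem_act_image[OF g _ fixed_set_subset] x fixed_set_subset by blast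
    qed
  qed
qed

end

text \<open>Minimality spreads a property of one stabilizer over the whole space, as long as only finitely
  many conjugates are involved: the union of their fixed point sets is closed and invariant.\<close>

lemma (in minimal_action) stab_contains_conjugate:
  assumes A: "A \<subseteq> carrier G" and fin: "finite ((\<lambda>g. conjugate g A) ` carrier G)"
    and ex: "x\<^sub>0 \<in> topspace X" "A \<subseteq> stab x\<^sub>0" and x: "x \<in> topspace X"
  obtains g where "g \<in> carrier G" "conjugate g A \<subseteq> stab x"
proof -
  have "saturation (fixed_set A) = (\<Union>B\<in>(\<lambda>g. conjugate g A) ` carrier G. fixed_set B)"
    unfolding saturation_def using act_image_fixed_set[OF _ A] by auto
  moreover have "closedin X (\<Union>B\<in>(\<lambda>g. conjugate g A) ` carrier G. fixed_set B)"
    using fin closedin_fixed_set conjugate_closed[OF _ A] by (intro closedin_Union) auto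
  ultimately have "closedin X (saturation (fixed_set A))" by simp
  moreover have "x\<^sub>0 \<in> fixed_set A" using ex unfolding fixed_set_def by blast
  ultimately have "saturation (fixed_set A) = topspace X"
    using minimal saturation_invariant[OF fixed_set_subset] saturation_superset[OF fixed_set_subset] by blast
  then obtain g where "g \<in> carrier G" "x \<in> \<phi> g ` fixed_set A" using x unfolding saturation_def by blast
  then show ?thesis using that act_image_fixed_set[OF _ A] unfolding fixed_set_def by blast
qed

section \<open>Measurability of the stabilizer map\<close>

definition chabauty_basis :: "('g, 'c) monoid_scheme \<Rightarrow> 'g set set set" where
  "chabauty_basis G = {{K. subgroup K G \<and> A \<subseteq> K \<and> B \<inter> K = {}} | A B.
     finite A \<and> A \<subseteq> carrier G \<and> finite B \<and> B \<subseteq> carrier G}"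

lemma openin_chabauty_basis: "U \<in> chabauty_basis G \<Longrightarrow> openin (chabauty_fell G) U"
  unfolding chabauty_fell_def chabauty_basis_def by (rule topology_generated_by_Basis)

lemma topspace_chabauty_fell: "topspace (chabauty_fell G) = {K. subgroup K G}"
proof -
  have "topspace (chabauty_fell G) = \<Union> (chabauty_basis G)"
    unfolding chabauty_fell_def chabauty_basis_def by (rule topology_generated_by_topspace)
  moreover have "{K. subgroup K G} \<in> chabauty_basis G"
    unfolding chabauty_basis_def by (intro CollectI exI[of _ "{}"]) auto
  moreover have "U \<subseteq> {K. subgroup K G}" if "U \<in> chabauty_basis G" for U
    using that unfolding chabauty_basis_def by blast
  ultimately show ?thesis by blast
qed

lemma countable_chabauty_basis:
  assumes "countable (carrier G)"
  shows "countable (chabauty_basis G)"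
proof -
  let ?F = "{A. finite A \<and> A \<subseteq> carrier G}"
  have "chabauty_basis G = (\<lambda>(A, B). {K. subgroup K G \<and> A \<subseteq> K \<and> B \<inter> K = {}}) ` (?F \<times> ?F)"
    unfolding chabauty_basis_def by auto
  moreover have "countable (?F \<times> ?F)" using countable_Collect_finite_subset[OF assms] by simp
  ultimately show ?thesis by simp
qed

text \<open>The basic sets are closed under intersections, so they form a base of the topology, and it is a
  countable one. Hence measurability of the stabilizer map can be tested on basic sets.\<close>

lemma openin_chabauty_fell_Union:
  assumes "openin (chabauty_fell G) U"
  shows "U = \<Union> {B \<in> chabauty_basis G. B \<subseteq> U}"
proof -
  have "generate_topology_on (chabauty_basis G) U"
    using assms unfolding chabauty_fell_def chabauty_basis_def by (rule openin_topology_generated_by)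
  then have "\<forall>K\<in>U. \<exists>B\<in>chabauty_basis G. K \<in> B \<and> B \<subseteq> U"
  proof induction
    case (Int a b)
    show ?case
    proof
      fix K assume K: "K \<in> a \<inter> b"
      obtain S where S: "S \<in> chabauty_basis G" "K \<in> S" "S \<subseteq> a" using Int.IH(1) K by blast
      obtain T where T: "T \<in> chabauty_basis G" "K \<in> T" "T \<subseteq> b" using Int.IH(2) K by blast
      obtain A B where AB: "finite A" "A \<subseteq> carrier G" "finite B" "B \<subseteq> carrier G"
        "S = {K. subgroup K G \<and> A \<subseteq> K \<and> B \<inter> K = {}}" using S(1) unfolding chabauty_basis_def by blast
      obtain C D where CD: "finite C" "C \<subseteq> carrier G" "finite D" "D \<subseteq> carrier G"
        "T = {K. subgroup K G \<and> C \<subseteq> K \<and> D \<inter> K = {}}" using T(1) unfolding chabauty_basis_def by blast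
      have "S \<inter> T = {K. subgroup K G \<and> A \<union> C \<subseteq> K \<and> (B \<union> D) \<inter> K = {}}" unfolding AB(5) CD(5) by blast
      then have "S \<inter> T \<in> chabauty_basis G"
        unfolding chabauty_basis_def using AB(1-4) CD(1-4)
        by (intro CollectI exI[of _ "A \<union> C"] exI[of _ "B \<union> D"]) auto
      then show "\<exists>B\<in>chabauty_basis G. K \<in> B \<and> B \<subseteq> a \<inter> b" using S T by blast
    qed
  next
    case (UN \<K>)
    then show ?case by (meson Sup_upper UnionE order_trans)
  qed auto
  then show ?thesis by blast
qed

lemma singleton_sets_chabauty_fell:
  assumes "countable (carrier G)" and K: "subgroup K G"
  shows "{K} \<in> sets (borel_of (chabauty_fell G))"
proof -
  define U where "U g = (if g \<in> K then {M. subgroup M G \<and> {g} \<subseteq> M \<and> {} \<inter> M = {}}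
    else {M. subgroup M G \<and> {} \<subseteq> M \<and> {g} \<inter> M = {}})" for g
  have "U g \<in> chabauty_basis G" if "g \<in> carrier G" for g
    unfolding chabauty_basis_def U_def using that by (cases "g \<in> K") (simp_all, blast+)
  then have meas: "U ` carrier G \<subseteq> sets (borel_of (chabauty_fell G))"
    using openin_chabauty_basis openin_sets_borel_of by blast
  have ne: "carrier G \<noteq> {}" using subgroup.subset[OF K] subgroup.one_closed[OF K] by blast
  have "{K} = (\<Inter>g\<in>carrier G. U g)"
  proof
    show "{K} \<subseteq> (\<Inter>g\<in>carrier G. U g)" unfolding U_def using K by auto
    show "(\<Inter>g\<in>carrier G. U g) \<subseteq> {K}"
    proof
      fix M assume M': "M \<in> (\<Inter>g\<in>carrier G. U g)"
      have M: "subgroup M G \<and> (g \<in> M \<longleftrightarrow> g \<in> K)" if "g \<in> carrier G" for g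
      proof -
        have "M \<in> U g" using M' that by blast
        then show ?thesis unfolding U_def by (cases "g \<in> K") auto
      qed
      then have MG: "subgroup M G" using ne by blast
      have "M = K" using M subgroup.subset[OF K] subgroup.subset[OF MG] by blast
      then show "M \<in> {K}" by simp
    qed
  qed
  then show ?thesis using sets.countable_INT'[OF assms(1) ne meas] by simp
qed

lemma (in continuous_action) stabilizer_measurable:
  "stab \<in> measurable (borel_of X) (borel_of (chabauty_fell G))"
proof (rule measurable_sigma_sets[OF sets_borel_of])
  show "{U. openin (chabauty_fell G) U} \<subseteq> Pow (topspace (chabauty_fell G))" by (auto dest: openin_subset)
  show "stab \<in> space (borel_of X) \<rightarrow> topspace (chabauty_fell G)"
    using subgroup_stab by (simp add: space_borel_of topspace_chabauty_fell)
  have basic: "stab -` B \<inter> topspace X \<in> sets (borel_of X)" if B: "B \<in> chabauty_basis G" for B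
  proof -
    obtain C D where CD: "finite D" "C \<subseteq> carrier G" "D \<subseteq> carrier G"
      "B = {K. subgroup K G \<and> C \<subseteq> K \<and> D \<inter> K = {}}"
      using B unfolding chabauty_basis_def by blast
    have "stab -` B \<inter> topspace X = fixed_set C - (\<Union>d\<in>D. fixed_points d)"
    proof -
      have "D \<inter> stab x = {} \<longleftrightarrow> x \<notin> (\<Union>d\<in>D. fixed_points d)" if "x \<in> topspace X" for x
        using mem_stab[OF that] CD(3) by auto
      then show ?thesis unfolding CD(4) fixed_set_def using subgroup_stab by auto
    qed
    moreover have "fixed_set C \<in> sets (borel_of X)"
      by (rule closedin_sets_borel_of[OF closedin_fixed_set[OF CD(2)]])
    moreover have "(\<Union>d\<in>D. fixed_points d) \<in> sets (borel_of X)"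
      using CD(1,3) closedin_fixed_points closedin_sets_borel_of by (intro sets.finite_UN) auto
    ultimately show ?thesis by simp
  qed
  fix U assume "U \<in> {U. openin (chabauty_fell G) U}"
  then have "U = \<Union> {B \<in> chabauty_basis G. B \<subseteq> U}" using openin_chabauty_fell_Union by blast
  then have U: "stab -` U \<inter> space (borel_of X)
      = (\<Union>B\<in>{B \<in> chabauty_basis G. B \<subseteq> U}. stab -` B \<inter> topspace X)"
    unfolding space_borel_of by blast
  have "countable {B \<in> chabauty_basis G. B \<subseteq> U}"
    using countable_chabauty_basis[OF countable_carrier] by (rule countable_subset[rotated]) blast
  then show "stab -` U \<inter> space (borel_of X) \<in> sets (borel_of X)"
    unfolding U by (rule sets.countable_UN') (use basic in blast)
qed

section \<open>Systems whose generic stabilizers are the conjugates of a finite subgroup\<close>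

locale finite_stabilizer_system = ergodic_action G X \<phi> \<mu>
  for G (structure) and X :: "'x topology" and \<phi> and \<mu> +
  fixes H :: "'a set"
  assumes subgroup_H: "subgroup H G"
    and finite_H: "finite H"
    and almost_normal: "finite_index G (normalizer G H)"
    and holonomy_iff: "x \<in> topspace X \<Longrightarrow>
      trivial_holonomy G X \<phi> x \<longleftrightarrow> (\<exists>g\<in>carrier G. stab x = conjugate g H)"
begin

lemma H_carrier: "H \<subseteq> carrier G"
  by (rule subgroup.subset[OF subgroup_H])

lemma generic_point:
  obtains x g where "x \<in> topspace X" "g \<in> carrier G" "stab x = conjugate g H"
proof -
  obtain x where "x \<in> topspace X" "trivial_holonomy G X \<phi> x"
    using trivial_holonomy_dense[OF openin_topspace nonempty] .
  then show ?thesis using that holonomy_iff by blast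
qed

lemma conjugate_H_subset_stab:
  assumes x: "x \<in> topspace X"
  obtains g where "g \<in> carrier G" "conjugate g H \<subseteq> stab x"
proof -
  obtain x0 g0 where x0: "x0 \<in> topspace X" "g0 \<in> carrier G" "stab x0 = conjugate g0 H"
    using generic_point .
  have "stab (\<phi> (inv g0) x0) = H"
    using stab_act[of "inv g0" x0] x0 conjugate_inv(1)[OF x0(2) H_carrier] by simp
  then show ?thesis
    using stab_contains_conjugate[OF H_carrier finite_conjugates[OF subgroup_H almost_normal],
        of "\<phi> (inv g0) x0"] x0 act_closed x that by auto
qed

text \<open>The union of \<open>H\<close> and the second conjugate has finitely many conjugates, so one of them lies in the
  stabilizer of a point with trivial holonomy. That stabilizer has only as many elements as \<open>H\<close>, so
  both halves fill it. Geometrically, the fixed point sets of different conjugates of \<open>H\<close> are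
  disjoint.\<close>

lemma conjugate_H_in_stab_unique:
  assumes x: "x \<in> topspace X" and H: "H \<subseteq> stab x" and k: "k \<in> carrier G" "conjugate k H \<subseteq> stab x"
  shows "conjugate k H = H"
proof -
  let ?A = "H \<union> conjugate k H"
  have A: "?A \<subseteq> carrier G" using H_carrier conjugate_closed[OF k(1)] by blast
  let ?\<C> = "(\<lambda>g. conjugate g H) ` carrier G"
  have "(\<lambda>g. conjugate g ?A) ` carrier G \<subseteq> (\<lambda>(B, C). B \<union> C) ` (?\<C> \<times> ?\<C>)"
  proof
    fix B assume "B \<in> (\<lambda>g. conjugate g ?A) ` carrier G"
    then obtain g where g: "g \<in> carrier G" "B = conjugate g ?A" by blast
    have "B = (\<lambda>(B, C). B \<union> C) (conjugate g H, conjugate (g \<otimes> k) H)"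
      using g conjugate_mult[OF g(1) k(1) H_carrier] by (simp add: conjugate_Un)
    moreover have "(conjugate g H, conjugate (g \<otimes> k) H) \<in> ?\<C> \<times> ?\<C>" using g(1) k(1) by auto
    ultimately show "B \<in> (\<lambda>(B, C). B \<union> C) ` (?\<C> \<times> ?\<C>)" by (rule image_eqI)
  qed
  then have fin: "finite ((\<lambda>g. conjugate g ?A) ` carrier G)"
    by (rule finite_subset) (simp add: finite_conjugates[OF subgroup_H almost_normal])
  obtain x0 g0 where x0: "x0 \<in> topspace X" "g0 \<in> carrier G" "stab x0 = conjugate g0 H"
    using generic_point .
  have "?A \<subseteq> stab x" using H k(2) by blast
  from stab_contains_conjugate[OF A fin x this x0(1)]
  obtain g where g: "g \<in> carrier G" "conjugate g ?A \<subseteq> stab x0" .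
  have cH: "card (conjugate h H) = card H" if "h \<in> carrier G" for h
    using card_conjugate[OF that H_carrier] .
  have finc: "finite (stab x0)" unfolding x0(3) conjugate_def using finite_H by simp
  have sub: "conjugate g H \<subseteq> stab x0" "conjugate g (conjugate k H) \<subseteq> stab x0"
    using g(2) unfolding conjugate_Un by blast+
  have "conjugate g H = stab x0"
    by (rule card_subset_eq[OF finc sub(1)]) (simp add: x0 cH g(1))
  moreover have "conjugate g (conjugate k H) = stab x0"
    by (rule card_subset_eq[OF finc sub(2)])
      (simp add: x0 cH g(1) k(1) conjugate_mult H_carrier)
  ultimately show ?thesis
    using conjugate_cancel[OF g(1) H_carrier conjugate_closed[OF k(1) H_carrier]] by simp
qed

definition nontriv_holonomy :: "'x set" where
  "nontriv_holonomy = {x \<in> topspace X. \<not> trivial_holonomy G X \<phi> x}"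

definition stab_class :: "'a set \<Rightarrow> 'x set" where
  "stab_class K = {x \<in> topspace X. stab x = K}"

lemma stab_class_measurable:
  assumes K: "subgroup K G"
  shows "stab_class K \<in> sets \<mu>"
proof -
  have "stab -` {K} \<inter> space (borel_of X) \<in> sets (borel_of X)"
    by (rule measurable_sets[OF stabilizer_measurable singleton_sets_chabauty_fell[OF countable_carrier K]])
  moreover have "stab -` {K} \<inter> space (borel_of X) = stab_class K"
    unfolding stab_class_def space_borel_of by blast
  ultimately show ?thesis unfolding sets_measure by simp
qed

lemma subgroup_conjugate:
  assumes g: "g \<in> carrier G"
  shows "subgroup (conjugate g H) G"
proof -
  obtain x k where x: "x \<in> topspace X" "k \<in> carrier G" "stab x = conjugate k H"
    using generic_point .
  have "stab (\<phi> (g \<otimes> inv k) x) = conjugate g H"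
    using stab_act[of "g \<otimes> inv k" x] x g conjugate_mult[of "g \<otimes> inv k" k H] H_carrier
    by (simp add: m_assoc)
  then show ?thesis using subgroup_stab[of "\<phi> (g \<otimes> inv k) x"] x g by (simp add: act_closed)
qed

lemma good_eq: "topspace X - nontriv_holonomy = (\<Union>g\<in>carrier G. stab_class (conjugate g H))"
  unfolding nontriv_holonomy_def stab_class_def using holonomy_iff by auto

lemma nontriv_holonomy_measurable: "nontriv_holonomy \<in> sets \<mu>"
proof -
  have "(\<Union>g\<in>carrier G. stab_class (conjugate g H)) \<in> sets \<mu>"
    using stab_class_measurable[OF subgroup_conjugate]
    by (intro sets.countable_UN'[OF countable_carrier]) auto
  then have "space \<mu> - (topspace X - nontriv_holonomy) \<in> sets \<mu>" unfolding good_eq by (rule sets.compl_sets)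
  moreover have "space \<mu> - (topspace X - nontriv_holonomy) = nontriv_holonomy" unfolding space_measure nontriv_holonomy_def by blast
  ultimately show ?thesis by simp
qed

text \<open>The conjugates of \<open>K\<close> are the stabilizers on disjoint sets of the same positive measure.\<close>

lemma finite_conjugates_of_positive_class:
  assumes K: "subgroup K G" and pos: "prob (stab_class K) > 0"
  shows "finite ((\<lambda>g. conjugate g K) ` carrier G)"
proof (rule ccontr)
  assume inf: "infinite ((\<lambda>g. conjugate g K) ` carrier G)"
  have KG: "K \<subseteq> carrier G" by (rule subgroup.subset[OF K])
  have translate: "stab_class (conjugate g K) = \<phi> g ` stab_class K" if g: "g \<in> carrier G" for g
  proof -
    have "\<phi> (inv g) x \<in> stab_class K \<and> x = \<phi> g (\<phi> (inv g) x)"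
      if "x \<in> stab_class (conjugate g K)" for x
      using that g stab_act[of "inv g" x] conjugate_inv(1)[OF g KG]
      unfolding stab_class_def by (auto simp: act_closed act_inv)
    moreover have "\<phi> g x \<in> stab_class (conjugate g K)" if "x \<in> stab_class K" for x
      using that g stab_act[OF g] unfolding stab_class_def by (auto simp: act_closed)
    ultimately show ?thesis by (intro equalityI subsetI) (metis imageI, force)
  qed
  obtain n :: nat where n: "1 < n * prob (stab_class K)" using reals_Archimedean3[OF pos] by blast
  obtain \<C> where C: "finite \<C>" "card \<C> = n" "\<C> \<subseteq> (\<lambda>g. conjugate g K) ` carrier G"
    using infinite_arbitrarily_large[OF inf] by blast
  have cl: "stab_class M \<in> sets \<mu>" "prob (stab_class M) = prob (stab_class K)" if M: "M \<in> \<C>" for M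
  proof -
    obtain g where g: "g \<in> carrier G" "M = conjugate g K" using C(3) M by blast
    show "stab_class M \<in> sets \<mu>" "prob (stab_class M) = prob (stab_class K)"
      unfolding g(2) translate[OF g(1)]
      using sets_measure_act_image[OF g(1)] measure_act_image[OF g(1)] stab_class_measurable[OF K] by auto
  qed
  have "prob (\<Union>M\<in>\<C>. stab_class M) = (\<Sum>M\<in>\<C>. prob (stab_class M))"
    by (rule finite_measure_finite_Union[OF C(1)])
      (use cl in \<open>auto simp: disjoint_family_on_def stab_class_def\<close>)
  also have "\<dots> = n * prob (stab_class K)" using cl C(2) by simp
  finally show False using n prob_le_1[of "\<Union>M\<in>\<C>. stab_class M"] by linarith
qed

text \<open>If \<open>F\<close> were the stabilizer on a set of positive measure, then one of its finitely many conjugates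
  would lie in the stabilizer of a point with trivial holonomy, so \<open>F\<close> would have at most as many
  elements as \<open>H\<close>. But \<open>F\<close> contains a conjugate of \<open>H\<close>, so it would be equal to that conjugate,
  and its points would have trivial holonomy.\<close>

lemma finite_stab_class_null:
  assumes F: "finite F" and x: "x \<in> nontriv_holonomy" "stab x = F"
  shows "prob (stab_class F) = 0"
proof (rule ccontr)
  assume "prob (stab_class F) \<noteq> 0"
  then have pos: "prob (stab_class F) > 0" using measure_nonneg[of \<mu> "stab_class F"] by linarith
  have xX: "x \<in> topspace X" using x(1) unfolding nontriv_holonomy_def by blast
  have sF: "subgroup F G" and FG: "F \<subseteq> carrier G" using subgroup_stab[OF xX] stab_carrier x(2) by auto
  obtain x0 g0 where x0: "x0 \<in> topspace X" "g0 \<in> carrier G" "stab x0 = conjugate g0 H"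
    using generic_point .
  have "F \<subseteq> stab x" using x(2) by simp
  from stab_contains_conjugate[OF FG finite_conjugates_of_positive_class[OF sF pos] xX this x0(1)]
  obtain g where g: "g \<in> carrier G" "conjugate g F \<subseteq> conjugate g0 H" unfolding x0(3) .
  have "card F \<le> card H"
    using card_mono[OF _ g(2)] finite_H card_conjugate[OF g(1) FG] card_conjugate[OF x0(2) H_carrier]
    by (simp add: conjugate_def)
  moreover obtain k where k: "k \<in> carrier G" "conjugate k H \<subseteq> F"
    using conjugate_H_subset_stab[OF xX] x(2) by blast
  ultimately have "conjugate k H = F"
    using card_seteq[OF F k(2)] card_conjugate[OF k(1) H_carrier] by simp
  then have "trivial_holonomy G X \<phi> x" using holonomy_iff[OF xX] x(2) k(1) by blast
  then show False using x(1) unfolding nontriv_holonomy_def by blast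
qed

text \<open>A countable group has only countably many finite subgroups.\<close>

lemma finite_stab_with_holonomy_null:
  assumes S: "S \<in> sets \<mu>" "S \<subseteq> nontriv_holonomy" "\<And>x. x \<in> S \<Longrightarrow> finite (stab x)"
  shows "prob S = 0"
proof -
  let ?\<F> = "stab ` S"
  have "?\<F> \<subseteq> {A. finite A \<and> A \<subseteq> carrier G}" using S(3) stab_carrier by blast
  then have cF: "countable ?\<F>"
    using countable_Collect_finite_subset[OF countable_carrier] countable_subset by blast
  have "stab_class F \<in> null_sets \<mu>" if F: "F \<in> ?\<F>" for F
  proof -
    obtain x where x: "x \<in> S" "stab x = F" using F by blast
    then have "x \<in> topspace X" using S(2) unfolding nontriv_holonomy_def by blast
    then have "stab_class F \<in> sets \<mu>" using stab_class_measurable subgroup_stab x(2) by blast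
    moreover have "prob (stab_class F) = 0" using finite_stab_class_null x S(2,3) by blast
    ultimately show ?thesis by (simp add: null_sets_def emeasure_eq_measure)
  qed
  then have "(\<Union>F\<in>?\<F>. stab_class F) \<in> null_sets \<mu>" by (rule null_sets_UN'[OF cF])
  moreover have "S \<subseteq> (\<Union>F\<in>?\<F>. stab_class F)"
    using S(2) unfolding stab_class_def nontriv_holonomy_def by blast
  ultimately have "S \<in> null_sets \<mu>" by (rule null_sets_subset[OF _ S(1)])
  then show ?thesis by (simp add: null_sets_def emeasure_eq_measure)
qed

text \<open>The points of the fixed point set of \<open>H\<close> that the restricted action of \<open>L\<close> still recognizes as
  having a stabilizer larger than \<open>H\<close>.\<close>

definition stab_outside_H :: "'a set \<Rightarrow> 'x set" where
  "stab_outside_H L = fixed_set H \<inter> (\<Union>l\<in>L - H. fixed_points l)"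

lemma stab_outside_H_measurable:
  assumes "subgroup L G"
  shows "stab_outside_H L \<in> sets \<mu>"
proof -
  have "(\<Union>l\<in>L - H. fixed_points l) \<in> sets \<mu>"
    using countable_subset[OF subgroup.subset[OF assms] countable_carrier] subgroup.mem_carrier[OF assms]
      closedin_measurable closedin_fixed_points
    by (intro sets.countable_UN') auto
  then show ?thesis unfolding stab_outside_H_def
    using closedin_measurable[OF closedin_fixed_set[OF H_carrier]] by blast
qed

text \<open>Restricting to \<open>L\<close> must not make the action essentially free. Where \<open>L\<close> meets the stabilizer only
  inside \<open>H\<close>, the stabilizer is finite, since \<open>L\<close> has finite index, and nontrivial holonomy with a
  finite stabilizer has measure zero. The points with nontrivial holonomy are reached from those
  fixed by \<open>H\<close> by countably many translations.\<close>

lemma stab_outside_H_not_null: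
  assumes fi: "finite_index G L" and pos: "prob nontriv_holonomy > 0"
  shows "prob (stab_outside_H L) > 0"
proof (rule ccontr)
  assume neg: "\<not> prob (stab_outside_H L) > 0"
  have sL: "subgroup L G" using fi unfolding finite_index_def by blast
  let ?Y = "fixed_set H"
  have Y: "?Y \<in> sets \<mu>" by (rule closedin_measurable[OF closedin_fixed_set[OF H_carrier]])
  have BX: "nontriv_holonomy \<subseteq> topspace X" unfolding nontriv_holonomy_def by blast
  let ?S = "(nontriv_holonomy \<inter> ?Y) - stab_outside_H L"
  have S: "?S \<in> sets \<mu>" using nontriv_holonomy_measurable Y stab_outside_H_measurable[OF sL] by blast
  have "finite (stab x)" if x: "x \<in> ?S" for x
  proof -
    have xX: "x \<in> topspace X" using x BX by blast
    have "L \<inter> stab x \<subseteq> H"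
      using x mem_stab[OF xX] unfolding stab_outside_H_def by blast
    then show ?thesis
      using finite_subgroup_if_finite_Int[OF fi subgroup_stab[OF xX]] finite_H finite_subset by blast
  qed
  then have "prob ?S = 0" by (intro finite_stab_with_holonomy_null[OF S]) auto
  moreover have "prob (stab_outside_H L) = 0" using neg measure_nonneg[of \<mu> "stab_outside_H L"] by linarith
  ultimately have "?S \<in> null_sets \<mu>" "stab_outside_H L \<in> null_sets \<mu>"
    using S stab_outside_H_measurable[OF sL] by (simp_all add: null_sets_def emeasure_eq_measure)
  then have "?S \<union> stab_outside_H L \<in> null_sets \<mu>" by blast
  then have "nontriv_holonomy \<inter> ?Y \<in> null_sets \<mu>"
    by (rule null_sets_subset) (use nontriv_holonomy_measurable Y in auto)
  then have "\<phi> g ` (nontriv_holonomy \<inter> ?Y) \<in> null_sets \<mu>" if "g \<in> carrier G" for g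
    using that sets_measure_act_image emeasure_act_image unfolding null_sets_def by simp
  then have "(\<Union>g\<in>carrier G. \<phi> g ` (nontriv_holonomy \<inter> ?Y)) \<in> null_sets \<mu>"
    by (rule null_sets_UN'[OF countable_carrier])
  moreover have "nontriv_holonomy \<subseteq> (\<Union>g\<in>carrier G. \<phi> g ` (nontriv_holonomy \<inter> ?Y))"
  proof
    fix x assume x: "x \<in> nontriv_holonomy"
    then have xX: "x \<in> topspace X" using BX by blast
    obtain g where g: "g \<in> carrier G" "conjugate g H \<subseteq> stab x"
      using conjugate_H_subset_stab[OF xX] .
    let ?y = "\<phi> (inv g) x"
    have y: "?y \<in> topspace X" "\<phi> g ?y = x" using g(1) xX by (simp_all add: act_closed act_inv)
    have "x \<in> \<phi> g ` ?Y"
      unfolding act_image_fixed_set[OF g(1) H_carrier] using g(2) xX by (simp add: fixed_set_def)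
    then have "?y \<in> ?Y" unfolding mem_act_image[OF g(1) xX fixed_set_subset] .
    moreover have "?y \<in> nontriv_holonomy"
      using x y trivial_holonomy_act[OF g(1) y(1)] unfolding nontriv_holonomy_def by auto
    ultimately show "x \<in> (\<Union>g\<in>carrier G. \<phi> g ` (nontriv_holonomy \<inter> ?Y))"
      using g(1) y(2) by (intro UN_I[of g] image_eqI[of _ _ ?y]) auto
  qed
  ultimately have "nontriv_holonomy \<in> null_sets \<mu>" by (rule null_sets_subset[OF _ nontriv_holonomy_measurable])
  then show False using pos by (simp add: null_sets_def emeasure_eq_measure)
qed

text \<open>If \<open>x\<close> and \<open>y\<close> are fixed by \<open>H\<close> and \<open>x = gy\<close>, then \<open>g\<close> normalizes \<open>H\<close>, and so conjugation by \<open>g\<close>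
  preserves the complement of \<open>H\<close> in \<open>L\<close>.\<close>

lemma saturation_stab_outside_H:
  assumes L: "L \<lhd> G"
  shows "fixed_set H \<inter> saturation (stab_outside_H L) \<subseteq> stab_outside_H L"
proof
  fix x assume x: "x \<in> fixed_set H \<inter> saturation (stab_outside_H L)"
  then have xX: "x \<in> topspace X" and Hx: "H \<subseteq> stab x" unfolding fixed_set_def by auto
  obtain g y where g: "g \<in> carrier G" "y \<in> stab_outside_H L" "x = \<phi> g y"
    using x unfolding saturation_def by blast
  obtain l where l: "l \<in> L" "l \<notin> H" "y \<in> fixed_points l" and y: "y \<in> topspace X" "H \<subseteq> stab y"
    using g(2) unfolding stab_outside_H_def fixed_set_def by blast
  have lG: "l \<in> carrier G" using l(1) subgroup.mem_carrier[OF normal_imp_subgroup[OF L]] by blast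
  have "conjugate g H \<subseteq> stab x" unfolding g(3) stab_act[OF g(1) y(1)] using y(2)
    unfolding conjugate_def by blast
  then have H: "conjugate g H = H" by (rule conjugate_H_in_stab_unique[OF xX Hx g(1)])
  let ?m = "g \<otimes> l \<otimes> inv g"
  have "?m \<in> L" by (rule normal.inv_op_closed2[OF L g(1) l(1)])
  moreover have "?m \<notin> H"
  proof
    assume "?m \<in> H"
    then obtain h where h: "h \<in> H" "?m = g \<otimes> h \<otimes> inv g" using H unfolding conjugate_def by blast
    then have "l = h" using conj_eq_iff[OF g(1) lG] H_carrier by blast
    with h(1) l(2) show False by simp
  qed
  moreover have "x \<in> fixed_points ?m" using fixed_points_conj_iff[OF g(1) lG y(1)] l(3) g(3) by simp
  ultimately show "x \<in> stab_outside_H L" using x unfolding stab_outside_H_def by blast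
qed

text \<open>Since \<open>L\<close> normalizes \<open>H\<close>, the component of a point fixed by \<open>H\<close> consists of points fixed by \<open>H\<close>. So
  the action of \<open>L\<close> on it factors through \<open>p\<close>, whose kernel is \<open>L \<inter> H\<close>, and the image of \<open>p\<close> has finite
  index in \<open>G\<close>. This action of the image is topologically free because generic stabilizers are
  equal to \<open>H\<close> there, and it is not essentially free because elements of \<open>L\<close> outside \<open>H\<close> fix a set
  of positive measure.\<close>

theorem essential_holonomy_imp_allosteric:
  assumes fg: "finitely_generated G"
    and comm: "commensurable ((G\<lparr>carrier := normalizer G H\<rparr>) Mod H) (G\<lparr>carrier := normalizer G H\<rparr>)"
    and pos: "prob nontriv_holonomy > 0"
  shows "allosteric G"
proof -
  obtain L p where L: "L \<lhd> G" "finite_index G L" "L \<subseteq> normalizer G H"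
    and p: "p \<in> hom (G\<lparr>carrier := L\<rparr>) G" "\<And>l. l \<in> L \<Longrightarrow> p l = \<one> \<longleftrightarrow> l \<in> H"
    and fip: "finite_index G (p ` L)"
    using finite_index_hom_with_kernel[OF subgroup_H almost_normal comm] by blast
  let ?L = "G\<lparr>carrier := L\<rparr>"
  let ?Y = "fixed_set H"
  have sL: "subgroup L G" by (rule normal_imp_subgroup[OF L(1)])
  interpret L: continuous_action ?L X \<phi> by (rule subgroup_action[OF sL])
  have Yc: "closedin X ?Y" by (rule closedin_fixed_set[OF H_carrier])
  have Yinv: "invariant_set ?L \<phi> ?Y"
  proof (rule L.invariant_setI[OF fixed_set_subset])
    fix l x assume l: "l \<in> carrier ?L" and x: "x \<in> ?Y"
    have "l \<in> carrier G" "conjugate l H = H" using l L(3) normalizer_conjugate[OF subgroup_H] by auto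
    then have "\<phi> l ` ?Y = ?Y" using act_image_fixed_set[of l H] H_carrier by simp
    then show "\<phi> l x \<in> ?Y" using imageI[OF x, of "\<phi> l"] by simp
  qed
  have E: "stab_outside_H L \<in> sets \<mu>" "prob (stab_outside_H L) > 0"
    using stab_outside_H_measurable[OF sL] stab_outside_H_not_null[OF L(2) pos] .
  then have "stab_outside_H L \<noteq> {}" by auto
  then obtain y where y: "y \<in> ?Y" unfolding stab_outside_H_def by blast
  then have yX: "y \<in> topspace X" using fixed_set_subset by blast
  obtain Z A \<nu> where Z: "y \<in> Z" "closedin X Z" "openin X Z" "invariant_set ?L \<phi> Z"
    and Zmin: "\<forall>C. closedin X C \<and> invariant_set ?L \<phi> C \<and> y \<in> C \<longrightarrow> Z \<subseteq> C"
    and ergZ: "ergodic_action ?L (subtopology X Z) \<phi> \<nu>"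
    and A: "A \<in> sets \<mu>" "A \<subseteq> Z" "prob A > 0"
    and \<nu>: "\<forall>B\<in>sets \<mu>. B \<subseteq> Z \<longrightarrow> emeasure \<nu> B = emeasure \<mu> (A \<inter> B) / emeasure \<mu> A"
    using restrict_to_component[OF L(2,1) yX] .
  interpret Z: ergodic_action ?L "subtopology X Z" \<phi> \<nu> by (rule ergZ)
  have ZX: "Z \<subseteq> topspace X" by (rule closedin_subset[OF Z(2)])
  have topZ: "topspace (subtopology X Z) = Z" using ZX by auto
  have ZY: "Z \<subseteq> ?Y" using Zmin Yc Yinv y by blast
  have HZ: "H \<subseteq> stab x" if "x \<in> Z" for x using that ZY unfolding fixed_set_def by blast

  (* Almost every point of A is a translate of a point of stab_outside_H L, and hence belongs to it. *)
  have "\<exists>l\<in>L - H. prob (A \<inter> fixed_points l) > 0"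
  proof (rule ccontr)
    assume neg: "\<not> (\<exists>l\<in>L - H. prob (A \<inter> fixed_points l) > 0)"
    have "A \<inter> fixed_points l \<in> null_sets \<mu>" if l: "l \<in> L - H" for l
    proof -
      have "l \<in> carrier G" using l subgroup.mem_carrier[OF sL] by blast
      then have "A \<inter> fixed_points l \<in> sets \<mu>"
        using A(1) closedin_measurable[OF closedin_fixed_points] by blast
      moreover have "\<not> prob (A \<inter> fixed_points l) > 0" using neg l by blast
      then have "prob (A \<inter> fixed_points l) = 0"
        using measure_nonneg[of \<mu> "A \<inter> fixed_points l"] by linarith
      ultimately show ?thesis by (simp add: null_sets_def emeasure_eq_measure)
    qed
    moreover have "countable (L - H)"
      using countable_subset[OF subgroup.subset[OF sL] countable_carrier] by blast
    ultimately have N: "(\<Union>l\<in>L - H. A \<inter> fixed_points l) \<in> null_sets \<mu>" by (intro null_sets_UN')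
    have "AE x in \<mu>. x \<in> saturation (stab_outside_H L)"
      using measure_saturation[OF E] prob_eq_1[OF saturation_measurable[OF E(1)]] by simp
    moreover have "AE x in \<mu>. x \<notin> (\<Union>l\<in>L - H. A \<inter> fixed_points l)" by (rule AE_not_in[OF N])
    ultimately have "AE x in \<mu>. x \<notin> A"
    proof eventually_elim
      case (elim x)
      show ?case
      proof
        assume x: "x \<in> A"
        then have "x \<in> stab_outside_H L" using saturation_stab_outside_H[OF L(1)] elim(1) A(2) ZY by blast
        then show False using elim(2) x unfolding stab_outside_H_def by blast
      qed
    qed
    then have "prob A = 0" using prob_eq_0[OF A(1)] by simp
    with A(3) show False by simp
  qed
  then obtain l where l: "l \<in> L" "l \<notin> H" "prob (A \<inter> fixed_points l) > 0" by blast

  have kernel: "\<phi> g x = x" if "g \<in> L" "p g = \<one>" "x \<in> Z" for g x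
    using that p(2) HZ[of x] ZX mem_stab[of x g] unfolding fixed_points_def by blast
  have "\<exists>\<psi>. ergodic_action (G\<lparr>carrier := p ` L\<rparr>) (subtopology X Z) \<psi> \<nu> \<and>
      (\<forall>g\<in>L. \<forall>x\<in>Z. \<psi> (p g) x = \<phi> g x)"
  proof (rule Z.factor_action[OF is_group p(1)])
    fix g x assume "g \<in> carrier ?L" "p g = \<one>" "x \<in> topspace (subtopology X Z)"
    then show "\<phi> g x = x" using kernel topZ by simp
  next
    fix \<psi>
    assume "ergodic_action (G\<lparr>carrier := p ` carrier ?L\<rparr>) (subtopology X Z) \<psi> \<nu>"
      and "\<And>g x. g \<in> carrier ?L \<Longrightarrow> x \<in> topspace (subtopology X Z) \<Longrightarrow> \<psi> (p g) x = \<phi> g x"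
    then show ?thesis unfolding topZ by (intro exI[of _ \<psi>]) simp
  qed
  then obtain \<psi> where \<psi>: "ergodic_action (G\<lparr>carrier := p ` L\<rparr>) (subtopology X Z) \<psi> \<nu>"
    "\<forall>g\<in>L. \<forall>x\<in>Z. \<psi> (p g) x = \<phi> g x" by blast
  interpret P: ergodic_action "G\<lparr>carrier := p ` L\<rparr>" "subtopology X Z" \<psi> \<nu> by (rule \<psi>(1))
  have fixP: "P.fixed_points (p g) = Z \<inter> fixed_points g" if "g \<in> L" for g
    unfolding P.fixed_points_def fixed_points_def topZ using bspec[OF \<psi>(2) that] ZX by auto
  have "allosteric_action (G\<lparr>carrier := p ` L\<rparr>) (subtopology X Z) \<psi> \<nu>"
  proof unfold_locales
    fix k assume k: "k \<in> carrier (G\<lparr>carrier := p ` L\<rparr>)" "k \<noteq> \<one>\<^bsub>G\<lparr>carrier := p ` L\<rparr>\<^esub>"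
    then obtain g where g: "g \<in> L" "k = p g" "g \<notin> H" using p(2) by auto
    define V where "V = subtopology X Z interior_of P.fixed_points k"
    have VO: "openin X V" unfolding V_def by (rule openin_trans_full[OF openin_interior_of Z(3)])
    have V: "V \<subseteq> Z" "V \<subseteq> fixed_points g"
      using interior_of_subset[of "subtopology X Z" "P.fixed_points k"]
      unfolding V_def g(2) fixP[OF g(1)] by auto
    have "V = {}"
    proof (rule ccontr)
      assume "V \<noteq> {}"
      then obtain x where x: "x \<in> V" "trivial_holonomy G X \<phi> x"
        using trivial_holonomy_dense[OF VO] by blast
      then have xX: "x \<in> topspace X" and xZ: "x \<in> Z" using V(1) ZX by auto
      obtain h where h: "h \<in> carrier G" "stab x = conjugate h H" using holonomy_iff[OF xX] x(2) by blast
      have "stab x = H" using conjugate_H_in_stab_unique[OF xX HZ[OF xZ] h(1)] h(2) by simp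
      moreover have "g \<in> stab x"
        using x(1) V(2) mem_stab[OF xX] g(1) subgroup.mem_carrier[OF sL] by blast
      ultimately show False using g(3) by simp
    qed
    then show "subtopology X Z interior_of P.fixed_points k = {}" unfolding V_def .
  next
    have lG: "l \<in> carrier G" using l(1) subgroup.mem_carrier[OF sL] by blast
    have F: "Z \<inter> fixed_points l \<in> sets \<mu>"
      using closedin_measurable[OF Z(2)] closedin_measurable[OF closedin_fixed_points[OF lG]] by blast
    have "A \<inter> (Z \<inter> fixed_points l) = A \<inter> fixed_points l" using A(2) by blast
    then have "emeasure \<nu> (P.fixed_points (p l)) = ennreal (prob (A \<inter> fixed_points l) / prob A)"
      using bspec[OF \<nu> F] A(3) fixP[OF l(1)] by (simp add: emeasure_eq_measure divide_ennreal)
    then have "measure \<nu> (P.fixed_points (p l)) > 0" using l(3) A(3) by (simp add: measure_def)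
    then show "\<exists>k\<in>carrier (G\<lparr>carrier := p ` L\<rparr>). k \<noteq> \<one>\<^bsub>G\<lparr>carrier := p ` L\<rparr>\<^esub>
        \<and> measure \<nu> (P.fixed_points k) > 0"
      using l p(2) by auto
  qed
  then show ?thesis by (rule allosteric_from_finite_index[OF countable_carrier fg fip])
qed

text \<open>Almost every point belongs to one of countably many classes.\<close>

lemma positive_stab_class:
  assumes null: "nontriv_holonomy \<in> null_sets \<mu>"
  obtains g where "g \<in> carrier G" "prob (stab_class (conjugate g H)) > 0"
proof (rule ccontr)
  assume "\<not> thesis"
  then have neg: "\<forall>g\<in>carrier G. \<not> prob (stab_class (conjugate g H)) > 0" using that by blast
  have "stab_class (conjugate g H) \<in> null_sets \<mu>" if g: "g \<in> carrier G" for g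
  proof -
    have "prob (stab_class (conjugate g H)) = 0"
      using bspec[OF neg g] measure_nonneg[of \<mu> "stab_class (conjugate g H)"] by linarith
    then show ?thesis
      using stab_class_measurable[OF subgroup_conjugate[OF g]] by (simp add: null_sets_def emeasure_eq_measure)
  qed
  then have "(\<Union>g\<in>carrier G. stab_class (conjugate g H)) \<in> null_sets \<mu>"
    by (rule null_sets_UN'[OF countable_carrier])
  then have "(topspace X - nontriv_holonomy) \<union> nontriv_holonomy \<in> null_sets \<mu>" using null unfolding good_eq by blast
  moreover have "(topspace X - nontriv_holonomy) \<union> nontriv_holonomy = space \<mu>" unfolding space_measure nontriv_holonomy_def by blast
  ultimately show False using prob_space by (simp add: null_sets_def emeasure_eq_measure)
qed

end

section \<open>Stabilizers at almost every point\<close>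

theorem theorem1p6:
  fixes G :: "('g, 'c) monoid_scheme"
    and X :: "'x topology"
    and \<phi> :: "'g \<Rightarrow> 'x \<Rightarrow> 'x"
    and \<mu> :: "'x measure"
    and H :: "'g set"
  assumes "minimal_system G X \<phi>"
    and "ergodic_measure G X \<phi> \<mu>"
    and "subgroup H G" and "finite H" and "almost_normal G H"
    and "\<forall>x\<in>topspace X. trivial_holonomy G X \<phi> x \<longleftrightarrow>
           (\<exists>g\<in>carrier G. stabilizer G \<phi> x = g <#\<^bsub>G\<^esub> H #>\<^bsub>G\<^esub> inv\<^bsub>G\<^esub> g)"
    and "\<not> allosteric G"
    and "commensurable ((G\<lparr>carrier := normalizer G H\<rparr>) Mod H) (G\<lparr>carrier := normalizer G H\<rparr>)"
  shows "(prob_space (IRS G \<phi> \<mu>) \<and> atomic (IRS G \<phi> \<mu>)) \<and>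
         (measure (IRS G \<phi> \<mu>) (stabilizer_URS G X \<phi>) = 1 \<and> no_essential_holonomy G X \<phi> \<mu>)"
proof -
  interpret minimal_action G X \<phi> by (rule minimal_system_imp_minimal_action[OF assms(1)])
  have fg: "finitely_generated G"
    using assms(1) unfolding minimal_system_def dynamical_system_def by blast
  interpret finite_stabilizer_system G X \<phi> \<mu> H
  proof unfold_locales
    show "finite_index G (normalizer G H)" using assms(5) unfolding almost_normal_def by blast
    show "trivial_holonomy G X \<phi> x \<longleftrightarrow> (\<exists>g\<in>carrier G. stab x = conjugate g H)"
      if "x \<in> topspace X" for x
      using assms(6) that unfolding coset_conjugate by blast
  qed (use assms(2,4) assms(3)[unfolded subgroup_def] in auto)
  have "\<not> prob nontriv_holonomy > 0"
    using essential_holonomy_imp_allosteric[OF fg assms(8)] assms(7) by blast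
  then have "prob nontriv_holonomy = 0" using measure_nonneg[of \<mu> nontriv_holonomy] by linarith
  then have null: "nontriv_holonomy \<in> null_sets \<mu>"
    using nontriv_holonomy_measurable by (simp add: null_sets_def emeasure_eq_measure)
  have good: "AE x in \<mu>. trivial_holonomy G X \<phi> x"
    by (rule AE_I'[OF null]) (auto simp: space_measure nontriv_holonomy_def)
  have meas: "stab \<in> measurable \<mu> (borel_of (chabauty_fell G))"
    using stabilizer_measurable measurable_cong_sets[OF sets_measure refl] by blast
  have ps: "prob_space (IRS G \<phi> \<mu>)" unfolding IRS_def by (rule prob_space_distr[OF meas])
  have atomic: "atomic (IRS G \<phi> \<mu>)"
  proof -
    obtain g where g: "g \<in> carrier G" "prob (stab_class (conjugate g H)) > 0"
      using positive_stab_class[OF null] .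
    let ?K = "conjugate g H"
    have K: "subgroup ?K G" by (rule subgroup_conjugate[OF g(1)])
    have "stab -` {?K} \<inter> space \<mu> = stab_class ?K" unfolding space_measure stab_class_def by blast
    then have "measure (IRS G \<phi> \<mu>) {?K} = prob (stab_class ?K)"
      unfolding IRS_def
      using measure_distr[OF meas singleton_sets_chabauty_fell[OF countable_carrier K]] by simp
    moreover have "?K \<in> space (IRS G \<phi> \<mu>)"
      unfolding IRS_def using K by (simp add: space_borel_of topspace_chabauty_fell)
    ultimately show ?thesis unfolding atomic_def using g(2) by (intro bexI[of _ ?K]) simp_all
  qed
  have URS: "measure (IRS G \<phi> \<mu>) (stabilizer_URS G X \<phi>) = 1"
  proof -
    let ?S = "stabilizer_URS G X \<phi>"
    have "closedin (chabauty_fell G) ?S" unfolding stabilizer_URS_def by (rule closedin_closure_of)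
    then have S: "?S \<in> sets (borel_of (chabauty_fell G))" by (rule closedin_sets_borel_of)
    have "stab ` {x \<in> topspace X. trivial_holonomy G X \<phi> x} \<subseteq> ?S"
      unfolding stabilizer_URS_def
      using subgroup_stab by (intro closure_of_subset) (auto simp: topspace_chabauty_fell)
    then have "AE x in \<mu>. x \<in> stab -` ?S \<inter> space \<mu>"
      by (intro AE_mp[OF good AE_I2]) (auto simp: space_measure)
    then have "prob (stab -` ?S \<inter> space \<mu>) = 1"
      using prob_eq_1[OF measurable_sets[OF meas S]] by simp
    then show ?thesis unfolding IRS_def using measure_distr[OF meas S] by simp
  qed
  show ?thesis using ps atomic URS good unfolding no_essential_holonomy_def by blast
qed

end
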